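(* Let $G$ be a Garside group. (i) (Basis problem for abelian subgroups) There is a finite-time algorithm that, given a collection $h_1,\ldots,h_n$ of mutually commuting elements of $G$, finds a basis of the subgroup generated by $h_1,\ldots,h_n$. (ii) (Membership problem for abelian subgroups) There is a finite-time algorithm that, given an element $g$ of $G$ and a finite collection $h_1,\ldots,h_n$ of mutually commuting elements of $G$, decides whether $g$ belongs to the subgroup generated by $h_1,\ldots,h_n$. (iii) (Conjugacy membership problem for abelian subgroups) There is a finite-time algorithm that, given an element $g$ of $G$ and a finite collection $h_1,\ldots,h_n$ of mutually commuting elements of $G$, decides whether $g$ is conjugate (in $G$) to an element of the subgroup generated by $h_1,\ldots,h_n$. (iv) (Equality problem for abelian subgroups) There is a finite-time algorithm that, given two finite collections $\{h_1,\ldots,h_n\}$ and $\{h_1',\ldots,h_m'\}$ of mutually commuting elements of $G$, decides whether they generate the same subgroup. (v) (Conjugacy problem for abelian subgroups) There is a finite-time algorithm that, given two finite collections $\{h_1,\ldots,h_n\}$ and $\{h_1',\ldots,h_m'\}$ of mutually commuting elements of $G$, decides whether they generate conjugate subgroups of $G$.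
   Context: Garside groups. Let $M$ be a monoid. An atom is an element $a\in M\setminus\{1\}$ such that $a=bc$ implies $b=1$ or $c=1$. For $a\in M$, $|a|_{\max}$ is the supremum of the lengths of all expressions of $a$ in terms of atoms. $M$ is atomic if it is generated by its atoms and $|a|_{\max}<\infty$ for all $a\in M$. In an atomic monoid, $a\le_L b$ means $ac=b$ for some $c\in M$, and $a\le_R b$ means $ca=b$ for some $c\in M$; these are partial orders. A finitely generated monoid $M$ is a Garside monoid if it is atomic, left and right cancellative, the posets $(M,\le_L)$ and $(M,\le_R)$ are lattices, and there is an element $\Delta\in M$ (a Garside element) such that for every $a\in M$, $a\le_L\Delta$ iff $a\le_R\Delta$, and $\mathcal D=\{a\in M: a\le_L\Delta\}$ generates $M$. A Garside group $G$ is the group of fractions of a Garside monoid $M$; it is generated by the finite set $\mathcal D$ of simple elements. A subset $\{g_1,\ldots,g_n\}$ of an abelian group is linearly independent if $g_1^{c_1}\cdots g_n^{c_n}=1$ with $c_i\in\mathbb Z$ implies $c_1=\cdots=c_n=0$; it is a basis if it is a linearly independent set of generators. The Garside group $G$ (with its Garside structure) is fixed, elements of $G$ are given as words in $\mathcal D\cup\mathcal D^{-1}$, and a finite-time algorithm is one that terminates after finitely many steps on every admissible input with the correct output. In (iv) and (v) the elements within each collection commute with each other (elements of different collections need not commute). *)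

theory Defs
  imports "HOL-Algebra.Algebra" "HOL-Library.Extended_Nat" "HOL-Library.Nat_Bijection"
begin

section \<open>Garside monoids and Garside groups\<close>

abbreviation word_prod :: "('m, 'r) monoid_scheme \<Rightarrow> 'm list \<Rightarrow> 'm" where
  "word_prod M xs \<equiv> foldr (\<lambda>x y. x \<otimes>\<^bsub>M\<^esub> y) xs \<one>\<^bsub>M\<^esub>"

definition monoid_generates :: "('m, 'r) monoid_scheme \<Rightarrow> 'm set \<Rightarrow> bool" where
  "monoid_generates M S \<longleftrightarrow> S \<subseteq> carrier M \<and> carrier M = {word_prod M xs | xs. set xs \<subseteq> S}"

definition atoms :: "('m, 'r) monoid_scheme \<Rightarrow> 'm set" where
  "atoms M = {a \<in> carrier M - {\<one>\<^bsub>M\<^esub>}.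
     \<forall>b \<in> carrier M. \<forall>c \<in> carrier M. a = b \<otimes>\<^bsub>M\<^esub> c \<longrightarrow> b = \<one>\<^bsub>M\<^esub> \<or> c = \<one>\<^bsub>M\<^esub>}"

definition max_len :: "('m, 'r) monoid_scheme \<Rightarrow> 'm \<Rightarrow> enat" where
  "max_len M a = (SUP xs \<in> {xs. set xs \<subseteq> atoms M \<and> word_prod M xs = a}. enat (length xs))"

definition atomic_monoid :: "('m, 'r) monoid_scheme \<Rightarrow> bool" where
  "atomic_monoid M \<longleftrightarrow> monoid_generates M (atoms M) \<and> (\<forall>a \<in> carrier M. max_len M a < \<infinity>)"

definition le_L :: "('m, 'r) monoid_scheme \<Rightarrow> 'm \<Rightarrow> 'm \<Rightarrow> bool" where
  "le_L M a b \<longleftrightarrow> (\<exists>c \<in> carrier M. a \<otimes>\<^bsub>M\<^esub> c = b)"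

definition le_R :: "('m, 'r) monoid_scheme \<Rightarrow> 'm \<Rightarrow> 'm \<Rightarrow> bool" where
  "le_R M a b \<longleftrightarrow> (\<exists>c \<in> carrier M. c \<otimes>\<^bsub>M\<^esub> a = b)"

definition simples :: "('m, 'r) monoid_scheme \<Rightarrow> 'm \<Rightarrow> 'm set" where
  "simples M \<Delta> = {a \<in> carrier M. le_L M a \<Delta>}"

locale garside_monoid = monoid_cancel M for M (structure) +
  fixes \<Delta>
  assumes finitely_generated: "\<exists>S. finite S \<and> monoid_generates M S"
    and atomic: "atomic_monoid M"
    and lattice_L: "Lattice.lattice \<lparr>carrier = carrier M, eq = (=), le = le_L M\<rparr>"
    and lattice_R: "Lattice.lattice \<lparr>carrier = carrier M, eq = (=), le = le_R M\<rparr>"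
    and \<Delta>_closed: "\<Delta> \<in> carrier M"
    and balanced: "a \<in> carrier M \<Longrightarrow> le_L M a \<Delta> \<longleftrightarrow> le_R M a \<Delta>"
    and simples_generate: "monoid_generates M (simples M \<Delta>)"

text \<open>The group of fractions comes with its embedding \<open>\<iota>\<close> of the monoid. Left fractions
  suffice: in a Garside monoid any two elements have a common right multiple, so every left
  fraction is also a right fraction.\<close>

locale garside_group = garside_monoid M \<Delta> + G: group G
  for M (structure) and \<Delta> and G (structure) and \<iota> +
  assumes embedding_hom: "\<iota> \<in> hom M G"
    and embedding_inj: "inj_on \<iota> (carrier M)"
    and fractions: "carrier G = {inv\<^bsub>G\<^esub> (\<iota> a) \<otimes>\<^bsub>G\<^esub> \<iota> b | a b. a \<in> carrier M \<and> b \<in> carrier M}"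

context garside_monoid
begin

lemma word_prod_closed: "set xs \<subseteq> carrier M \<Longrightarrow> word_prod M xs \<in> carrier M"
  by (induction xs) auto

lemma word_prod_append:
  "set xs \<subseteq> carrier M \<Longrightarrow> set ys \<subseteq> carrier M \<Longrightarrow>
    word_prod M (xs @ ys) = word_prod M xs \<otimes> word_prod M ys"
  by (induction xs) (auto simp: m_assoc word_prod_closed)

lemma atom_in_generators:
  "set xs \<subseteq> carrier M \<Longrightarrow> word_prod M xs \<in> atoms M \<Longrightarrow> word_prod M xs \<in> set xs"
proof (induction xs)
  case Nil
  then show ?case by (simp add: atoms_def)
next
  case (Cons x xs)
  have c: "x \<in> carrier M" "word_prod M xs \<in> carrier M"
    using Cons.prems word_prod_closed by auto
  have "x = \<one> \<or> word_prod M xs = \<one>"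
    using Cons.prems(2) c unfolding atoms_def by auto
  then show ?case
    using Cons c by auto
qed

lemma finite_atoms: "finite (atoms M)"
proof -
  obtain S where S: "finite S" "monoid_generates M S"
    using finitely_generated by blast
  have "atoms M \<subseteq> S"
  proof
    fix a assume a: "a \<in> atoms M"
    then have "a \<in> carrier M" by (simp add: atoms_def)
    then obtain xs where "set xs \<subseteq> S" "a = word_prod M xs"
      using S(2) unfolding monoid_generates_def by blast
    then show "a \<in> S"
      using a atom_in_generators[of xs] S(2) unfolding monoid_generates_def by blast
  qed
  then show ?thesis using S(1) finite_subset by blast
qed

lemma finite_simples: "finite (simples M \<Delta>)"
proof -
  have gen: "carrier M = {word_prod M xs | xs. set xs \<subseteq> atoms M}"
    and atoms_closed: "atoms M \<subseteq> carrier M"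
    using atomic unfolding atomic_monoid_def monoid_generates_def by blast+
  obtain N where N: "max_len M \<Delta> = enat N"
    using atomic \<Delta>_closed unfolding atomic_monoid_def by fastforce
  have "simples M \<Delta> \<subseteq> word_prod M ` {xs. set xs \<subseteq> atoms M \<and> length xs \<le> N}"
  proof
    fix d assume "d \<in> simples M \<Delta>"
    then obtain c where d: "d \<in> carrier M" and c: "c \<in> carrier M" "d \<otimes> c = \<Delta>"
      unfolding simples_def le_L_def by blast
    obtain xs where xs: "set xs \<subseteq> atoms M" "d = word_prod M xs" using d gen by blast
    obtain ys where ys: "set ys \<subseteq> atoms M" "c = word_prod M ys" using c(1) gen by blast
    have "word_prod M (xs @ ys) = \<Delta>"
      using c(2) xs ys atoms_closed word_prod_append[of xs ys] by auto
    then have "enat (length (xs @ ys)) \<le> max_len M \<Delta>"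
      unfolding max_len_def using xs ys by (intro SUP_upper) auto
    then show "d \<in> word_prod M ` {xs. set xs \<subseteq> atoms M \<and> length xs \<le> N}"
      using N xs by auto
  qed
  moreover have "finite {xs. set xs \<subseteq> atoms M \<and> length xs \<le> N}"
    using finite_lists_length_le[OF finite_atoms] .
  ultimately show ?thesis using finite_subset by blast
qed

end

section \<open>Words in the simple elements and their inverses\<close>

text \<open>The letter \<open>(d, True)\<close> stands for \<open>\<iota> d\<close> and \<open>(d, False)\<close> for its inverse.\<close>

type_synonym 'm sword = "('m \<times> bool) list"

definition swords :: "('m, 'r) monoid_scheme \<Rightarrow> 'm \<Rightarrow> 'm sword set" where
  "swords M \<Delta> = lists (simples M \<Delta> \<times> UNIV)"

definition letter_val :: "('g, 's) monoid_scheme \<Rightarrow> ('m \<Rightarrow> 'g) \<Rightarrow> 'm \<times> bool \<Rightarrow> 'g" where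
  "letter_val G \<iota> = (\<lambda>(d, pos). if pos then \<iota> d else inv\<^bsub>G\<^esub> (\<iota> d))"

definition word_val :: "('g, 's) monoid_scheme \<Rightarrow> ('m \<Rightarrow> 'g) \<Rightarrow> 'm sword \<Rightarrow> 'g" where
  "word_val G \<iota> w = word_prod G (map (letter_val G \<iota>) w)"

definition commuting_words ::
  "('m, 'r) monoid_scheme \<Rightarrow> 'm \<Rightarrow> ('g, 's) monoid_scheme \<Rightarrow> ('m \<Rightarrow> 'g) \<Rightarrow> 'm sword list set" where
  "commuting_words M \<Delta> G \<iota> = {ws \<in> lists (swords M \<Delta>). \<forall>u \<in> set ws. \<forall>v \<in> set ws.
     word_val G \<iota> u \<otimes>\<^bsub>G\<^esub> word_val G \<iota> v = word_val G \<iota> v \<otimes>\<^bsub>G\<^esub> word_val G \<iota> u}"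

definition word_span :: "('g, 's) monoid_scheme \<Rightarrow> ('m \<Rightarrow> 'g) \<Rightarrow> 'm sword list \<Rightarrow> 'g set" where
  "word_span G \<iota> ws = generate G (word_val G \<iota> ` set ws)"

section \<open>Bases of abelian subgroups\<close>

text \<open>Linear independence is that of a family: a list with a repeated entry is dependent.\<close>

definition lin_indep :: "('g, 's) monoid_scheme \<Rightarrow> 'g list \<Rightarrow> bool" where
  "lin_indep G gs \<longleftrightarrow> (\<forall>cs :: int list. length cs = length gs \<longrightarrow>
     word_prod G (map2 (\<lambda>g c. g [^]\<^bsub>G\<^esub> c) gs cs) = \<one>\<^bsub>G\<^esub> \<longrightarrow> (\<forall>c \<in> set cs. c = 0))"

definition basis_of :: "('g, 's) monoid_scheme \<Rightarrow> 'g set \<Rightarrow> 'g list \<Rightarrow> bool" where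
  "basis_of G H gs \<longleftrightarrow> set gs \<subseteq> H \<and> generate G (set gs) = H \<and> lin_indep G gs"

section \<open>Algorithms\<close>

text \<open>Algorithms are partial recursive functions. Functions take argument lists of arbitrary
  length; those applied to too few arguments (e.g. \<open>Succ\<close> to the empty list) are undefined
  there, and surplus arguments of \<open>Succ\<close> are ignored. The minimisation \<open>Mu f\<close> searches on the
  first argument of \<open>f\<close> and requires all smaller values to be defined.\<close>

datatype recf = Zero | Succ | Proj nat | Comp recf "recf list" | PrimRec recf recf | Mu recf

inductive computes :: "recf \<Rightarrow> nat list \<Rightarrow> nat \<Rightarrow> bool" where
  Zero: "computes Zero xs 0"
| Succ: "computes Succ (x # xs) (Suc x)"
| Proj: "i < length xs \<Longrightarrow> computes (Proj i) xs (xs ! i)"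
| Comp: "length ys = length gs \<Longrightarrow> (\<And>i. i < length gs \<Longrightarrow> computes (gs ! i) xs (ys ! i)) \<Longrightarrow>
    computes f ys z \<Longrightarrow> computes (Comp f gs) xs z"
| PrimRec_0: "computes f xs z \<Longrightarrow> computes (PrimRec f g) (0 # xs) z"
| PrimRec_Suc: "computes (PrimRec f g) (n # xs) y \<Longrightarrow> computes g (n # y # xs) z \<Longrightarrow>
    computes (PrimRec f g) (Suc n # xs) z"
| Mu: "computes f (n # xs) 0 \<Longrightarrow> (\<And>i. i < n \<Longrightarrow> \<exists>y. computes f (i # xs) (Suc y)) \<Longrightarrow>
    computes (Mu f) xs n"

lemma computes_deterministic: "computes p xs y \<Longrightarrow> computes p xs z \<Longrightarrow> y = z"
proof (induction arbitrary: z rule: computes.induct)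
  case (Zero xs)
  then show ?case by (cases rule: computes.cases) auto
next
  case (Succ x xs)
  then show ?case by (cases rule: computes.cases) auto
next
  case (Proj i xs)
  from Proj.prems Proj.hyps show ?case by (cases rule: computes.cases) auto
next
  case (Comp ys gs xs f y)
  from Comp.prems obtain ys' where ys': "length ys' = length gs"
    "\<And>i. i < length gs \<Longrightarrow> computes (gs ! i) xs (ys' ! i)" "computes f ys' z"
    by (cases rule: computes.cases) auto
  have "ys = ys'"
    using Comp.hyps(1) Comp.IH(1) ys'(1,2) by (intro nth_equalityI) auto
  then show ?case using Comp.IH(2) ys'(3) by simp
next
  case (PrimRec_0 f xs z g)
  from PrimRec_0.prems PrimRec_0.IH show ?case by (cases rule: computes.cases) auto
next
  case (PrimRec_Suc f g n xs y w)
  from PrimRec_Suc.prems obtain y' where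
    "computes (PrimRec f g) (n # xs) y'" "computes g (n # y' # xs) z"
    by (cases rule: computes.cases) auto
  then show ?case using PrimRec_Suc.IH by metis
next
  case (Mu f n xs)
  from Mu.prems have m: "computes f (z # xs) 0" "\<And>i. i < z \<Longrightarrow> \<exists>y. computes f (i # xs) (Suc y)"
    by (cases rule: computes.cases; auto)+
  have "\<not> z < n" using Mu.IH(2) m(1) by fastforce
  moreover have "\<not> n < z" using Mu.IH(1) m(2) by fastforce
  ultimately show ?case by simp
qed

text \<open>Words are presented to an algorithm through a numbering \<open>\<nu>\<close> of the simple elements. These
  are finite in number (\<open>finite_simples\<close>), so any two injective numberings
  translate into each other computably.\<close>

definition word_code :: "('m \<Rightarrow> nat) \<Rightarrow> 'm sword \<Rightarrow> nat" where
  "word_code \<nu> w = list_encode (map (\<lambda>(d, pos). prod_encode (\<nu> d, of_bool pos)) w)"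

definition words_code :: "('m \<Rightarrow> nat) \<Rightarrow> 'm sword list \<Rightarrow> nat" where
  "words_code \<nu> ws = list_encode (map (word_code \<nu>) ws)"

end

theory Submission
  imports Defs "HOL-Library.More_List" "HOL-Analysis.Kronecker_Approximation_Theorem"
begin

text \<open>Order the Garside group by \<open>x \<preceq> y\<close> iff \<open>x\<^sup>-\<^sup>1 y\<close> is positive; this is a left invariant lattice
  order, and right multiplication by \<open>\<delta>\<close> is an order automorphism. Taking meets of orbits shows
  that if \<open>x \<preceq> g\<^sup>n x \<delta>\<close> for \<open>n\<close> the number of simple elements, then \<open>y \<preceq> g y\<close> for some \<open>y\<close>. Hence
  \<open>\<delta>\<^sup>-\<^sup>m \<preceq> g\<^sup>n\<^sup>m \<preceq> \<delta>\<^sup>m\<close> fails for all \<open>g \<noteq> 1\<close> and \<open>m \<ge> 1\<close>: the translation length of a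
  nontrivial element is at least \<open>1/n\<close>.

  By simultaneous Diophantine approximation, this uniform gap bounds the coefficients of some
  nontrivial relation in a dependent commuting family, and the coordinates, with respect to a given
  basis, of every conjugate of an element of given length. Linear independence and membership in the
  span of a basis are thereby decided by finitely many instances of the word problem. A basis
  exists because the group is torsion free, and is found by search. For the conjugacy problems, the
  tuples of elements of length at most \<open>R\<close> that are conjugate to each other are connected through
  conjugations by simple elements inside that finite set, which bounds the length of a conjugator.\<close>

section \<open>Computable functions\<close>

text \<open>The uniform gap comes from a pigeonhole: the meets of longer and longer pieces of an
  orbit descend inside an interval that is a translate of the set of simple elements, so among n + 1
  of them two agree. No limit is formed. Every growth estimate compares an element with a power of
  \<open>\<delta>\<close>, so each bound is an explicit arithmetic function of the input codes.

  The obstacle is that neither coordinates nor conjugators come with a bound. Growth rates help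
  because they ignore conjugation: the cost of a conjugator enters once, however high the power.
  Hence even the coordinates of an unknown conjugate are bounded by the length of the original
  element, and this confines the search for a conjugator to a finite graph.

  The group is effective only through finitely many finite tables on letters. These may be defined
  by choice, since every finite table is recursive. The only unbounded search is checked by a
  certificate: exponents show equality of spans, and a computed bound decides independence.\<close>

definition rec_fun :: "nat \<Rightarrow> (nat list \<Rightarrow> nat) \<Rightarrow> bool" where
  "rec_fun n f \<longleftrightarrow> (\<exists>p. \<forall>xs. length xs = n \<longrightarrow> computes p xs (f xs))"

lemma rec_fun_const: "rec_fun n (\<lambda>_. c)"
proof (induction c)
  case 0
  then show ?case unfolding rec_fun_def using computes.Zero by blast
next
  case (Suc c)
  then obtain p where p: "\<And>xs. length xs = n \<Longrightarrow> computes p xs c"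
    unfolding rec_fun_def by blast
  have "computes (Comp Succ [p]) xs (Suc c)" if "length xs = n" for xs
    by (rule computes.Comp[where ys = "[c]"]) (use p[OF that] in \<open>auto intro: computes.Succ\<close>)
  then show ?case unfolding rec_fun_def by blast
qed

lemma rec_fun_nth: "i < n \<Longrightarrow> rec_fun n (\<lambda>xs. xs ! i)"
  unfolding rec_fun_def using computes.Proj by blast

lemma rec_fun_comp:
  assumes f: "rec_fun (length gs) f" and g: "\<And>g. g \<in> set gs \<Longrightarrow> rec_fun n g"
  shows "rec_fun n (\<lambda>xs. f (map (\<lambda>g. g xs) gs))"
proof -
  obtain p where p: "\<And>xs. length xs = length gs \<Longrightarrow> computes p xs (f xs)"
    using f unfolding rec_fun_def by blast
  have "\<forall>i<length gs. \<exists>q. \<forall>xs. length xs = n \<longrightarrow> computes q xs ((gs ! i) xs)"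
    using g unfolding rec_fun_def by simp
  then obtain q where q: "\<And>i xs. i < length gs \<Longrightarrow> length xs = n \<Longrightarrow> computes (q i) xs ((gs ! i) xs)"
    by metis
  have "computes (Comp p (map q [0..<length gs])) xs (f (map (\<lambda>g. g xs) gs))"
    if "length xs = n" for xs
    by (rule computes.Comp[where ys = "map (\<lambda>g. g xs) gs"]) (use p q that in auto)
  then show ?thesis unfolding rec_fun_def by blast
qed

lemma rec_fun_comp1:
  "rec_fun 1 (\<lambda>xs. f (xs ! 0)) \<Longrightarrow> rec_fun n g \<Longrightarrow> rec_fun n (\<lambda>xs. f (g xs))"
  using rec_fun_comp[of "[g]" "\<lambda>xs. f (xs ! 0)" n] by simp

lemma rec_fun_comp2:
  "rec_fun 2 (\<lambda>xs. f (xs ! 0) (xs ! 1)) \<Longrightarrow> rec_fun n g \<Longrightarrow> rec_fun n h \<Longrightarrow>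
    rec_fun n (\<lambda>xs. f (g xs) (h xs))"
  using rec_fun_comp[of "[g, h]" "\<lambda>xs. f (xs ! 0) (xs ! 1)" n] by (auto simp: numeral_2_eq_2)

lemma rec_fun_Suc: "rec_fun n g \<Longrightarrow> rec_fun n (\<lambda>xs. Suc (g xs))"
proof (rule rec_fun_comp1[where f = Suc])
  show "rec_fun 1 (\<lambda>xs. Suc (xs ! 0))"
    unfolding rec_fun_def
    by (rule exI[of _ Succ]) (auto simp: length_Suc_conv intro: computes.Succ)
qed

text \<open>One parameter \<open>h xs\<close> is enough, because the whole context of a computation
  is later packed into a single number.\<close>

lemma rec_fun_rec_nat:
  assumes "rec_fun 1 (\<lambda>xs. f (xs ! 0))" "rec_fun 3 (\<lambda>xs. g (xs ! 0) (xs ! 1) (xs ! 2))"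
    and "rec_fun n k" "rec_fun n h"
  shows "rec_fun n (\<lambda>xs. rec_nat (f (h xs)) (\<lambda>i y. g i y (h xs)) (k xs))"
proof (rule rec_fun_comp2[where f = "\<lambda>m x. rec_nat (f x) (\<lambda>i y. g i y x) m"])
  obtain p where p: "\<And>xs. length xs = 1 \<Longrightarrow> computes p xs (f (xs ! 0))"
    using assms(1) unfolding rec_fun_def by blast
  obtain q where q: "\<And>xs. length xs = 3 \<Longrightarrow> computes q xs (g (xs ! 0) (xs ! 1) (xs ! 2))"
    using assms(2) unfolding rec_fun_def by blast
  have "computes (PrimRec p q) [m, x] (rec_nat (f x) (\<lambda>i y. g i y x) m)" for m x
  proof (induction m)
    case 0
    then show ?case using p[of "[x]"] by (simp add: computes.PrimRec_0)
  next
    case (Suc m)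
    then show ?case using q[of "[m, _, x]"] by (simp add: computes.PrimRec_Suc)
  qed
  then show "rec_fun 2 (\<lambda>xs. rec_nat (f (xs ! 1)) (\<lambda>i y. g i y (xs ! 1)) (xs ! 0))"
    unfolding rec_fun_def
    by (intro exI[of _ "PrimRec p q"]) (auto simp: numeral_2_eq_2 length_Suc_conv)
qed (use assms in auto)

lemma rec_fun_add:
  assumes "rec_fun n f" "rec_fun n g" shows "rec_fun n (\<lambda>xs. f xs + g xs)"
proof -
  have "rec_nat b (\<lambda>_ y. Suc y) a = a + b" for a b :: nat by (induction a) auto
  then show ?thesis
    using rec_fun_rec_nat[of "\<lambda>x. x" "\<lambda>i y x. Suc y" n f g] assms
    by (simp add: rec_fun_nth rec_fun_Suc)
qed

lemma rec_fun_mult: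
  assumes "rec_fun n f" "rec_fun n g" shows "rec_fun n (\<lambda>xs. f xs * g xs)"
proof -
  have "rec_nat 0 (\<lambda>_ y. y + b) a = a * b" for a b :: nat by (induction a) auto
  then show ?thesis
    using rec_fun_rec_nat[of "\<lambda>x. 0" "\<lambda>i y x. y + x" n f g] assms
    by (simp add: rec_fun_nth rec_fun_add rec_fun_const)
qed

lemma rec_fun_diff:
  assumes "rec_fun n f" "rec_fun n g" shows "rec_fun n (\<lambda>xs. f xs - g xs)"
proof -
  have pred: "rec_nat 0 (\<lambda>i _. i) a = a - 1" for a :: nat by (induction a) auto
  have pred_rec: "rec_fun m h \<Longrightarrow> rec_fun m (\<lambda>xs. h xs - 1)" for m h
    using rec_fun_rec_nat[of "\<lambda>x. 0" "\<lambda>i y x. i" m h h]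
    by (simp add: rec_fun_nth rec_fun_const pred)
  have "rec_nat a (\<lambda>_ y. y - 1) b = a - b" for a b :: nat by (induction b) auto
  then show ?thesis
    using rec_fun_rec_nat[of "\<lambda>x. x" "\<lambda>i y x. y - 1" n g f] assms pred_rec[of 3 "\<lambda>xs. xs ! 1"]
    by (simp add: rec_fun_nth)
qed

lemma rec_fun_triangle:
  assumes "rec_fun n f" shows "rec_fun n (\<lambda>xs. triangle (f xs))"
proof -
  have "rec_nat 0 (\<lambda>i y. y + Suc i) a = triangle a" for a :: nat by (induction a) auto
  then show ?thesis
    using rec_fun_rec_nat[of "\<lambda>x. 0" "\<lambda>i y x. y + Suc i" n f f] assms
      rec_fun_add[of 3 "\<lambda>xs. xs ! 1" "\<lambda>xs. Suc (xs ! 0)"]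
    by (simp add: rec_fun_nth rec_fun_Suc rec_fun_const)
qed

section \<open>The pairing function and its inverse\<close>

lemma rec_fun_prod_encode:
  assumes "rec_fun n f" "rec_fun n g" shows "rec_fun n (\<lambda>xs. prod_encode (f xs, g xs))"
  unfolding prod_encode_def using assms by (simp add: rec_fun_add rec_fun_triangle)

text \<open>The index of the anti-diagonal that holds the pair. As
  \<open>prod_encode (a, b) = triangle (a + b) + a\<close>, the rest of decoding consists of
  subtractions.\<close>

definition diagonal :: "nat \<Rightarrow> nat" where
  "diagonal x = fst (prod_decode x) + snd (prod_decode x)"

lemma prod_decode_diagonal:
  "fst (prod_decode x) = x - triangle (diagonal x)"
  "snd (prod_decode x) = diagonal x - (x - triangle (diagonal x))"
proof -
  obtain a b where ab: "prod_decode x = (a, b)" by fastforce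
  then have "x = triangle (a + b) + a"
    using prod_decode_inverse[of x] by (simp add: prod_encode_def)
  then show "fst (prod_decode x) = x - triangle (diagonal x)"
    "snd (prod_decode x) = diagonal x - (x - triangle (diagonal x))"
    using ab by (simp_all add: diagonal_def)
qed

lemma triangle_diagonal: "triangle (diagonal x) \<le> x \<and> x < triangle (Suc (diagonal x))"
proof -
  obtain a b where ab: "prod_decode x = (a, b)" by fastforce
  then have "x = triangle (a + b) + a"
    using prod_decode_inverse[of x] by (simp add: prod_encode_def)
  then show ?thesis
    using ab by (simp add: diagonal_def)
qed

lemma triangle_mono: "a \<le> b \<Longrightarrow> triangle a \<le> triangle b"
  unfolding triangle_def by (intro div_le_mono mult_le_mono) auto

lemma diagonal_unique:
  assumes "triangle s \<le> x" "x < triangle (Suc s)" shows "diagonal x = s"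
proof -
  have "\<not> Suc s \<le> diagonal x" "\<not> Suc (diagonal x) \<le> s"
    using assms triangle_diagonal[of x] triangle_mono[of "Suc s" "diagonal x"]
      triangle_mono[of "Suc (diagonal x)" s] by linarith+
  then show ?thesis by simp
qed

text \<open>From \<open>x\<close> to \<open>Suc x\<close> the index \<open>y\<close> stays or grows
  by one, and it grows exactly if \<open>triangle (Suc y) \<le> Suc x\<close>. Truncated subtraction
  turns this comparison into 0 or 1.\<close>

lemma diagonal_rec:
  "rec_nat 0 (\<lambda>i y. y + (1 - (triangle (Suc y) - Suc i))) x = diagonal x"
proof (induction x)
  case 0
  then show ?case using diagonal_unique[of 0 0] by simp
next
  case (Suc x)
  have "diagonal (Suc x) = diagonal x + (1 - (triangle (Suc (diagonal x)) - Suc x))"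
  proof (cases "triangle (Suc (diagonal x)) \<le> Suc x")
    case True
    then have "triangle (Suc (diagonal x)) = Suc x" using triangle_diagonal[of x] by simp
    then show ?thesis by (intro diagonal_unique) auto
  next
    case False
    then show ?thesis using triangle_diagonal[of x] by (intro diagonal_unique) auto
  qed
  then show ?case using Suc by simp
qed

lemma rec_fun_diagonal:
  assumes "rec_fun n f" shows "rec_fun n (\<lambda>xs. diagonal (f xs))"
proof -
  have "rec_fun 3 (\<lambda>xs. xs ! 1 + (1 - (triangle (Suc (xs ! 1)) - Suc (xs ! 0))))"
    by (intro rec_fun_add rec_fun_diff rec_fun_triangle rec_fun_Suc rec_fun_nth rec_fun_const) auto
  then show ?thesis
    using rec_fun_rec_nat[of "\<lambda>x. 0" "\<lambda>i y x. y + (1 - (triangle (Suc y) - Suc i))" n f f] assms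
      rec_fun_const unfolding diagonal_rec by blast
qed

section \<open>Computable unary functions and decidable predicates\<close>

abbreviation nfst :: "nat \<Rightarrow> nat" where "nfst x \<equiv> fst (prod_decode x)"
abbreviation nsnd :: "nat \<Rightarrow> nat" where "nsnd x \<equiv> snd (prod_decode x)"

text \<open>Unary functions suffice: a context of several variables is one number, and a function of
  two of them is tested on \<open>nfst z\<close> and \<open>nsnd z\<close>. Closure properties then
  become introduction rules that can be chained.\<close>

definition computable :: "(nat \<Rightarrow> nat) \<Rightarrow> bool" where
  "computable f \<longleftrightarrow> rec_fun 1 (\<lambda>xs. f (xs ! 0))"

definition decidable :: "(nat \<Rightarrow> bool) \<Rightarrow> bool" where
  "decidable P \<longleftrightarrow> computable (\<lambda>x. of_bool (P x))"

definition list_computable :: "(nat \<Rightarrow> nat list) \<Rightarrow> bool" where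
  "list_computable f \<longleftrightarrow> computable (\<lambda>x. list_encode (f x))"

lemma computable_basic:
  "computable (\<lambda>x. c)" "computable (\<lambda>x. x)"
  "computable f \<Longrightarrow> computable (\<lambda>x. Suc (f x))"
  "computable f \<Longrightarrow> computable g \<Longrightarrow> computable (\<lambda>x. f x + g x)"
  "computable f \<Longrightarrow> computable g \<Longrightarrow> computable (\<lambda>x. f x * g x)"
  "computable f \<Longrightarrow> computable g \<Longrightarrow> computable (\<lambda>x. f x - g x)"
  "computable f \<Longrightarrow> computable g \<Longrightarrow> computable (\<lambda>x. prod_encode (f x, g x))"
  "computable f \<Longrightarrow> computable (\<lambda>x. nfst (f x))"
  "computable f \<Longrightarrow> computable (\<lambda>x. nsnd (f x))"
  unfolding computable_def prod_decode_diagonal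
  by (simp_all add: rec_fun_const rec_fun_nth rec_fun_Suc rec_fun_add rec_fun_mult rec_fun_diff
      rec_fun_prod_encode rec_fun_diagonal rec_fun_triangle)

lemma computable_comp: "computable f \<Longrightarrow> computable g \<Longrightarrow> computable (\<lambda>x. f (g x))"
  unfolding computable_def by (rule rec_fun_comp1)

lemma computable_rec_nat:
  assumes "computable f" "computable n"
    and g: "computable (\<lambda>z. g (nfst z) (nfst (nsnd z)) (nsnd (nsnd z)))"
  shows "computable (\<lambda>x. rec_nat (f x) (g x) (n x))"
proof -
  have "rec_fun 3 (\<lambda>xs. (\<lambda>z. g (nfst z) (nfst (nsnd z)) (nsnd (nsnd z)))
      (prod_encode (xs ! 2, prod_encode (xs ! 0, xs ! 1))))"
    using g unfolding computable_def
    by (rule rec_fun_comp1) (intro rec_fun_prod_encode rec_fun_nth; simp)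
  then have "rec_fun 3 (\<lambda>xs. g (xs ! 2) (xs ! 0) (xs ! 1))" by simp
  then show ?thesis
    using rec_fun_rec_nat[of f "\<lambda>i y x. g x i y" 1 "\<lambda>xs. n (xs ! 0)" "\<lambda>xs. xs ! 0"] assms
    unfolding computable_def by (simp add: rec_fun_nth)
qed

lemma computable_funpow:
  assumes "computable f" "computable n" "computable (\<lambda>z. g (nfst z) (nsnd z))"
  shows "computable (\<lambda>x. (g x ^^ n x) (f x))"
proof -
  have "rec_nat a (\<lambda>_. h) n = (h ^^ n) a" for a :: nat and h n by (induction n) auto
  moreover have "computable (\<lambda>x. rec_nat (f x) (\<lambda>_. g x) (n x))"
    using assms(1,2) computable_comp[OF assms(3), of "\<lambda>z. prod_encode (nfst z, nsnd (nsnd z))"]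
    by (intro computable_rec_nat) (simp_all add: computable_basic)
  ultimately show ?thesis by simp
qed

lemma computable_power:
  assumes "computable f" "computable n" shows "computable (\<lambda>x. f x ^ n x)"
proof -
  have "rec_nat 1 (\<lambda>_ y. a * y) n = a ^ n" for a n :: nat by (induction n) auto
  moreover have "computable (\<lambda>x. rec_nat 1 (\<lambda>_ y. f x * y) (n x))"
    using assms by (intro computable_rec_nat computable_basic computable_comp[OF assms(1)])
  ultimately show ?thesis by simp
qed

lemma decidable_const: "decidable (\<lambda>x. P)"
  unfolding decidable_def by (rule computable_basic)

lemma decidable_le:
  assumes "computable f" "computable g" shows "decidable (\<lambda>x. f x \<le> g x)"
proof -
  have "of_bool (a \<le> b) = 1 - (a - b)" for a b :: nat by auto
  then show ?thesis using assms unfolding decidable_def by (simp add: computable_basic)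
qed

lemma decidable_bool:
  "decidable P \<Longrightarrow> decidable (\<lambda>x. \<not> P x)"
  "decidable P \<Longrightarrow> decidable Q \<Longrightarrow> decidable (\<lambda>x. P x \<and> Q x)"
  "decidable P \<Longrightarrow> decidable Q \<Longrightarrow> decidable (\<lambda>x. P x \<or> Q x)"
  "decidable P \<Longrightarrow> decidable Q \<Longrightarrow> decidable (\<lambda>x. P x \<longrightarrow> Q x)"
proof -
  have not: "decidable (\<lambda>x. \<not> P x)" if "decidable P" for P
  proof -
    have "of_bool (\<not> A) = (1 - of_bool A :: nat)" for A by auto
    then show ?thesis using that unfolding decidable_def by (simp add: computable_basic)
  qed
  have conj: "decidable (\<lambda>x. P x \<and> Q x)" if "decidable P" "decidable Q" for P Q
  proof -
    have "of_bool (A \<and> B) = (of_bool A * of_bool B :: nat)" for A B by auto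
    then show ?thesis using that unfolding decidable_def by (simp add: computable_basic)
  qed
  show "decidable P \<Longrightarrow> decidable (\<lambda>x. \<not> P x)" by (rule not)
  show "decidable P \<Longrightarrow> decidable Q \<Longrightarrow> decidable (\<lambda>x. P x \<and> Q x)" by (rule conj)
  show "decidable P \<Longrightarrow> decidable Q \<Longrightarrow> decidable (\<lambda>x. P x \<or> Q x)"
    using not[OF conj[OF not not], of P Q] by simp
  show "decidable P \<Longrightarrow> decidable Q \<Longrightarrow> decidable (\<lambda>x. P x \<longrightarrow> Q x)"
    using not[OF conj[OF _ not], of P Q] by simp
qed

lemma decidable_less: "computable f \<Longrightarrow> computable g \<Longrightarrow> decidable (\<lambda>x. f x < g x)"
  using decidable_bool(1)[OF decidable_le, of g f] by (simp add: not_le)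

lemma decidable_eq: "computable f \<Longrightarrow> computable g \<Longrightarrow> decidable (\<lambda>x. f x = g x)"
  using decidable_bool(2)[OF decidable_le decidable_le, of f g g f]
  by (simp add: eq_iff[symmetric])

lemma decidable_comp: "decidable P \<Longrightarrow> computable f \<Longrightarrow> decidable (\<lambda>x. P (f x))"
  unfolding decidable_def using computable_comp[of "\<lambda>x. of_bool (P x)" f] by simp

lemma computable_if:
  assumes "decidable P" "computable f" "computable g"
  shows "computable (\<lambda>x. if P x then f x else g x)"
proof -
  have "(if A then a else b) = of_bool A * a + (1 - of_bool A) * b" for A and a b :: nat by auto
  then show ?thesis using assms unfolding decidable_def
    by (simp only: computable_basic)
qed

lemma decidable_ex_less:
  assumes "computable n" "decidable (\<lambda>z. P (nfst z) (nsnd z))"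
  shows "decidable (\<lambda>x. \<exists>i<n x. P x i)"
proof -
  have "decidable (\<lambda>z. P (nfst z) (nfst (nsnd z)))"
    using decidable_comp[OF assms(2), of "\<lambda>z. prod_encode (nfst z, nfst (nsnd z))"]
    by (simp add: computable_basic)
  then have "computable (\<lambda>x. rec_nat 0 (\<lambda>i y. if P x i then 1 else y) (n x))"
    by (intro computable_rec_nat computable_basic computable_if assms)
  moreover have "rec_nat 0 (\<lambda>i y. if Q i then 1 else y) n = (of_bool (\<exists>i<n. Q i) :: nat)" for Q n
    by (induction n) (auto simp: less_Suc_eq)
  ultimately show ?thesis unfolding decidable_def by simp
qed

lemma decidable_all_less:
  assumes "computable n" "decidable (\<lambda>z. P (nfst z) (nsnd z))"
  shows "decidable (\<lambda>x. \<forall>i<n x. P x i)"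
  using decidable_bool(1)[OF decidable_ex_less[OF assms(1) decidable_bool(1)[OF assms(2)]]] by simp

lemma decidable_finite:
  assumes "finite S" "computable f" shows "decidable (\<lambda>x. f x \<in> S)"
  using assms(1)
proof induction
  case (insert a S)
  then have "decidable (\<lambda>x. f x = a \<or> f x \<in> S)"
    by (intro decidable_bool decidable_eq computable_basic assms)
  then show ?case by simp
qed (simp add: decidable_const)

text \<open>Finitely many comparisons compute a finite table, however its entries were obtained;
  \<open>t\<close> may well be defined by choice.\<close>

lemma computable_finite_support:
  assumes "finite S" "computable f" shows "computable (\<lambda>x. if f x \<in> S then t (f x) else 0)"
  using assms(1)
proof induction
  case (insert a S)
  have "computable (\<lambda>x. if f x = a then t a else if f x \<in> S then t (f x) else 0)"
    by (rule computable_if[OF decidable_eq[OF assms(2) computable_basic(1)] computable_basic(1)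
          insert.IH])
  moreover have "(if f x = a then t a else if f x \<in> S then t (f x) else 0) =
      (if f x \<in> insert a S then t (f x) else 0)" for x by auto
  ultimately show ?case by simp
qed (simp add: computable_basic)

section \<open>Computations with coded lists\<close>

lemma list_computable_basic:
  "list_computable (\<lambda>x. [])"
  "computable f \<Longrightarrow> list_computable g \<Longrightarrow> list_computable (\<lambda>x. f x # g x)"
  "computable f \<Longrightarrow> list_computable (\<lambda>x. list_decode (f x))"
  "list_computable g \<Longrightarrow> computable (\<lambda>x. list_encode (g x))"
  by (simp_all add: list_computable_def computable_basic)

lemma list_computable_if:
  "decidable P \<Longrightarrow> list_computable f \<Longrightarrow> list_computable g \<Longrightarrow>
    list_computable (\<lambda>x. if P x then f x else g x)"
  unfolding list_computable_def using computable_if[of P] by (simp add: if_distrib)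

lemma length_le_list_encode: "length xs \<le> list_encode xs"
  by (induction xs) (auto intro: order_trans le_prod_encode_2)

text \<open>The state of the loop is the code of the remaining list paired with the accumulator. The
  number of rounds is the code of the list, which is at least its length; surplus rounds leave the
  empty list alone.\<close>

lemma computable_fold:
  assumes "computable a" "list_computable xs"
    and f: "computable (\<lambda>z. f (nfst z) (nfst (nsnd z)) (nsnd (nsnd z)))"
  shows "computable (\<lambda>x. fold (f x) (xs x) (a x))"
proof -
  \<comment> \<open>A nonempty list has the code
    \<open>Suc (prod_encode (head, code of the tail))\<close>, hence the subtraction of 1 before
    decoding.\<close>
  define step where "step x s = (if nfst s = 0 then s else
    prod_encode (nsnd (nfst s - 1), f x (nfst (nfst s - 1)) (nsnd s)))" for x s
  have iter: "(step x ^^ n) (prod_encode (list_encode ys, b)) = prod_encode (0, fold (f x) ys b)"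
    if "length ys \<le> n" for x n ys b
    using that
  proof (induction n arbitrary: ys b)
    case (Suc n)
    have z: "(step x ^^ m) (prod_encode (0, c)) = prod_encode (0, c)" for m c
      by (induction m) (auto simp: step_def)
    show ?case
    proof (cases ys)
      case Nil
      then show ?thesis using z[of "Suc n"] by simp
    next
      case (Cons y ys')
      then show ?thesis using Suc by (simp add: step_def funpow_Suc_right del: funpow.simps)
    qed
  qed simp
  have "computable (\<lambda>z. f (nfst z) (nfst (nfst (nsnd z) - 1)) (nsnd (nsnd z)))"
    using computable_comp[OF f, of
        "\<lambda>z. prod_encode (nfst z, prod_encode (nfst (nfst (nsnd z) - 1), nsnd (nsnd z)))"]
    by (simp add: computable_basic)
  then have "computable (\<lambda>z. step (nfst z) (nsnd z))"
    unfolding step_def by (intro computable_if decidable_eq computable_basic)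
  then have "computable (\<lambda>x. nsnd ((step x ^^ list_encode (xs x))
      (prod_encode (list_encode (xs x), a x))))"
    using assms(1,2) by (intro computable_basic computable_funpow list_computable_basic)
  then show ?thesis by (simp add: iter length_le_list_encode)
qed

lemma list_computable_fold:
  assumes "list_computable a" "list_computable xs"
    and "list_computable (\<lambda>z. f (nfst z) (nfst (nsnd z)) (list_decode (nsnd (nsnd z))))"
  shows "list_computable (\<lambda>x. fold (f x) (xs x) (a x))"
proof -
  have "computable (\<lambda>x. fold (\<lambda>y c. list_encode (f x y (list_decode c))) (xs x) (list_encode (a x)))"
    using assms unfolding list_computable_def
    by (intro computable_fold) (auto simp: list_computable_def)
  moreover have "fold (\<lambda>y c. list_encode (f x y (list_decode c))) ys (list_encode b)
      = list_encode (fold (f x) ys b)" for x ys b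
    by (induction ys arbitrary: b) auto
  ultimately show ?thesis unfolding list_computable_def by simp
qed

lemma list_computable_rev: "list_computable xs \<Longrightarrow> list_computable (\<lambda>x. rev (xs x))"
  using list_computable_fold[of "\<lambda>x. []" xs "\<lambda>x. (#)"]
  by (simp add: fold_Cons_rev list_computable_basic computable_basic)

lemma list_computable_append:
  "list_computable xs \<Longrightarrow> list_computable ys \<Longrightarrow> list_computable (\<lambda>x. xs x @ ys x)"
  using list_computable_fold[of ys "\<lambda>x. rev (xs x)" "\<lambda>x. (#)"]
  by (simp add: fold_Cons_rev list_computable_basic computable_basic list_computable_rev)

lemma list_computable_concat_map:
  assumes "list_computable xs" "list_computable (\<lambda>z. f (nfst z) (nsnd z))"
  shows "list_computable (\<lambda>x. concat (map (f x) (xs x)))"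
proof -
  have "list_computable (\<lambda>z. f (nfst z) (nfst (nsnd z)))"
    using assms(2) computable_comp[of "\<lambda>z. list_encode (f (nfst z) (nsnd z))"
        "\<lambda>z. prod_encode (nfst z, nfst (nsnd z))"]
    by (simp add: list_computable_def computable_basic)
  then have "list_computable (\<lambda>x. fold (\<lambda>y acc. acc @ f x y) (xs x) [])"
    using assms(1)
    by (intro list_computable_fold list_computable_append list_computable_basic computable_basic)
  moreover have "fold (\<lambda>y acc. acc @ f x y) ys b = b @ concat (map (f x) ys)" for x ys b
    by (induction ys arbitrary: b) auto
  ultimately show ?thesis by simp
qed

lemma list_computable_map:
  assumes "list_computable xs" "computable (\<lambda>z. f (nfst z) (nsnd z))"
  shows "list_computable (\<lambda>x. map (f x) (xs x))"
proof -
  have "concat (map (\<lambda>y. [g y]) ys) = map g ys" for g :: "nat \<Rightarrow> nat" and ys by (induction ys) auto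
  then show ?thesis
    using list_computable_concat_map[OF assms(1), of "\<lambda>x y. [f x y]"] assms(2)
    by (simp add: list_computable_basic)
qed

lemma list_computable_upt:
  assumes "computable n" shows "list_computable (\<lambda>x. [0..<n x])"
proof -
  have "list_computable (\<lambda>z. list_decode (nsnd (nsnd z)) @ [nfst (nsnd z)])"
    by (intro list_computable_append list_computable_basic computable_basic)
  then have "computable (\<lambda>x. rec_nat (list_encode []) (\<lambda>i c. list_encode (list_decode c @ [i])) (n x))"
    using assms by (intro computable_rec_nat computable_basic) (auto simp: list_computable_def)
  moreover have "rec_nat (list_encode []) (\<lambda>i c. list_encode (list_decode c @ [i])) m
      = list_encode [0..<m]" for m
    by (induction m) auto
  ultimately show ?thesis unfolding list_computable_def by simp
qed

lemma computable_length:
  assumes "list_computable xs" shows "computable (\<lambda>x. length (xs x))"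
proof -
  have "fold (\<lambda>_ n. Suc n) ys m = m + length ys" for ys :: "nat list" and m
    by (induction ys arbitrary: m) auto
  then show ?thesis
    using computable_fold[of "\<lambda>x. 0" xs "\<lambda>_ _ n. Suc n"] assms by (simp add: computable_basic)
qed

text \<open>One entry is emitted per failure, so the condition holds iff the emitted list is
  empty.\<close>

lemma decidable_all_set:
  assumes "list_computable xs" "decidable (\<lambda>z. P (nfst z) (nsnd z))"
  shows "decidable (\<lambda>x. \<forall>y\<in>set (xs x). P x y)"
proof -
  have "decidable (\<lambda>x. length (concat (map (\<lambda>y. if P x y then [] else [0::nat]) (xs x))) = 0)"
    using assms by (intro decidable_eq computable_basic computable_length list_computable_concat_map
        list_computable_if list_computable_basic)
  moreover have "length (concat (map (\<lambda>y. if Q y then [] else [0::nat]) ys)) = 0 \<longleftrightarrow> (\<forall>y\<in>set ys. Q y)"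
    for Q and ys :: "nat list"
    by (induction ys) auto
  ultimately show ?thesis by simp
qed

lemma computable_nth_default:
  assumes "list_computable xs" "computable i"
  shows "computable (\<lambda>x. nth_default 0 (xs x) (i x))"
proof -
  have "computable (\<lambda>x. nfst (((\<lambda>c. nsnd (c - 1)) ^^ i x) (list_encode (xs x)) - 1))"
    using assms by (intro computable_basic computable_funpow list_computable_basic)
  \<comment> \<open>Peeling a tail off code 0 gives 0 again, since \<open>0 - 1 = 0\<close> and
    \<open>prod_decode 0 = (0, 0)\<close>; past the end of the list the result is therefore the
    default 0.\<close>
  moreover have "nfst (((\<lambda>c. nsnd (c - 1)) ^^ n) (list_encode ys) - 1) = nth_default 0 ys n" for n ys
  proof (induction n arbitrary: ys)
    case 0
    have "prod_decode 0 = (0, 0)" by (simp add: prod_decode_def prod_decode_aux.simps)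
    then show ?case by (cases ys) (auto simp: nth_default_def)
  next
    case (Suc n)
    have "prod_decode 0 = (0, 0)" by (simp add: prod_decode_def prod_decode_aux.simps)
    then have "nsnd (list_encode ys - 1) = list_encode (tl ys)" by (cases ys) auto
    then show ?case using Suc[of "tl ys"]
      by (cases ys) (auto simp: funpow_Suc_right nth_default_def simp del: funpow.simps)
  qed
  ultimately show ?thesis by simp
qed

lemmas computable_intros =
  computable_basic computable_power computable_if list_computable_basic list_computable_if
  decidable_const decidable_le decidable_less decidable_eq decidable_bool
  decidable_ex_less decidable_all_less decidable_all_set
  list_computable_rev list_computable_append list_computable_concat_map list_computable_map
  list_computable_upt computable_length computable_nth_default

lemma list_computable_comp:
  "list_computable f \<Longrightarrow> computable g \<Longrightarrow> list_computable (\<lambda>x. f (g x))"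
  unfolding list_computable_def using computable_comp[of "\<lambda>x. list_encode (f x)" g] by simp

text \<open>The reason why the letter tables of the word problem return 0 away from the
  letters.\<close>

lemma computable_table:
  assumes "finite S" "computable f" "\<And>a. a \<notin> S \<Longrightarrow> t a = 0"
  shows "computable (\<lambda>x. t (f x))"
proof -
  have "(\<lambda>x. if f x \<in> S then t (f x) else 0) = (\<lambda>x. t (f x))" using assms(3) by auto
  then show ?thesis using computable_finite_support[OF assms(1,2), of t] by simp
qed

lemma computable_table2:
  assumes "finite S" "computable f" "computable g" "\<And>a b. a \<notin> S \<or> b \<notin> S \<Longrightarrow> t a b = 0"
  shows "computable (\<lambda>x. t (f x) (g x))"
proof -
  have "t (nfst z) (nsnd z) = 0" if "z \<notin> prod_encode ` (S \<times> S)" for z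
  proof -
    have "(nfst z, nsnd z) \<notin> S \<times> S" using that by (metis image_eqI prod.collapse prod_decode_inverse)
    then show ?thesis using assms(4) by blast
  qed
  then have "computable (\<lambda>x. (\<lambda>z. t (nfst z) (nsnd z)) (prod_encode (f x, g x)))"
    using assms(1)
    by (intro computable_table[of "prod_encode ` (S \<times> S)", OF _ computable_basic(7)[OF assms(2,3)]]) auto
  then show ?thesis by simp
qed

section \<open>Bounds for codes of lists\<close>

lemma prod_encode_mono: "a \<le> a' \<Longrightarrow> b \<le> b' \<Longrightarrow> prod_encode (a, b) \<le> prod_encode (a', b')"
  unfolding prod_encode_def using triangle_mono[of "a + b" "a' + b'"] by simp

text \<open>One more than the code of \<open>k\<close> copies of \<open>N\<close>; it turns a search
  over short lists with small entries into a bounded quantifier over numbers. The form with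
  \<open>map\<close> and \<open>[0..<k]\<close> matches the computability rules above.\<close>

definition list_code_bound :: "nat \<Rightarrow> nat \<Rightarrow> nat" where
  "list_code_bound k N = Suc (list_encode (map (\<lambda>_. N) [0..<k]))"

lemma list_encode_less_vbound:
  assumes "length xs \<le> k" "\<And>x. x \<in> set xs \<Longrightarrow> x \<le> N" shows "list_encode xs < list_code_bound k N"
proof -
  have "list_encode xs \<le> list_encode (replicate k N)"
    using assms
  proof (induction xs arbitrary: k)
    case (Cons x xs)
    then obtain k' where "k = Suc k'" by (cases k) auto
    then show ?case using Cons by (auto intro!: prod_encode_mono)
  qed simp
  then show ?thesis unfolding list_code_bound_def by (simp add: map_replicate_const)
qed

lemma list_code_bound_mono: "N \<le> N' \<Longrightarrow> list_code_bound k N \<le> list_code_bound k N'"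
  unfolding list_code_bound_def[of k N] by (rule Suc_leI, rule list_encode_less_vbound) auto

lemma computable_vbound:
  assumes "computable f" "computable g" shows "computable (\<lambda>x. list_code_bound (f x) (g x))"
  unfolding list_code_bound_def by (intro computable_intros computable_comp[OF assms(2)] assms(1))

lemma element_le_list_encode: "x \<in> set xs \<Longrightarrow> x \<le> list_encode xs"
proof (induction xs)
  case (Cons a xs)
  have "a \<le> list_encode (a # xs)" "list_encode xs \<le> list_encode (a # xs)"
    using le_prod_encode_1[of a "list_encode xs"] le_prod_encode_2[of "list_encode xs" a] by auto
  then show ?case using Cons by auto
qed simp

text \<open>The only place where the unbounded search \<open>Mu\<close> occurs. Callers need some
  correct witness \<open>c\<close>, not the least one, so the conclusion says no more.\<close>

lemma search_computes:
  assumes R: "decidable (\<lambda>z. R (nfst z) (nsnd z))" and U: "computable U"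
  obtains p where "\<And>x. \<exists>c. R c x \<Longrightarrow> \<exists>c. R c x \<and> computes p [x] (U (prod_encode (c, x)))"
proof -
  \<comment> \<open>\<open>Mu\<close> stops at the value 0, so the test is negated.\<close>
  have "rec_fun 2 (\<lambda>xs. (\<lambda>z. of_bool (\<not> R (nfst z) (nsnd z))) (prod_encode (xs ! 0, xs ! 1)))"
    by (rule rec_fun_comp1[where f = "\<lambda>z. of_bool (\<not> R (nfst z) (nsnd z))"])
      (use decidable_bool(1)[OF R] in \<open>auto simp: decidable_def computable_def
        intro!: rec_fun_prod_encode rec_fun_nth\<close>)
  then obtain r where r: "\<And>xs. length xs = 2 \<Longrightarrow> computes r xs (of_bool (\<not> R (xs ! 0) (xs ! 1)))"
    unfolding rec_fun_def by auto
  have "rec_fun 2 (\<lambda>xs. U (prod_encode (xs ! 0, xs ! 1)))"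
    by (rule rec_fun_comp1[where f = U])
      (use U in \<open>auto simp: computable_def intro!: rec_fun_prod_encode rec_fun_nth\<close>)
  then obtain u where u: "\<And>xs. length xs = 2 \<Longrightarrow> computes u xs (U (prod_encode (xs ! 0, xs ! 1)))"
    unfolding rec_fun_def by blast
  define p where "p = Comp u [Mu r, Proj 0]"
  show ?thesis
  proof (rule that[of p])
    fix x assume ex: "\<exists>c. R c x"
    define c where "c = (LEAST c. R c x)"
    have c: "R c x" "\<And>d. d < c \<Longrightarrow> \<not> R d x"
      using ex unfolding c_def by (auto intro: LeastI dest: not_less_Least)
    have "computes (Mu r) [x] c"
    proof (rule computes.Mu)
      show "computes r [c, x] 0" using r[of "[c, x]"] c(1) by simp
      show "\<exists>y. computes r [d, x] (Suc y)" if "d < c" for d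
        using r[of "[d, x]"] c(2)[OF that] by auto
    qed
    then have "computes p [x] (U (prod_encode (c, x)))"
      unfolding p_def
      by (intro computes.Comp[where ys = "[c, x]"])
        (use u[of "[c, x]"] computes.Proj[of 0 "[x]"] in \<open>auto simp: less_Suc_eq\<close>)
    then show "\<exists>c. R c x \<and> computes p [x] (U (prod_encode (c, x)))" using c(1) by blast
  qed
qed

lemma computes_binary:
  obtains q where "\<And>x y v. computes p [prod_encode (x, y)] v \<Longrightarrow> computes q [x, y] v"
proof -
  obtain e where e: "\<And>xs. length xs = 2 \<Longrightarrow> computes e xs (prod_encode (xs ! 0, xs ! 1))"
    using rec_fun_prod_encode[of 2 "\<lambda>xs. xs ! 0" "\<lambda>xs. xs ! 1"] rec_fun_nth[of _ 2]
    unfolding rec_fun_def by auto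
  have "computes (Comp p [e]) [x, y] v" if "computes p [prod_encode (x, y)] v" for x y v
    using that e[of "[x, y]"] by (intro computes.Comp[where ys = "[prod_encode (x, y)]"]) auto
  then show ?thesis using that by blast
qed

section \<open>Positive cones of Garside groups\<close>

lemma (in group) inv_mult_cancel:
  "x \<in> carrier G \<Longrightarrow> y \<in> carrier G \<Longrightarrow> inv x \<otimes> (x \<otimes> y) = y"
  "x \<in> carrier G \<Longrightarrow> y \<in> carrier G \<Longrightarrow> x \<otimes> (inv x \<otimes> y) = y"
  by (simp_all add: m_assoc[symmetric])

lemma (in group) centralizer_subgroup:
  assumes y: "y \<in> carrier G" shows "subgroup {x \<in> carrier G. x \<otimes> y = y \<otimes> x} G"
proof
  fix x z assume xz: "x \<in> {x \<in> carrier G. x \<otimes> y = y \<otimes> x}" "z \<in> {x \<in> carrier G. x \<otimes> y = y \<otimes> x}"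
  then have "x \<otimes> z \<otimes> y = x \<otimes> (y \<otimes> z)" using y by (simp add: m_assoc)
  also have "\<dots> = y \<otimes> (x \<otimes> z)" using xz y by (simp add: m_assoc[symmetric])
  finally show "x \<otimes> z \<in> {x \<in> carrier G. x \<otimes> y = y \<otimes> x}" using xz by simp
next
  fix x assume x: "x \<in> {x \<in> carrier G. x \<otimes> y = y \<otimes> x}"
  then have eq: "x \<otimes> y = y \<otimes> x" and xc: "x \<in> carrier G" by auto
  have "y \<otimes> inv x = inv x \<otimes> (x \<otimes> y) \<otimes> inv x" using xc y by (simp add: m_assoc[symmetric])
  also have "\<dots> = inv x \<otimes> y" unfolding eq using xc y by (simp add: m_assoc)
  finally have "y \<otimes> inv x = inv x \<otimes> y" .
  then show "inv x \<in> {x \<in> carrier G. x \<otimes> y = y \<otimes> x}" using x by simp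
qed (use y in auto)

lemma (in group) generate_commute:
  assumes S: "S \<subseteq> carrier G" "\<And>x y. x \<in> S \<Longrightarrow> y \<in> S \<Longrightarrow> x \<otimes> y = y \<otimes> x"
    and "x \<in> generate G S" "y \<in> generate G S"
  shows "x \<otimes> y = y \<otimes> x"
proof -
  have *: "generate G S \<subseteq> {x \<in> carrier G. x \<otimes> y = y \<otimes> x}"
    if "y \<in> carrier G" "\<And>s. s \<in> S \<Longrightarrow> s \<otimes> y = y \<otimes> s" for y
    using that S(1) by (intro generate_subgroup_incl centralizer_subgroup) auto
  have xc: "x \<in> carrier G" "y \<in> carrier G" using assms generate_in_carrier by blast+
  have "x \<otimes> s = s \<otimes> x" if "s \<in> S" for s
    using *[of s] that S assms(3) by blast
  then show ?thesis using *[of x] xc assms(4) by fastforce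
qed

lemma uniform_bound:
  assumes "finite S" "\<And>x. x \<in> S \<Longrightarrow> \<exists>N::nat. Q x N" "\<And>x N N'. Q x N \<Longrightarrow> N \<le> N' \<Longrightarrow> Q x N'"
  shows "\<exists>N. \<forall>x\<in>S. Q x N"
  using assms(1,2)
proof induction
  case (insert x S)
  then obtain N where "\<forall>y\<in>S. Q y N" by auto
  moreover obtain N' where "Q x N'" using insert.prems by blast
  ultimately have "\<forall>y\<in>insert x S. Q y (max N N')"
    using assms(3)[of _ N "max N N'"] assms(3)[of x N' "max N N'"] by auto
  then show ?case by blast
qed simp

text \<open>The part of the Garside structure that the arguments need, stated in the group alone:
  \<open>P\<close> is the set of positive elements, the finite interval is the set of simple
  elements, and meets are those of the left invariant order. \<open>delta_normal\<close> makes right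
  multiplication by \<open>\<delta>\<close> compatible with that order.\<close>

locale garside_cone = group G for G (structure) +
  fixes P and \<delta>
  assumes cone_subset: "P \<subseteq> carrier G"
    and one_cone: "\<one> \<in> P"
    and mult_cone: "x \<in> P \<Longrightarrow> y \<in> P \<Longrightarrow> x \<otimes> y \<in> P"
    and cone_antisym: "x \<in> P \<Longrightarrow> inv x \<in> P \<Longrightarrow> x = \<one>"
    and delta_cone: "\<delta> \<in> P"
    and delta_normal: "x \<in> carrier G \<Longrightarrow> inv \<delta> \<otimes> x \<otimes> \<delta> \<in> P \<longleftrightarrow> x \<in> P"
    and cofinal: "x \<in> carrier G \<Longrightarrow> \<exists>k::nat. x \<otimes> \<delta> [^] k \<in> P"
    and finite_interval: "finite {x \<in> P. inv x \<otimes> \<delta> \<in> P}"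
    and meet_exists: "x \<in> carrier G \<Longrightarrow> y \<in> carrier G \<Longrightarrow> \<exists>m \<in> carrier G. inv m \<otimes> x \<in> P \<and> inv m \<otimes> y \<in> P \<and>
      (\<forall>z \<in> carrier G. inv z \<otimes> x \<in> P \<longrightarrow> inv z \<otimes> y \<in> P \<longrightarrow> inv z \<otimes> m \<in> P)"
begin

section \<open>The left invariant order and its meets\<close>

definition le (infix "\<preceq>" 50) where "x \<preceq> y \<longleftrightarrow> inv x \<otimes> y \<in> P"

definition D where "D = {x \<in> P. x \<preceq> \<delta>}"

definition glb where
  "glb S m \<longleftrightarrow> m \<in> carrier G \<and> (\<forall>s\<in>S. m \<preceq> s) \<and> (\<forall>z\<in>carrier G. (\<forall>s\<in>S. z \<preceq> s) \<longrightarrow> z \<preceq> m)"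

declare inv_mult_cancel [simp]

lemma cone_closed [simp]: "x \<in> P \<Longrightarrow> x \<in> carrier G"
  using cone_subset by blast

lemma delta_closed [simp]: "\<delta> \<in> carrier G"
  using delta_cone by simp

lemma finite_D: "finite D"
  using finite_interval unfolding D_def le_def by simp

lemma D_closed [simp]: "x \<in> D \<Longrightarrow> x \<in> carrier G"
  unfolding D_def by simp

lemma one_D: "\<one> \<in> D"
  unfolding D_def le_def using one_cone delta_cone by simp

lemma delta_D: "\<delta> \<in> D"
  unfolding D_def le_def using one_cone delta_cone by simp

lemma card_D_pos: "card D > 0"
  using finite_D one_D card_gt_0_iff by blast

lemma le_refl [simp]: "x \<in> carrier G \<Longrightarrow> x \<preceq> x"
  unfolding le_def using one_cone by simp

lemma le_trans:
  assumes "x \<preceq> y" "y \<preceq> z" "x \<in> carrier G" "y \<in> carrier G" "z \<in> carrier G" shows "x \<preceq> z"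
  using mult_cone[of "inv x \<otimes> y" "inv y \<otimes> z"] assms unfolding le_def by (simp add: m_assoc)

lemma le_antisym:
  assumes "x \<preceq> y" "y \<preceq> x" "x \<in> carrier G" "y \<in> carrier G" shows "x = y"
proof -
  have "inv x \<otimes> y = \<one>"
    using assms cone_antisym[of "inv x \<otimes> y"] unfolding le_def by (simp add: inv_mult_group)
  then have "x \<otimes> (inv x \<otimes> y) = x" using assms by simp
  then show ?thesis using assms by simp
qed

lemma one_le: "x \<in> carrier G \<Longrightarrow> \<one> \<preceq> x \<longleftrightarrow> x \<in> P"
  unfolding le_def by simp

lemma le_mult_cone: "x \<in> carrier G \<Longrightarrow> p \<in> P \<Longrightarrow> x \<preceq> x \<otimes> p"
  unfolding le_def by simp

lemma delta_pow_cone: "\<delta> [^] (k::nat) \<in> P"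
  by (induction k) (auto simp: one_cone delta_cone mult_cone)

lemma delta_pow_normal:
  "x \<in> carrier G \<Longrightarrow> inv (\<delta> [^] (k::nat)) \<otimes> x \<otimes> \<delta> [^] k \<in> P \<longleftrightarrow> x \<in> P"
proof (induction k arbitrary: x)
  case (Suc k)
  have "inv (\<delta> [^] Suc k) \<otimes> x \<otimes> \<delta> [^] Suc k = inv \<delta> \<otimes> (inv (\<delta> [^] k) \<otimes> x \<otimes> \<delta> [^] k) \<otimes> \<delta>"
    using Suc.prems by (simp add: inv_mult_group m_assoc)
  then show ?case using Suc delta_normal[of "inv (\<delta> [^] k) \<otimes> x \<otimes> \<delta> [^] k"] by simp
qed simp

text \<open>Invariance handles the factor \<open>a\<close> and normality the factor
  \<open>\<delta>^k\<close>. Both are kept in one map, because it is the combined map whose roots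
  are extracted below.\<close>

lemma le_shift:
  assumes "a \<in> carrier G" "x \<in> carrier G" "y \<in> carrier G"
  shows "a \<otimes> x \<otimes> \<delta> [^] (k::nat) \<preceq> a \<otimes> y \<otimes> \<delta> [^] k \<longleftrightarrow> x \<preceq> y"
proof -
  have "inv (a \<otimes> x \<otimes> \<delta> [^] k) \<otimes> (a \<otimes> y \<otimes> \<delta> [^] k) = inv (\<delta> [^] k) \<otimes> (inv x \<otimes> y) \<otimes> \<delta> [^] k"
    using assms by (simp add: inv_mult_group m_assoc)
  then show ?thesis using assms delta_pow_normal[of "inv x \<otimes> y" k] unfolding le_def by simp
qed

lemma le_left: "a \<in> carrier G \<Longrightarrow> x \<in> carrier G \<Longrightarrow> y \<in> carrier G \<Longrightarrow> a \<otimes> x \<preceq> a \<otimes> y \<longleftrightarrow> x \<preceq> y"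
  using le_shift[of a x y 0] by simp

lemma le_right:
  "x \<in> carrier G \<Longrightarrow> y \<in> carrier G \<Longrightarrow> x \<otimes> \<delta> [^] (k::nat) \<preceq> y \<otimes> \<delta> [^] k \<longleftrightarrow> x \<preceq> y"
  using le_shift[of \<one> x y k] by simp

lemma le_delta_pow: "x \<in> carrier G \<Longrightarrow> x \<preceq> x \<otimes> \<delta> [^] (k::nat)"
  by (simp add: le_mult_cone delta_pow_cone)

text \<open>Order automorphisms carry meets to meets; \<open>w\<close> is the preimage of a
  competing lower bound \<open>z\<close>.\<close>

lemma glb_shift:
  assumes "glb S m" "S \<subseteq> carrier G" "a \<in> carrier G"
  shows "glb ((\<lambda>x. a \<otimes> x \<otimes> \<delta> [^] (k::nat)) ` S) (a \<otimes> m \<otimes> \<delta> [^] k)"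
proof -
  have m: "m \<in> carrier G" using assms unfolding glb_def by blast
  have "z \<preceq> a \<otimes> m \<otimes> \<delta> [^] k"
    if z: "z \<in> carrier G" "\<And>s. s \<in> S \<Longrightarrow> z \<preceq> a \<otimes> s \<otimes> \<delta> [^] k" for z
  proof -
    define w where "w = inv a \<otimes> z \<otimes> inv (\<delta> [^] k)"
    have w: "w \<in> carrier G" "z = a \<otimes> w \<otimes> \<delta> [^] k"
      using z assms(3) unfolding w_def by (auto simp: m_assoc)
    then have "w \<preceq> s" if "s \<in> S" for s
      using z(2)[OF that] le_shift[of a w s k] that assms(2,3) by auto
    then have "w \<preceq> m" using assms(1) w(1) unfolding glb_def by blast
    then show ?thesis using w m assms(3) by (simp add: le_shift)
  qed
  moreover have "a \<otimes> m \<otimes> \<delta> [^] k \<preceq> a \<otimes> s \<otimes> \<delta> [^] k" if "s \<in> S" for s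
    using that assms m le_shift[of a m s k] unfolding glb_def by auto
  ultimately show ?thesis using m assms(3) unfolding glb_def by auto
qed

lemma glb_exists:
  assumes "finite S" "S \<noteq> {}" "S \<subseteq> carrier G" shows "\<exists>m. glb S m"
  using assms
proof (induction S rule: finite_ne_induct)
  case (singleton x)
  then show ?case by (intro exI[of _ x]) (auto simp: glb_def)
next
  case (insert x S)
  then obtain m where m: "glb S m" by auto
  then have "m \<in> carrier G" unfolding glb_def by blast
  then obtain n where n: "n \<in> carrier G" "n \<preceq> x" "n \<preceq> m"
    "\<And>z. z \<in> carrier G \<Longrightarrow> z \<preceq> x \<Longrightarrow> z \<preceq> m \<Longrightarrow> z \<preceq> n"
    using meet_exists[of x m] insert unfolding le_def by auto
  have "glb (insert x S) n"
    using n m insert.prems le_trans[OF n(3)] unfolding glb_def by (auto 4 3)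
  then show ?case by blast
qed

text \<open>The witness is the meet of \<open>x, f x, \<dots>, f\<^sup>m\<^sup>-\<^sup>1 x\<close> for the order automorphism
  \<open>f y = a y \<delta>\<^sup>k\<close>.\<close>

lemma shift_root:
  fixes k m :: nat
  assumes "a \<in> carrier G" "x \<in> carrier G" "0 < m" "x \<preceq> a [^] m \<otimes> x \<otimes> \<delta> [^] (k * m)"
  shows "\<exists>y\<in>carrier G. y \<preceq> a \<otimes> y \<otimes> \<delta> [^] k"
proof -
  define t where "t i = a [^] i \<otimes> x \<otimes> \<delta> [^] (k * i)" for i :: nat
  have t_closed: "t i \<in> carrier G" for i using assms unfolding t_def by simp
  have t_Suc: "a \<otimes> t i \<otimes> \<delta> [^] k = t (Suc i)" for i
    using assms unfolding t_def nat_pow_Suc2[OF assms(1)] mult_Suc_right add.commute[of k]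
    by (simp add: m_assoc nat_pow_mult[symmetric])
  obtain y where y: "glb (t ` {..<m}) y"
    using glb_exists[of "t ` {..<m}"] assms(3) t_closed by blast
  then have yc: "y \<in> carrier G" unfolding glb_def by blast
  have "glb ((\<lambda>z. a \<otimes> z \<otimes> \<delta> [^] k) ` t ` {..<m}) (a \<otimes> y \<otimes> \<delta> [^] k)"
    using glb_shift[OF y] t_closed assms(1) by blast
  moreover have "y \<preceq> a \<otimes> z \<otimes> \<delta> [^] k" if z: "z \<in> t ` {..<m}" for z
  proof -
    from z obtain i where i: "i < m" "z = t i" by blast
    show ?thesis
    proof (cases "Suc i < m")
      case True
      then show ?thesis using y i t_Suc unfolding glb_def by auto
    next
      case False
      \<comment> \<open>The map sends the last point of the orbit segment to \<open>t m\<close>,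
        which lies above \<open>t 0\<close> by assumption.\<close>
      then have "Suc i = m" using i by simp
      then have "a \<otimes> z \<otimes> \<delta> [^] k = t m" using i t_Suc by simp
      moreover have "y \<preceq> t 0" using y assms(3) unfolding glb_def by auto
      moreover have "t 0 \<preceq> t m" using assms unfolding t_def by simp
      ultimately show ?thesis using le_trans[of y "t 0" "t m"] t_closed yc by simp
    qed
  qed
  ultimately have "y \<preceq> a \<otimes> y \<otimes> \<delta> [^] k" using yc unfolding glb_def by blast
  then show ?thesis using yc by blast
qed

text \<open>Two meets in succession, with n = \<open>card D\<close>. The meet \<open>y\<close> of n
  translates of \<open>x\<close> satisfies \<open>y \<preceq> g^j y \<delta>\<close> for all
  \<open>j \<le> n\<close>. Then the meets \<open>z k\<close> of \<open>y, g y, ..., g^k y\<close>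
  with \<open>k \<le> n\<close> all lie between \<open>y \<delta>^-1\<close> and \<open>y\<close>,
  an interval of n elements, so two of them agree. Once this descending chain pauses at
  \<open>i\<close>, it follows that \<open>z i \<preceq> g (z i)\<close>.\<close>

lemma shift_root_card:
  assumes g: "g \<in> carrier G" and x: "x \<in> carrier G"
    and le: "x \<preceq> g [^] card D \<otimes> x \<otimes> \<delta>"
  shows "\<exists>y\<in>carrier G. y \<preceq> g \<otimes> y"
proof -
  define n where "n = card D"
  \<comment> \<open>Two properties of the exponents are used: they are at most 1, for indices
    \<open>j + i\<close> below n, and they increase with the index, for indices that wrap around
    past n.\<close>
  define e where "e i = (if i = 0 then 0 else 1 :: nat)" for i :: nat
  define t where "t i = g [^] i \<otimes> x \<otimes> \<delta> [^] e i" for i :: nat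
  have n: "0 < n" unfolding n_def by (rule card_D_pos)
  have tc: "t i \<in> carrier G" for i using g x unfolding t_def by simp
  obtain y where y: "glb (t ` {..<n}) y"
    using glb_exists[of "t ` {..<n}"] n tc by blast
  then have yc: "y \<in> carrier G" and yt: "\<And>i. i < n \<Longrightarrow> y \<preceq> t i" unfolding glb_def by auto
  have gt: "g [^] j \<otimes> t i \<otimes> \<delta> [^] (1::nat) = g [^] (j + i) \<otimes> x \<otimes> \<delta> [^] (Suc (e i))" for i j
    using g x unfolding t_def by (simp add: m_assoc nat_pow_mult[symmetric])
  have y_le: "y \<preceq> g [^] j \<otimes> y \<otimes> \<delta> [^] (1::nat)" if j: "j \<le> n" for j
  proof -
    have "glb ((\<lambda>z. g [^] j \<otimes> z \<otimes> \<delta> [^] (1::nat)) ` t ` {..<n}) (g [^] j \<otimes> y \<otimes> \<delta> [^] (1::nat))"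
      using glb_shift[OF y, of "g [^] j" 1] tc g by blast
    moreover have "y \<preceq> g [^] j \<otimes> t i \<otimes> \<delta> [^] (1::nat)" if i: "i < n" for i
    proof (cases "j + i < n")
      case True
      have "g [^] j \<otimes> t i \<otimes> \<delta> [^] (1::nat) = t (j + i) \<otimes> \<delta> [^] (Suc (e i) - e (j + i))"
        unfolding gt using g x by (simp add: t_def e_def m_assoc)
      then show ?thesis
        using le_trans[OF yt[OF True] le_delta_pow[OF tc, of _ "Suc (e i) - e (j + i)"]] tc yc by simp
    next
      case False
      define r where "r = j + i - n"
      have r: "j + i = n + r" "r < n" "r \<le> i" using False i j unfolding r_def by auto
      have 1: "t r \<preceq> g [^] r \<otimes> x \<otimes> \<delta> [^] e i"
      proof -
        have "g [^] r \<otimes> x \<otimes> \<delta> [^] e i = t r \<otimes> \<delta> [^] (e i - e r)"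
          using g x r(3) by (simp add: t_def e_def m_assoc)
        then show ?thesis using le_delta_pow tc by simp
      qed
      \<comment> \<open>The hypothesis on \<open>g^n\<close>, translated by \<open>g^r\<close> on
        the left and by a power of \<open>\<delta>\<close> on the right.\<close>
      have 2: "g [^] r \<otimes> x \<otimes> \<delta> [^] e i \<preceq> g [^] r \<otimes> (g [^] n \<otimes> x \<otimes> \<delta>) \<otimes> \<delta> [^] e i"
        using le le_shift g x unfolding n_def by simp
      have 3: "g [^] r \<otimes> (g [^] n \<otimes> x \<otimes> \<delta>) \<otimes> \<delta> [^] e i = g [^] j \<otimes> t i \<otimes> \<delta> [^] (1::nat)"
        unfolding gt r(1) using g x nat_pow_Suc2[of \<delta> "e i"]
        by (simp add: m_assoc nat_pow_mult[symmetric] add.commute[of n] del: nat_pow_Suc)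
      have "t r \<preceq> g [^] j \<otimes> t i \<otimes> \<delta> [^] (1::nat)"
        using le_trans[OF 1 2] 3 g x tc by simp
      then show ?thesis using yt[OF r(2)] le_trans[of y "t r"] yc tc g by simp
    qed
    ultimately show ?thesis using yc unfolding glb_def by auto
  qed
  define S where "S k = (\<lambda>i::nat. g [^] i \<otimes> y) ` {..k}" for k :: nat
  have "\<exists>z. glb (S k) z" for k
    using glb_exists[of "S k"] g yc unfolding S_def by fastforce
  then obtain z where z: "\<And>k. glb (S k) (z k)" by metis
  then have zc: "z k \<in> carrier G" for k unfolding glb_def by blast
  have z_mono: "z l \<preceq> z k" if "k \<le> l" for k l
    using z[of k] z[of l] that unfolding glb_def S_def by auto
  have "inv y \<otimes> z k \<otimes> \<delta> \<in> D" if k: "k \<le> n" for k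
  proof -
    have "z k \<preceq> y" using z[of k] yc unfolding glb_def S_def by (force simp: image_iff)
    then have 1: "inv y \<otimes> z k \<otimes> \<delta> \<preceq> \<delta>"
      using le_shift[of "inv y" "z k" y 1] yc zc by simp
    have "glb ((\<lambda>w. \<one> \<otimes> w \<otimes> \<delta> [^] (1::nat)) ` S k) (\<one> \<otimes> z k \<otimes> \<delta> [^] (1::nat))"
      by (rule glb_shift[OF z]) (use g yc in \<open>auto simp: S_def\<close>)
    moreover have "y \<preceq> \<one> \<otimes> w \<otimes> \<delta> [^] (1::nat)" if "w \<in> S k" for w
      using that y_le k g yc unfolding S_def by auto
    ultimately have "y \<preceq> z k \<otimes> \<delta>" using yc zc unfolding glb_def by auto
    then have "inv y \<otimes> z k \<otimes> \<delta> \<in> P" using yc zc unfolding le_def by (simp add: m_assoc)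
    then show ?thesis using 1 unfolding D_def by simp
  qed
  then have "\<not> inj_on (\<lambda>k. inv y \<otimes> z k \<otimes> \<delta>) {..n}"
    using card_inj_on_le[of "\<lambda>k. inv y \<otimes> z k \<otimes> \<delta>" "{..n}" D] finite_D n_def by auto
  then obtain i j where ij: "i < j" "inv y \<otimes> z i \<otimes> \<delta> = inv y \<otimes> z j \<otimes> \<delta>"
    unfolding inj_on_def by (metis linorder_neqE_nat)
  then have "z i = z j" using yc zc by simp
  \<comment> \<open>The chain descends, so \<open>z (Suc i)\<close> is squeezed between
    \<open>z j = z i\<close> and \<open>z i\<close>.\<close>
  then have zi: "z i \<preceq> z (Suc i)" using z_mono[of "Suc i" j] ij(1) by simp
  have "glb ((\<lambda>w. g \<otimes> w \<otimes> \<delta> [^] (0::nat)) ` S i) (g \<otimes> z i \<otimes> \<delta> [^] (0::nat))"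
    by (rule glb_shift[OF z]) (use g yc in \<open>auto simp: S_def\<close>)
  moreover have "z i \<preceq> g \<otimes> w \<otimes> \<delta> [^] (0::nat)" if "w \<in> S i" for w
  proof -
    obtain l where l: "l \<le> i" "w = g [^] l \<otimes> y" using \<open>w \<in> S i\<close> unfolding S_def by blast
    have "g \<otimes> w = g [^] Suc l \<otimes> y"
      using g yc l(2) nat_pow_Suc2[OF g, of l] by (simp add: m_assoc del: nat_pow_Suc)
    then have "g \<otimes> w \<in> S (Suc i)" using l(1) unfolding S_def by (intro image_eqI[of _ _ "Suc l"]) auto
    then have "z (Suc i) \<preceq> g \<otimes> w" using z[of "Suc i"] unfolding glb_def by blast
    then show ?thesis using le_trans[OF zi] zc g yc l(2) by simp
  qed
  ultimately have "z i \<preceq> g \<otimes> z i" using zc g unfolding glb_def by auto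
  then show ?thesis using zc by blast
qed

text \<open>One step of the greedy decomposition: \<open>v\<close> lies below both
  \<open>v \<delta>^q\<close> and \<open>\<delta>^(q+1)\<close>, hence below their meet
  \<open>s \<delta>^q\<close>.\<close>

lemma meet_remainder:
  assumes v: "v \<in> P" "v \<preceq> \<delta> [^] Suc q" and s: "glb {v, \<delta>} s"
  shows "s \<in> D" "inv s \<otimes> v \<in> P" "inv s \<otimes> v \<preceq> \<delta> [^] q"
proof -
  have vc: "v \<in> carrier G" using v by simp
  have sc: "s \<in> carrier G" and sv: "s \<preceq> v" "s \<preceq> \<delta>"
    and s_glb: "\<And>z. z \<in> carrier G \<Longrightarrow> z \<preceq> v \<Longrightarrow> z \<preceq> \<delta> \<Longrightarrow> z \<preceq> s" using s unfolding glb_def by auto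
  have "s \<in> P" using s_glb[of \<one>] sc v delta_cone one_le by simp
  then show "s \<in> D" unfolding D_def using sv by simp
  show "inv s \<otimes> v \<in> P" using sv(1) unfolding le_def .
  have "glb ((\<lambda>w. \<one> \<otimes> w \<otimes> \<delta> [^] q) ` {v, \<delta>}) (\<one> \<otimes> s \<otimes> \<delta> [^] q)"
    by (rule glb_shift[OF s]) (use v in auto)
  moreover have "v \<preceq> v \<otimes> \<delta> [^] q" using le_delta_pow v by simp
  moreover have "v \<preceq> \<delta> \<otimes> \<delta> [^] q"
    using v(2) nat_pow_Suc2[OF delta_closed, of q] by simp
  ultimately have "v \<preceq> s \<otimes> \<delta> [^] q" using vc sc unfolding glb_def by auto
  then show "inv s \<otimes> v \<preceq> \<delta> [^] q"
    using le_left[of "inv s" v "s \<otimes> \<delta> [^] q"] sc vc by simp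
qed

lemma simple_factors:
  assumes "v \<in> P" "v \<preceq> \<delta> [^] (q::nat)"
  shows "\<exists>ds. set ds \<subseteq> D \<and> length ds = q \<and> v = word_prod G ds"
  using assms
proof (induction q arbitrary: v)
  case 0
  then have "v = \<one>" using le_antisym[of v \<one>] one_le[of v] by simp
  then show ?case by simp
next
  case (Suc q)
  note v = \<open>v \<in> P\<close>
  have vc: "v \<in> carrier G" using v by simp
  obtain s where s: "glb {v, \<delta>} s" using glb_exists[of "{v, \<delta>}"] v by auto
  note rem = meet_remainder[OF Suc.prems s]
  obtain ds where "set ds \<subseteq> D" "length ds = q" "inv s \<otimes> v = word_prod G ds"
    using Suc.IH[OF rem(2,3)] by blast
  moreover have "v = s \<otimes> (inv s \<otimes> v)" using rem(1) vc by simp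
  ultimately show ?case using rem(1) by (intro exI[of _ "s # ds"]) auto
qed

lemma word_prod_closed: "set xs \<subseteq> carrier G \<Longrightarrow> word_prod G xs \<in> carrier G"
  by (induction xs) auto

lemma word_prod_append:
  "set xs \<subseteq> carrier G \<Longrightarrow> set ys \<subseteq> carrier G \<Longrightarrow>
    word_prod G (xs @ ys) = word_prod G xs \<otimes> word_prod G ys"
  by (induction xs) (auto simp: m_assoc word_prod_closed)

lemma interval_subset:
  "{v \<in> P. v \<preceq> \<delta> [^] (q::nat)} \<subseteq> word_prod G ` {ds. set ds \<subseteq> D \<and> length ds = q}"
  using simple_factors by blast

lemma finite_delta_interval: "finite {v \<in> P. v \<preceq> \<delta> [^] (q::nat)}"
  using interval_subset finite_lists_length_eq[OF finite_D] by (rule finite_surj[rotated])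

lemma card_delta_interval: "card {v \<in> P. v \<preceq> \<delta> [^] (q::nat)} \<le> card D ^ q"
  using surj_card_le[OF finite_lists_length_eq[OF finite_D] interval_subset[of q]]
    card_lists_length_eq[OF finite_D, of q] by simp

text \<open>By normality of \<open>\<delta>\<close> the first condition on products says
  \<open>\<delta>^-k \<preceq> g\<close>, and the second says \<open>g \<preceq> \<delta>^k\<close>.
  This is the notion of length used throughout: a ball of radius \<open>k\<close> about
  \<open>\<one>\<close>.\<close>

definition bd :: "nat \<Rightarrow> 'a \<Rightarrow> bool" where
  "bd k g \<longleftrightarrow> g \<in> carrier G \<and> g \<otimes> \<delta> [^] k \<in> P \<and> inv g \<otimes> \<delta> [^] k \<in> P"

lemma bd_closed: "bd k g \<Longrightarrow> g \<in> carrier G"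
  unfolding bd_def by simp

lemma bd_inv: "bd k g \<Longrightarrow> bd k (inv g)"
  unfolding bd_def by auto

lemma bd_one: "bd k \<one>"
  unfolding bd_def by (simp add: delta_pow_cone)

lemma bd_mult:
  assumes "bd k g" "bd l h" shows "bd (k + l) (g \<otimes> h)"
proof -
  have *: "a \<otimes> b \<otimes> \<delta> [^] (i + j) \<in> P"
    if "a \<in> carrier G" "b \<in> carrier G" "a \<otimes> \<delta> [^] i \<in> P" "b \<otimes> \<delta> [^] j \<in> P" for a b and i j :: nat
  proof -
    \<comment> \<open>A factor \<open>\<delta>^i\<close> is inserted after \<open>a\<close> at the
      price of conjugating \<open>b \<delta>^j\<close> by it, which preserves positivity.\<close>
    have "a \<otimes> b \<otimes> \<delta> [^] (i + j) = (a \<otimes> \<delta> [^] i) \<otimes> (inv (\<delta> [^] i) \<otimes> (b \<otimes> \<delta> [^] j) \<otimes> \<delta> [^] i)"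
      using that unfolding add.commute[of i j] by (simp add: m_assoc nat_pow_mult[symmetric])
    then show ?thesis
      using that mult_cone[OF that(3)] delta_pow_normal[of "b \<otimes> \<delta> [^] j" i] by simp
  qed
  show ?thesis
    using assms *[of g h k l] *[of "inv h" "inv g" l k]
    unfolding bd_def by (auto simp: inv_mult_group add.commute)
qed

lemma bd_mono:
  assumes "bd k g" "k \<le> l" shows "bd l g"
proof -
  have "a \<otimes> \<delta> [^] l \<in> P" if "a \<in> carrier G" "a \<otimes> \<delta> [^] k \<in> P" for a
  proof -
    have "a \<otimes> \<delta> [^] l = a \<otimes> \<delta> [^] k \<otimes> \<delta> [^] (l - k)"
      using that(1) assms(2) by (simp add: m_assoc nat_pow_mult)
    then show ?thesis using mult_cone[OF that(2) delta_pow_cone] by simp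
  qed
  then show ?thesis using assms(1) unfolding bd_def by simp
qed

lemma bd_D: "x \<in> D \<Longrightarrow> bd 1 x"
  unfolding bd_def D_def le_def by (auto simp: mult_cone delta_cone)

lemma bd_exists: "g \<in> carrier G \<Longrightarrow> \<exists>k. bd k g"
proof -
  assume g: "g \<in> carrier G"
  obtain k l where kl: "g \<otimes> \<delta> [^] (k::nat) \<in> P" "inv g \<otimes> \<delta> [^] (l::nat) \<in> P"
    using cofinal[OF g] cofinal[of "inv g"] g by auto
  have "g \<otimes> \<delta> [^] (k + l) = g \<otimes> \<delta> [^] k \<otimes> \<delta> [^] l" "inv g \<otimes> \<delta> [^] (k + l) = inv g \<otimes> \<delta> [^] l \<otimes> \<delta> [^] k"
    using g by (simp_all add: m_assoc nat_pow_mult add.commute)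
  then have "bd (k + l) g"
    using kl g mult_cone delta_pow_cone unfolding bd_def by simp
  then show ?thesis by blast
qed

section \<open>Operations on simple elements\<close>

lemma D_cone: "d \<in> D \<Longrightarrow> d \<in> P"
  unfolding D_def by simp

lemma D_conj: "d \<in> D \<Longrightarrow> inv \<delta> \<otimes> d \<otimes> \<delta> \<in> D"
proof -
  assume d: "d \<in> D"
  have "inv (inv \<delta> \<otimes> d \<otimes> \<delta>) \<otimes> \<delta> = inv \<delta> \<otimes> (inv d \<otimes> \<delta>) \<otimes> \<delta>"
    using d by (simp add: inv_mult_group m_assoc)
  then show ?thesis
    using d delta_normal[of d] delta_normal[of "inv d \<otimes> \<delta>"] unfolding D_def le_def by simp
qed

lemma D_complement: "d \<in> D \<Longrightarrow> inv d \<otimes> \<delta> \<in> D"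
proof -
  assume d: "d \<in> D"
  have "inv (inv d \<otimes> \<delta>) \<otimes> \<delta> = inv \<delta> \<otimes> d \<otimes> \<delta>" using d by (simp add: inv_mult_group)
  then show ?thesis using d delta_normal[of d] unfolding D_def le_def by simp
qed

lemma D_mult_le: "a \<in> D \<Longrightarrow> b \<in> D \<Longrightarrow> a \<otimes> b \<preceq> \<delta> [^] Suc 1"
proof -
  assume ab: "a \<in> D" "b \<in> D"
  have "a \<otimes> b \<preceq> a \<otimes> \<delta>" using ab le_left unfolding D_def by simp
  moreover have "a \<otimes> \<delta> \<preceq> \<delta> \<otimes> \<delta>" using ab le_right[of a \<delta> 1] unfolding D_def by simp
  ultimately show ?thesis using le_trans ab by simp
qed

lemma glb_unique: "glb S m \<Longrightarrow> glb S n \<Longrightarrow> m = n"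
  unfolding glb_def using le_antisym by blast

text \<open>As \<open>\<delta> \<preceq> a \<delta>\<close> for positive \<open>a\<close>, anything
  below \<open>a v\<close> and \<open>\<delta>\<close> is below the meet \<open>a h\<close> of
  \<open>a v\<close> and \<open>a \<delta>\<close>. The meet of a product with
  \<open>\<delta>\<close> can thus be computed letter by letter, remembering only a simple
  element.\<close>

lemma glb_mult_delta:
  assumes a: "a \<in> P" and v: "v \<in> P" and h: "glb {v, \<delta>} h" and t: "glb {a \<otimes> h, \<delta>} t"
  shows "glb {a \<otimes> v, \<delta>} t"
proof -
  have hc: "h \<in> carrier G" "h \<preceq> v" and tc: "t \<in> carrier G" "t \<preceq> a \<otimes> h" "t \<preceq> \<delta>"
    using h t unfolding glb_def by auto
  have "t \<preceq> a \<otimes> v" using le_trans[OF tc(2)] le_left hc tc(1) a v by simp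
  moreover have "z \<preceq> t" if z: "z \<in> carrier G" "z \<preceq> a \<otimes> v" "z \<preceq> \<delta>" for z
  proof -
    have "\<one> \<otimes> \<one> \<otimes> \<delta> [^] (1::nat) \<preceq> \<one> \<otimes> a \<otimes> \<delta> [^] (1::nat)"
      using a one_le by (subst le_shift) auto
    then have "\<delta> \<preceq> a \<otimes> \<delta>" using a by simp
    then have "z \<preceq> a \<otimes> \<delta>" using le_trans[OF z(3)] z(1) a by simp
    moreover have "glb ((\<lambda>w. a \<otimes> w \<otimes> \<delta> [^] (0::nat)) ` {v, \<delta>}) (a \<otimes> h \<otimes> \<delta> [^] (0::nat))"
      by (rule glb_shift[OF h]) (use v a in auto)
    ultimately have "z \<preceq> a \<otimes> h" using z a v hc(1) unfolding glb_def by auto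
    then show ?thesis using t z unfolding glb_def by blast
  qed
  ultimately show ?thesis using tc unfolding glb_def by auto
qed

section \<open>Growth of powers\<close>

lemma bd_pow_int:
  assumes "bd k g" shows "bd (k * nat \<bar>c\<bar>) (g [^] (c::int))"
proof -
  have pow: "bd (k * n) (g [^] (n::nat))" for n
  proof (induction n)
    case (Suc n)
    then show ?case using bd_mult[OF Suc assms] by (simp add: add.commute)
  qed (simp add: bd_one)
  show ?thesis
  proof (cases "0 \<le> c")
    case True
    then have "g [^] c = g [^] nat c" unfolding int_pow_def2 by simp
    then show ?thesis using pow[of "nat c"] True by simp
  next
    case False
    then have "g [^] c = inv (g [^] nat (- c))" unfolding int_pow_def2 by simp
    then show ?thesis using bd_inv[OF pow[of "nat (- c)"]] False by simp
  qed
qed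

text \<open>Ensures that conjugation steps by \<open>inv \<delta>\<close> never leave a box of
  tuples.\<close>

lemma bd_delta_conj:
  assumes "bd k g" shows "bd k (\<delta> \<otimes> g \<otimes> inv \<delta>)"
proof -
  have *: "\<delta> \<otimes> a \<otimes> inv \<delta> \<otimes> \<delta> [^] k \<in> P" if "a \<in> carrier G" "a \<otimes> \<delta> [^] k \<in> P" for a
  proof -
    have comm: "\<delta> [^] k \<otimes> \<delta> = \<delta> \<otimes> \<delta> [^] k" using nat_pow_Suc2[of \<delta> k] by simp
    have "inv \<delta> \<otimes> \<delta> [^] k = inv \<delta> \<otimes> (\<delta> [^] k \<otimes> \<delta>) \<otimes> inv \<delta>" by (simp add: m_assoc)
    also have "\<dots> = \<delta> [^] k \<otimes> inv \<delta>" unfolding comm by (simp add: m_assoc)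
    finally have "inv \<delta> \<otimes> \<delta> [^] k = \<delta> [^] k \<otimes> inv \<delta>" .
    then have "inv \<delta> \<otimes> (\<delta> \<otimes> a \<otimes> inv \<delta> \<otimes> \<delta> [^] k) \<otimes> \<delta> = a \<otimes> \<delta> [^] k"
      using that(1) by (simp add: m_assoc)
    then show ?thesis
      using delta_normal[of "\<delta> \<otimes> a \<otimes> inv \<delta> \<otimes> \<delta> [^] k"] that by simp
  qed
  show ?thesis
    using assms *[of g] *[of "inv g"] unfolding bd_def by (simp add: inv_mult_group m_assoc)
qed

lemma bd_subset:
  "{g. bd k g} \<subseteq> (\<lambda>v. v \<otimes> inv (\<delta> [^] k)) ` {v \<in> P. v \<preceq> \<delta> [^] (2 * k)}"
proof
  fix g assume "g \<in> {g. bd k g}"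
  then have g: "g \<in> carrier G" "g \<otimes> \<delta> [^] k \<in> P" "g \<preceq> \<delta> [^] k" unfolding bd_def le_def by auto
  have "g \<otimes> \<delta> [^] k \<preceq> \<delta> [^] k \<otimes> \<delta> [^] k" using g le_right by simp
  then have "g \<otimes> \<delta> [^] k \<preceq> \<delta> [^] (2 * k)" by (simp add: nat_pow_mult mult_2)
  moreover have "g = g \<otimes> \<delta> [^] k \<otimes> inv (\<delta> [^] k)" using g(1) by (simp add: m_assoc)
  ultimately show "g \<in> (\<lambda>v. v \<otimes> inv (\<delta> [^] k)) ` {v \<in> P. v \<preceq> \<delta> [^] (2 * k)}" using g(2) by blast
qed

lemma finite_bd: "finite {g. bd k g}"
  using finite_surj[OF finite_delta_interval bd_subset] .

text \<open>The explicit cardinality matters: it becomes a computable bound for the number of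
  conjugation steps.\<close>

lemma card_bd: "card {g. bd k g} \<le> card D ^ (2 * k)"
  using order.trans[OF surj_card_le[OF finite_delta_interval bd_subset] card_delta_interval] .

text \<open>The orbit \<open>g^i y\<close> ascends while \<open>g^i z\<close> stays below
  \<open>z\<close>. Comparing \<open>y\<close> with \<open>z\<close> up to a power of
  \<open>\<delta>\<close> confines the ascending orbit to a finite interval, so it repeats a value
  and must be constant.\<close>

lemma positive_negative_trivial:
  assumes g: "g \<in> carrier G" and y: "y \<in> carrier G" "y \<preceq> g \<otimes> y"
    and z: "z \<in> carrier G" "z \<preceq> inv g \<otimes> z"
  shows "g = \<one>"
proof -
  have up: "g [^] i \<otimes> y \<preceq> g [^] (i + j) \<otimes> y" for i j :: nat
  proof (induction j)
    case (Suc j)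
    have "g [^] (i + j) \<otimes> y \<preceq> g [^] (i + j) \<otimes> (g \<otimes> y)" using g y le_left by simp
    then show ?case using le_trans[OF Suc] g y(1) by (simp add: m_assoc)
  qed (use g y in simp)
  have down: "g [^] i \<otimes> z \<preceq> z" for i :: nat
  proof (induction i)
    case (Suc i)
    have "g \<otimes> z \<preceq> z" using g z le_left[of g z "inv g \<otimes> z"] by simp
    then have "g [^] i \<otimes> (g \<otimes> z) \<preceq> g [^] i \<otimes> z" using g z le_left by simp
    then show ?case using le_trans[OF _ Suc] g z(1) by (simp add: m_assoc)
  qed (use z in simp)
  obtain k where k: "bd k (inv y \<otimes> z)" using bd_exists[of "inv y \<otimes> z"] y z by auto
  obtain l where l: "bd l (inv y \<otimes> z \<otimes> \<delta> [^] k)"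
    using bd_exists[of "inv y \<otimes> z \<otimes> \<delta> [^] k"] y z by auto
  have "inv y \<otimes> (g [^] i \<otimes> y) \<in> {v \<in> P. v \<preceq> \<delta> [^] l}" for i :: nat
  proof -
    have "y \<preceq> z \<otimes> \<delta> [^] k" using k y z unfolding bd_def le_def by (simp add: m_assoc)
    then have "g [^] i \<otimes> y \<preceq> g [^] i \<otimes> (z \<otimes> \<delta> [^] k)" using g y z le_left by simp
    moreover have "g [^] i \<otimes> z \<otimes> \<delta> [^] k \<preceq> z \<otimes> \<delta> [^] k" using down g z le_right by simp
    ultimately have "g [^] i \<otimes> y \<preceq> z \<otimes> \<delta> [^] k"
      using le_trans[of "g [^] i \<otimes> y" "g [^] i \<otimes> z \<otimes> \<delta> [^] k" "z \<otimes> \<delta> [^] k"] g y z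
      by (simp add: m_assoc)
    then have "inv y \<otimes> (g [^] i \<otimes> y) \<preceq> inv y \<otimes> (z \<otimes> \<delta> [^] k)" using le_left g y z by simp
    moreover have "inv y \<otimes> (z \<otimes> \<delta> [^] k) \<preceq> \<delta> [^] l"
      using l y z unfolding bd_def le_def by (simp add: m_assoc)
    ultimately have "inv y \<otimes> (g [^] i \<otimes> y) \<preceq> \<delta> [^] l"
      using le_trans[of "inv y \<otimes> (g [^] i \<otimes> y)" "inv y \<otimes> (z \<otimes> \<delta> [^] k)"] g y z by simp
    moreover have "y \<preceq> g [^] i \<otimes> y" using up[of 0 i] y(1) by simp
    ultimately show ?thesis unfolding le_def by simp
  qed
  then have "range (\<lambda>i::nat. inv y \<otimes> (g [^] i \<otimes> y)) \<subseteq> {v \<in> P. v \<preceq> \<delta> [^] l}" by blast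
  then have "\<not> inj (\<lambda>i::nat. inv y \<otimes> (g [^] i \<otimes> y))"
    using finite_delta_interval finite_subset range_inj_infinite by blast
  then obtain i j :: nat where ij: "i < j" "inv y \<otimes> (g [^] i \<otimes> y) = inv y \<otimes> (g [^] j \<otimes> y)"
    unfolding inj_on_def by (metis linorder_neqE_nat)
  then have "g [^] i \<otimes> y = g [^] j \<otimes> y" using g y by simp
  then have "g [^] Suc i \<otimes> y \<preceq> g [^] i \<otimes> y" using up[of "Suc i" "j - Suc i"] ij(1) by simp
  then have "g [^] i \<otimes> (g \<otimes> y) \<preceq> g [^] i \<otimes> y" using g y(1) by (simp add: m_assoc)
  then have "g \<otimes> y \<preceq> y" using g y le_left by simp
  then have "g \<otimes> y = y" using le_antisym g y by simp
  then show ?thesis using g y(1) r_cancel_one by simp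
qed

text \<open>Boundedness gives \<open>\<one> \<preceq> a^(n m) \<delta>^m\<close> for
  \<open>a = g\<close> and for \<open>a = inv g\<close>, where n = \<open>card D\<close>.
  \<open>shift_root\<close> extracts an m-th root of this inequality, which leaves a single
  \<open>\<delta>\<close>, and \<open>shift_root_card\<close> then extracts an n-th root that
  absorbs it.\<close>

lemma power_unbounded:
  assumes "g \<in> carrier G" "g \<noteq> \<one>" "0 < m"
  shows "\<not> bd m (g [^] (card D * m))"
proof
  assume bd: "bd m (g [^] (card D * m))"
  have *: "\<exists>y\<in>carrier G. y \<preceq> a \<otimes> y" if a: "a \<in> carrier G" "a [^] (card D * m) \<otimes> \<delta> [^] m \<in> P" for a
  proof -
    have "\<one> \<preceq> (a [^] card D) [^] m \<otimes> \<one> \<otimes> \<delta> [^] (1 * m)"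
      using a one_le by (simp add: nat_pow_pow)
    then obtain x where "x \<in> carrier G" "x \<preceq> a [^] card D \<otimes> x \<otimes> \<delta> [^] (1::nat)"
      using shift_root[of "a [^] card D" \<one> m 1] a(1) assms(3) by auto
    then show ?thesis using shift_root_card[of a x] a(1) by simp
  qed
  have "inv g [^] (card D * m) = inv (g [^] (card D * m))"
    using assms(1) by (simp add: nat_pow_inv)
  then show False
    using *[of g] *[of "inv g"] bd assms positive_negative_trivial unfolding bd_def by auto
qed

lemma torsion_free:
  assumes "g \<in> carrier G" "g [^] (c::int) = \<one>" "c \<noteq> 0" shows "g = \<one>"
proof (rule ccontr)
  assume "g \<noteq> \<one>"
  have "g [^] nat \<bar>c\<bar> = \<one>"
  proof (cases "0 \<le> c")
    case True
    then show ?thesis using assms(2) unfolding int_pow_def2 by simp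
  next
    case False
    then have "inv (g [^] nat (- c)) = \<one>" using assms(2) unfolding int_pow_def2 by simp
    then show ?thesis using False assms(1) by (simp add: inv_eq_1_iff)
  qed
  then have "g [^] (card D * nat \<bar>c\<bar>) = \<one>"
    using nat_pow_pow[OF assms(1), of "nat \<bar>c\<bar>" "card D"] by (simp add: mult.commute)
  then show False
    using power_unbounded[of g "nat \<bar>c\<bar>"] assms \<open>g \<noteq> \<one>\<close> bd_one by simp
qed

section \<open>Commuting families\<close>

definition mpow :: "(nat \<Rightarrow> 'a) \<Rightarrow> (nat \<Rightarrow> int) \<Rightarrow> nat \<Rightarrow> 'a" where
  "mpow b c k = word_prod G (map (\<lambda>i. b i [^] c i) [0..<k])"

definition commuting_fam :: "(nat \<Rightarrow> 'a) \<Rightarrow> nat \<Rightarrow> bool" where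
  "commuting_fam b k \<longleftrightarrow> (\<forall>i<k. b i \<in> carrier G \<and> (\<forall>j<k. b i \<otimes> b j = b j \<otimes> b i))"

lemma commuting_closed: "commuting_fam b k \<Longrightarrow> i < k \<Longrightarrow> b i \<in> carrier G"
  unfolding commuting_fam_def by blast

lemma commuting_Suc: "commuting_fam b (Suc k) \<Longrightarrow> commuting_fam b k"
  unfolding commuting_fam_def by simp

abbreviation gspan :: "(nat \<Rightarrow> 'a) \<Rightarrow> nat \<Rightarrow> 'a set" where
  "gspan b k \<equiv> generate G (b ` {..<k})"

lemma gspan_closed: "commuting_fam b k \<Longrightarrow> x \<in> gspan b k \<Longrightarrow> x \<in> carrier G"
  using generate_in_carrier[of "b ` {..<k}"] commuting_closed by blast

lemma gspan_commute: "commuting_fam b k \<Longrightarrow> x \<in> gspan b k \<Longrightarrow> y \<in> gspan b k \<Longrightarrow> x \<otimes> y = y \<otimes> x"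
  by (rule generate_commute[of "b ` {..<k}"]) (auto simp: commuting_fam_def)

lemma gspan_subgroup: "commuting_fam b k \<Longrightarrow> subgroup (gspan b k) G"
  by (intro generate_is_subgroup) (auto simp: commuting_fam_def)

lemma gspan_pow: "commuting_fam b k \<Longrightarrow> x \<in> gspan b k \<Longrightarrow> x [^] (c::int) \<in> gspan b k"
  using subgroup_int_pow_closed gspan_subgroup by blast

lemma gspan_mono: "k \<le> l \<Longrightarrow> gspan b k \<subseteq> gspan b l"
  by (intro mono_generate) auto

lemma gspan_SucI: "x \<in> gspan b k \<Longrightarrow> x \<in> gspan b (Suc k)"
  using gspan_mono[of k "Suc k" b] by auto

lemma mpow_0: "mpow b c 0 = \<one>"
  unfolding mpow_def by simp

lemma mpow_Suc: "commuting_fam b (Suc k) \<Longrightarrow> mpow b c (Suc k) = mpow b c k \<otimes> b k [^] c k"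
  using word_prod_append[of "map (\<lambda>i. b i [^] c i) [0..<k]" "[b k [^] c k]"]
  unfolding mpow_def by (auto simp: commuting_fam_def image_subset_iff)

lemma mpow_in_gspan: "commuting_fam b k \<Longrightarrow> mpow b c k \<in> gspan b k"
proof (induction k)
  case (Suc k)
  then have "mpow b c k \<in> gspan b (Suc k)" using gspan_SucI commuting_Suc by blast
  moreover have "b k \<in> gspan b (Suc k)" by (auto intro: generate.incl)
  ultimately show ?case using Suc.prems gspan_pow by (auto simp: mpow_Suc intro: generate.eng)
qed (simp add: mpow_0 generate.one)

lemma mpow_closed [simp]: "commuting_fam b k \<Longrightarrow> mpow b c k \<in> carrier G"
  using mpow_in_gspan gspan_closed by blast

lemma mpow_cong: "(\<And>i. i < k \<Longrightarrow> b i = b' i \<and> c i = c' i) \<Longrightarrow> mpow b c k = mpow b' c' k"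
  unfolding mpow_def by (intro arg_cong[of _ _ "word_prod G"] map_cong) auto

lemma mpow_zero: "commuting_fam b k \<Longrightarrow> (\<And>i. i < k \<Longrightarrow> c i = 0) \<Longrightarrow> mpow b c k = \<one>"
proof (induction k)
  case (Suc k)
  then show ?case
    using commuting_closed[of b "Suc k" k] commuting_Suc[of b k] by (simp add: mpow_Suc)
qed (simp add: mpow_0)

lemma mpow_add:
  "commuting_fam b k \<Longrightarrow> mpow b (\<lambda>i. c i + d i) k = mpow b c k \<otimes> mpow b d k"
proof (induction k)
  case (Suc k)
  note comm = Suc.prems and comm' = commuting_Suc[OF Suc.prems]
  have bk: "b k \<in> gspan b (Suc k)" by (auto intro: generate.incl)
  then have bkc: "b k [^] c k \<in> gspan b (Suc k)" "b k \<in> carrier G" using comm gspan_pow gspan_closed by blast+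
  have "mpow b d k \<in> gspan b (Suc k)" using mpow_in_gspan[OF comm'] by (rule gspan_SucI)
  then have "b k [^] c k \<otimes> mpow b d k = mpow b d k \<otimes> b k [^] c k"
    using gspan_commute[OF comm bkc(1)] by blast
  then have eq: "b k [^] c k \<otimes> (mpow b d k \<otimes> z) = mpow b d k \<otimes> (b k [^] c k \<otimes> z)"
    if "z \<in> carrier G" for z
    using that comm' bkc(2) by (simp add: m_assoc[symmetric])
  show ?case
    using comm comm' bkc(2) Suc.IH by (simp add: mpow_Suc int_pow_mult m_assoc eq)
qed (simp add: mpow_0)

lemma mpow_scale:
  "commuting_fam b k \<Longrightarrow> mpow b (\<lambda>i. m * c i) k = mpow b c k [^] (m::int)"
proof (induction k)
  case (Suc k)
  note comm = Suc.prems and comm' = commuting_Suc[OF Suc.prems]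
  have bk: "b k \<in> gspan b (Suc k)" by (auto intro: generate.incl)
  then have bkc: "b k [^] c k \<in> gspan b (Suc k)" "b k \<in> carrier G" using comm gspan_pow gspan_closed by blast+
  have "mpow b c k \<in> gspan b (Suc k)" using mpow_in_gspan[OF comm'] by (rule gspan_SucI)
  then have "mpow b c k \<otimes> b k [^] c k = b k [^] c k \<otimes> mpow b c k"
    using gspan_commute[OF comm _ bkc(1)] by blast
  then have "(mpow b c k \<otimes> b k [^] c k) [^] m = mpow b c k [^] m \<otimes> (b k [^] c k) [^] m"
    using comm' bkc(2) by (intro int_pow_mult_distrib) auto
  then show ?case
    using comm comm' bkc(2) Suc.IH by (simp add: mpow_Suc int_pow_pow mult.commute)
qed (simp add: mpow_0)

lemma mpow_unit:
  "commuting_fam b k \<Longrightarrow> j < k \<Longrightarrow> mpow b (\<lambda>i. if i = j then m else 0) k = b j [^] m"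
proof (induction k)
  case (Suc k)
  show ?case
  proof (cases "j = k")
    case True
    have "mpow b (\<lambda>i. if i = j then m else 0) k = \<one>"
      using True by (intro mpow_zero[OF commuting_Suc[OF Suc.prems(1)]]) auto
    then show ?thesis using True Suc.prems commuting_closed[of b "Suc k" k] by (simp add: mpow_Suc)
  next
    case False
    then show ?thesis
      using Suc.IH[OF commuting_Suc[OF Suc.prems(1)]] Suc.prems commuting_closed[of b "Suc k"]
      by (simp add: mpow_Suc)
  qed
qed simp

lemma gspan_mpow: "commuting_fam b k \<Longrightarrow> x \<in> gspan b k \<Longrightarrow> \<exists>c. x = mpow b c k"
proof -
  assume comm: "commuting_fam b k" and "x \<in> gspan b k"
  from this(2) show ?thesis
  proof (induction rule: generate.induct)
    case one
    then show ?case using mpow_zero[OF comm, of "\<lambda>_. 0"] by metis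
  next
    case (incl h)
    then obtain j where "j < k" "h = b j" by blast
    then show ?case using mpow_unit[OF comm, of j 1] commuting_closed[OF comm] by (metis int_pow_1)
  next
    case (inv h)
    then obtain j where "j < k" "h = b j" by blast
    then show ?case
      using mpow_unit[OF comm, of j "-1"] commuting_closed[OF comm, of j]
      by (metis int_pow_1 int_pow_neg)
  next
    case (eng h1 h2)
    then show ?case using mpow_add[OF comm] by metis
  qed
qed

section \<open>Relations and their approximation\<close>

lemma bd_mpow:
  assumes "commuting_fam b k" "\<And>i. i < k \<Longrightarrow> bd L (b i)"
  shows "bd (L * (\<Sum>i<k. nat \<bar>c i\<bar>)) (mpow b c k)"
  using assms
proof (induction k)
  case (Suc k)
  then show ?case
    using bd_mult[OF Suc.IH[OF commuting_Suc] bd_pow_int[of L "b k" "c k"]]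
    by (simp add: mpow_Suc distrib_left)
qed (simp add: mpow_0 bd_one)

definition independent :: "(nat \<Rightarrow> 'a) \<Rightarrow> nat \<Rightarrow> bool" where
  "independent b k \<longleftrightarrow> (\<forall>c. mpow b c k = \<one> \<longrightarrow> (\<forall>i<k. c i = 0))"

text \<open>Simultaneous Diophantine approximation of \<open>c/C\<close> by \<open>p/q\<close>: the element \<open>b\<^sup>p\<close>, raised to
  the power \<open>C\<close>, differs from \<open>(b\<^sup>c)\<^sup>q\<close> by a short element, so that the uniform lower bound for
  the growth of powers applies.\<close>

lemma approximate_relation:
  fixes c :: "nat \<Rightarrow> int" and Q L k :: nat
  assumes comm: "commuting_fam b k" and L: "\<And>i. i < k \<Longrightarrow> bd L (b i)"
    and i0: "i0 < k" "c i0 \<noteq> 0" "\<And>i. i < k \<Longrightarrow> \<bar>c i\<bar> \<le> \<bar>c i0\<bar>"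
    and Q: "2 \<le> Q" "2 * k * L * card D \<le> Q"
  obtains q p where "q \<le> Q ^ k" "p i0 \<noteq> 0" "\<And>i. i < k \<Longrightarrow> \<bar>p i\<bar> \<le> int (Q ^ k)"
    "mpow b p k = \<one> \<or> (\<forall>s r. 0 < s \<longrightarrow> bd r (mpow b c k [^] int (q * card D * s)) \<longrightarrow>
      nat \<bar>c i0\<bar> * s < 2 * r)"
proof -
  define C where "C = nat \<bar>c i0\<bar>"
  have C: "0 < C" "\<And>i. i < k \<Longrightarrow> \<bar>c i\<bar> \<le> int C" using i0 unfolding C_def by auto
  \<comment> \<open>The ratios \<open>c i / C\<close> are approximated with one common denominator
    \<open>q' \<le> Q^k\<close>.\<close>
  obtain q' p where q': "0 < q'" "q' \<le> int (Q ^ k)"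
    and approx: "\<And>i. i < k \<Longrightarrow> \<bar>of_int q' * (of_int (c i) / real C) - of_int (p i)\<bar> < 1 / real Q"
    by (rule Dirichlet_approx_simult[of Q, where n = k and \<theta> = "\<lambda>i. of_int (c i) / real C"])
      (use Q in auto)
  define q where "q = nat q'"
  have q: "0 < q" "q' = int q" "q \<le> Q ^ k" using q' unfolding q_def by (auto simp: nat_le_iff)
  \<comment> \<open>The approximation error cleared of denominators: \<open>C p = q c + e\<close>,
    with \<open>Q |e i| < C\<close>.\<close>
  define e where "e i = int C * p i - int q * c i" for i
  have e: "int Q * \<bar>e i\<bar> < int C" if i: "i < k" for i
  proof -
    have "real C * \<bar>of_int q' * (of_int (c i) / real C) - of_int (p i)\<bar> < real C * (1 / real Q)"
      using approx[OF i] C(1) by (intro mult_strict_left_mono) auto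
    also have "real C * \<bar>of_int q' * (of_int (c i) / real C) - of_int (p i)\<bar> =
        \<bar>real C * (of_int q' * (of_int (c i) / real C) - of_int (p i))\<bar>"
      by (simp add: abs_mult)
    also have "real C * (of_int q' * (of_int (c i) / real C) - of_int (p i)) = - of_int (e i)"
      using C(1) q(2) unfolding e_def by (simp add: field_simps)
    finally have "real Q * \<bar>of_int (e i)\<bar> < real C" using Q by (simp add: field_simps)
    then have "real_of_int (int Q * \<bar>e i\<bar>) < real_of_int (int C)" by simp
    then show ?thesis unfolding of_int_less_iff .
  qed
  \<comment> \<open>The largest coefficient has ratio 1 or -1, so \<open>p i0 = 0\<close> would
    leave an error of at least \<open>C\<close>.\<close>
  have "p i0 \<noteq> 0"
  proof
    assume "p i0 = 0"
    then have "\<bar>e i0\<bar> = int q * int C" unfolding e_def C_def by (simp add: abs_mult)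
    then have "int Q * (int q * int C) < int C" using e[OF i0(1)] by simp
    moreover have "1 * (1 * int C) \<le> int Q * (int q * int C)"
      using Q q(1) by (intro mult_mono) auto
    ultimately show False by simp
  qed
  moreover have "\<bar>p i\<bar> \<le> int (Q ^ k)" if i: "i < k" for i
  proof -
    have "int C * \<bar>p i\<bar> = \<bar>e i + int q * c i\<bar>" unfolding e_def by (simp add: abs_mult)
    also have "\<dots> \<le> \<bar>e i\<bar> + int q * \<bar>c i\<bar>" 
      using abs_triangle_ineq[of "e i" "int q * c i"] by (simp add: abs_mult)
    also have "\<dots> < int C + int q * int C"
    proof -
      have "\<bar>e i\<bar> \<le> int Q * \<bar>e i\<bar>" using Q by (simp add: mult_le_cancel_right1)
      then have "\<bar>e i\<bar> < int C" using e[OF i] by simp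
      moreover have "int q * \<bar>c i\<bar> \<le> int q * int C" using C(2)[OF i] by (simp add: mult_left_mono)
      ultimately show ?thesis by simp
    qed
    finally have "int C * \<bar>p i\<bar> < int C * (int q + 1)" by (simp add: algebra_simps)
    then have "\<bar>p i\<bar> \<le> int q" using C(1) by simp
    then show ?thesis using q(3) by (meson of_nat_le_iff order_trans)
  qed
  moreover have "C * s < 2 * r"
    if ne: "mpow b p k \<noteq> \<one>" and s: "0 < s" and r: "bd r (mpow b c k [^] int (q * card D * s))" for s r
  proof -
    \<comment> \<open>The exponent \<open>N C\<close> clears the denominator, so that the power of
      \<open>b^p\<close> splits into an error term and a power of \<open>b^c\<close>. As
      \<open>N C\<close> is \<open>card D\<close> times \<open>C s\<close>, it also has the form
      needed by \<open>power_unbounded\<close>.\<close>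
    define N where "N = card D * s"
    have NC: "N * C = card D * (C * s)" unfolding N_def by (simp add: mult_ac)
    have "mpow b p k [^] int (card D * (C * s)) = mpow b (\<lambda>i. int (N * C) * p i) k"
      using mpow_scale[OF comm, of "int (N * C)" p] unfolding NC by (rule sym)
    also have "\<dots> = mpow b (\<lambda>i. int N * e i + int (q * N) * c i) k"
      by (rule mpow_cong) (simp add: e_def algebra_simps)
    also have "\<dots> = mpow b (\<lambda>i. int N * e i) k \<otimes> mpow b c k [^] int (q * N)"
      using mpow_add[OF comm, of "\<lambda>i. int N * e i" "\<lambda>i. int (q * N) * c i"]
        mpow_scale[OF comm, of "int (q * N)" c] by (simp only:)
    finally have eq: "mpow b p k [^] (card D * (C * s)) =
        mpow b (\<lambda>i. int N * e i) k \<otimes> mpow b c k [^] int (q * N)"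
      by (simp only: int_pow_int)
    define E where "E = (\<Sum>i<k. nat \<bar>int N * e i\<bar>)"
    have "bd (L * E + r) (mpow b p k [^] (card D * (C * s)))"
      unfolding eq E_def by (intro bd_mult bd_mpow comm L) (use r in \<open>simp_all add: N_def mult_ac\<close>)
    moreover have "\<not> bd (C * s) (mpow b p k [^] (card D * (C * s)))"
      using power_unbounded[of "mpow b p k" "C * s"] ne s C(1) comm by simp
    ultimately have "C * s < L * E + r" using bd_mono not_le by blast
    \<comment> \<open>The size of \<open>Q\<close> makes the error term cost at most half of
      \<open>C s\<close>.\<close>
    moreover have "2 * (L * E) \<le> C * s"
    proof (cases "k = 0")
      case True
      then show ?thesis by (simp add: E_def)
    next
      case False
      have "k * (2 * (L * nat \<bar>int N * e i\<bar>)) \<le> C * s" if i: "i < k" for i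
      proof -
        have "k * (2 * (L * nat \<bar>int N * e i\<bar>)) = 2 * k * L * card D * nat \<bar>e i\<bar> * s"
          unfolding N_def by (simp add: abs_mult nat_mult_distrib)
        also have "\<dots> \<le> Q * nat \<bar>e i\<bar> * s" using Q(2) by (intro mult_right_mono) auto
        also have "\<dots> \<le> C * s"
        proof (rule mult_right_mono)
          have "int (Q * nat \<bar>e i\<bar>) \<le> int C" using e[OF i] by simp
          then show "Q * nat \<bar>e i\<bar> \<le> C" unfolding of_nat_le_iff .
        qed simp
        finally show ?thesis .
      qed
      then have "(\<Sum>i<k. k * (2 * (L * nat \<bar>int N * e i\<bar>))) \<le> (\<Sum>i<k. C * s)"
        by (intro sum_mono) simp
      then have "k * (2 * (L * E)) \<le> k * (C * s)"
        unfolding E_def by (simp add: sum_distrib_left)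
      then show ?thesis using False by simp
    qed
    ultimately show ?thesis by simp
  qed
  ultimately show ?thesis using that[of q p] q(3) unfolding C_def by blast
qed

lemma nonzero_max_index:
  fixes c :: "nat \<Rightarrow> int"
  assumes "j < k" "c j \<noteq> 0"
  obtains i where "i < k" "c i \<noteq> 0" "\<And>j. j < k \<Longrightarrow> \<bar>c j\<bar> \<le> \<bar>c i\<bar>"
proof -
  define S where "S = (\<lambda>i. \<bar>c i\<bar>) ` {..<k}"
  have S: "finite S" "S \<noteq> {}" using assms(1) unfolding S_def by auto
  obtain i where "i < k" "Max S = \<bar>c i\<bar>" using Max_in[OF S] unfolding S_def by blast
  then have i: "i < k" "\<And>j. j < k \<Longrightarrow> \<bar>c j\<bar> \<le> \<bar>c i\<bar>"
    using Max_ge[OF S(1)] unfolding S_def by auto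
  have "c i \<noteq> 0" using i(2)[OF assms(1)] assms(2) by auto
  then show ?thesis using that i by blast
qed

text \<open>For a relation \<open>b^c = \<one>\<close> the growth alternative would hold with
  \<open>r = 0\<close>, which is absurd. So the approximating vector is itself a relation, and its
  coefficients are small.\<close>

lemma bounded_relation:
  fixes Q L k :: nat
  assumes comm: "commuting_fam b k" and L: "\<And>i. i < k \<Longrightarrow> bd L (b i)"
    and Q: "2 \<le> Q" "2 * k * L * card D \<le> Q" and dep: "\<not> independent b k"
  obtains p i where "mpow b p k = \<one>" "i < k" "p i \<noteq> 0" "\<And>i. i < k \<Longrightarrow> \<bar>p i\<bar> \<le> int (Q ^ k)"
proof -
  obtain c j where c: "mpow b c k = \<one>" "j < k" "c j \<noteq> 0"
    using dep unfolding independent_def by blast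
  obtain i where i: "i < k" "c i \<noteq> 0" "\<And>j. j < k \<Longrightarrow> \<bar>c j\<bar> \<le> \<bar>c i\<bar>"
    by (rule nonzero_max_index[where c = c, OF c(2,3)]) (rule that)
  obtain q p where "q \<le> Q ^ k" and p: "p i \<noteq> 0" "\<And>i. i < k \<Longrightarrow> \<bar>p i\<bar> \<le> int (Q ^ k)"
    "mpow b p k = \<one> \<or> (\<forall>s r. 0 < s \<longrightarrow> bd r (mpow b c k [^] int (q * card D * s)) \<longrightarrow>
      nat \<bar>c i\<bar> * s < 2 * r)"
    by (rule approximate_relation[where c = c, OF comm L i Q]) (assumption | rule that)+
  have "bd 0 (mpow b c k [^] int (q * card D * 1))" unfolding c(1) by (simp add: bd_one)
  then have "mpow b p k = \<one>" using p(3) by (metis less_one mult_0_right not_less_zero)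
  then show ?thesis using that p i(1) by blast
qed

text \<open>Independence excludes \<open>b^p = \<one>\<close>, so the powers of \<open>b^c\<close>
  grow at a rate proportional to its largest coefficient. Conjugation by \<open>x\<close> adds at
  most \<open>2 E\<close> to the length of a power, however high, and therefore does not affect the
  bound.\<close>

lemma independent_bound:
  fixes Q L k T :: nat
  assumes comm: "commuting_fam b k" and L: "\<And>i. i < k \<Longrightarrow> bd L (b i)"
    and Q: "2 \<le> Q" "2 * k * L * card D \<le> Q" and indep: "independent b k"
    and x: "x \<in> carrier G" "bd T (inv x \<otimes> mpow b c k \<otimes> x)" and j: "j < k"
  shows "nat \<bar>c j\<bar> \<le> 2 * Q ^ k * card D * T"
proof (cases "c j = 0")
  case False
  obtain i where i: "i < k" "c i \<noteq> 0" "\<And>j. j < k \<Longrightarrow> \<bar>c j\<bar> \<le> \<bar>c i\<bar>"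
    by (rule nonzero_max_index[where c = c, OF j False]) (rule that)
  obtain q p where p: "q \<le> Q ^ k" "p i \<noteq> 0" "\<And>i. i < k \<Longrightarrow> \<bar>p i\<bar> \<le> int (Q ^ k)"
    "mpow b p k = \<one> \<or> (\<forall>s r. 0 < s \<longrightarrow> bd r (mpow b c k [^] int (q * card D * s)) \<longrightarrow>
      nat \<bar>c i\<bar> * s < 2 * r)"
    by (rule approximate_relation[where c = c, OF comm L i Q]) (assumption | rule that)+
  have "mpow b p k \<noteq> \<one>" using indep p(2) i(1) unfolding independent_def by blast
  then have grow: "\<And>s r. 0 < s \<Longrightarrow> bd r (mpow b c k [^] int (q * card D * s)) \<Longrightarrow>
      nat \<bar>c i\<bar> * s < 2 * r" using p(4) by blast
  obtain E where E: "bd E x" using bd_exists x(1) by blast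
  define h where "h = inv x \<otimes> mpow b c k \<otimes> x"
  have hc: "h \<in> carrier G" using x(1) comm unfolding h_def by simp
  have hpow: "mpow b c k [^] n = x \<otimes> h [^] n \<otimes> inv x" for n :: nat
  proof (induction n)
    case (Suc n)
    have "mpow b c k = x \<otimes> h \<otimes> inv x" using x(1) comm unfolding h_def by (simp add: m_assoc)
    then have "mpow b c k [^] Suc n = (x \<otimes> h [^] n \<otimes> inv x) \<otimes> (x \<otimes> h \<otimes> inv x)" using Suc by simp
    then show ?case using x(1) hc by (simp add: m_assoc)
  qed (use x in simp)
  have "bd (T * n) (h [^] n)" for n :: nat
    using bd_pow_int[of T h "int n"] x(2) unfolding h_def by (simp add: int_pow_int)
  then have "bd (E + T * n + E) (mpow b c k [^] n)" for n :: nat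
    unfolding hpow using bd_mult bd_inv E by blast
  then have "nat \<bar>c i\<bar> * s < 2 * (E + T * (q * card D * s) + E)" if "0 < s" for s
    using grow[OF that] by (simp only: int_pow_int)
  \<comment> \<open>With \<open>s = 4 E + 1\<close> the constant contribution \<open>4 E\<close> of
    the conjugator is less than one multiple of \<open>s\<close>.\<close>
  from this[of "4 * E + 1"]
  have "nat \<bar>c i\<bar> * (4 * E + 1) < 2 * (E + T * (q * card D * (4 * E + 1)) + E)" by simp
  then have *: "nat \<bar>c i\<bar> * (4 * E + 1) < 4 * E + (2 * q * card D * T) * (4 * E + 1)"
    by (simp add: algebra_simps)
  have "nat \<bar>c i\<bar> \<le> 2 * q * card D * T"
  proof (rule ccontr)
    assume "\<not> ?thesis"
    then have "(2 * q * card D * T + 1) * (4 * E + 1) \<le> nat \<bar>c i\<bar> * (4 * E + 1)"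
      by (intro mult_right_mono) auto
    then show False using * by (simp add: algebra_simps)
  qed
  also have "\<dots> \<le> 2 * Q ^ k * card D * T" using p(1) by (intro mult_right_mono) auto
  finally show ?thesis using i(3)[OF j] by linarith
qed simp

section \<open>Bases\<close>

lemma mpow_substitute:
  assumes "commuting_fam b k"
  shows "commuting_fam b' l \<Longrightarrow> (\<And>i. i < l \<Longrightarrow> b' i = mpow b (A i) k) \<Longrightarrow>
    mpow b' c l = mpow b (\<lambda>m. \<Sum>i<l. c i * A i m) k"
proof (induction l)
  case 0
  then show ?case using mpow_zero[OF assms, of "\<lambda>_. 0"] by (simp add: mpow_0)
next
  case (Suc l)
  have "mpow b' c (Suc l) = mpow b (\<lambda>m. \<Sum>i<l. c i * A i m) k \<otimes> mpow b (A l) k [^] c l"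
    using Suc commuting_Suc[of b' l] by (simp add: mpow_Suc)
  also have "\<dots> = mpow b (\<lambda>m. (\<Sum>i<l. c i * A i m) + c l * A l m) k"
    using mpow_add[OF assms, of "\<lambda>m. \<Sum>i<l. c i * A i m" "\<lambda>m. c l * A l m"]
      mpow_scale[OF assms, of "c l" "A l"] by (simp only:)
  finally show ?case by simp
qed

text \<open>Nielsen moves along a relation among a shortest generating family shorten the relation,
  as in Euclid's algorithm, until it has a single nonzero coefficient.\<close>

lemma minimal_family_independent:
  assumes minimal: "\<And>b' k'. k' < k \<Longrightarrow> commuting_fam b' k' \<Longrightarrow> gspan b' k' \<noteq> H"
  shows "commuting_fam b k \<Longrightarrow> gspan b k = H \<Longrightarrow> mpow b c k = \<one> \<Longrightarrow> i < k \<Longrightarrow> c i = 0"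
proof (induction "\<Sum>i<k. nat \<bar>c i\<bar>" arbitrary: b c i rule: less_induct)
  case less
  note comm = less.prems(1)
  note closed = commuting_closed[OF comm]
  show ?case
  proof (rule ccontr)
    assume ci: "c i \<noteq> 0"
    show False
    proof (cases "\<exists>j<k. j \<noteq> i \<and> c j \<noteq> 0")
      case False
      then have "mpow b c k = mpow b (\<lambda>l. if l = i then c i else 0) k"
        by (intro mpow_cong) auto
      then have "b i [^] c i = \<one>" using mpow_unit[OF comm less.prems(4)] less.prems(3) by simp
      then have bi: "b i = \<one>" using torsion_free[OF closed[OF less.prems(4)]] ci by blast
      \<comment> \<open>The trivial generator is dropped and the last one takes its place; if
        \<open>i = k - 1\<close>, the index is simply outside the shorter family.\<close>
      define b' where "b' = b(i := b (k - 1))"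
      have k: "k - 1 < k" using less.prems(4) by simp
      have comm': "commuting_fam b' (k - 1)"
        using comm unfolding commuting_fam_def b'_def by auto
      have sub: "b ` {..<k} \<subseteq> insert \<one> (b' ` {..<k - 1})"
      proof (rule image_subsetI)
        fix l assume l: "l \<in> {..<k}"
        consider "l = i" | "l \<noteq> i" "l = k - 1" | "l \<noteq> i" "l < k - 1" using l by force
        then show "b l \<in> insert \<one> (b' ` {..<k - 1})"
        proof cases
          case 2
          then have "i < k - 1" "b l = b' i" using less.prems(4) unfolding b'_def by auto
          then show ?thesis by blast
        next
          case 3
          then have "b l = b' l" "l \<in> {..<k - 1}" unfolding b'_def by auto
          then show ?thesis by blast
        qed (use bi in simp)
      qed
      have "insert \<one> (b' ` {..<k - 1}) \<subseteq> gspan b' (k - 1)"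
        by (auto intro: generate.one generate.incl)
      then have 1: "gspan b k \<subseteq> gspan b' (k - 1)"
        by (rule generate_subgroup_incl[OF order_trans[OF sub] gspan_subgroup[OF comm']])
      have 2: "gspan b' (k - 1) \<subseteq> gspan b k"
        by (rule mono_generate) (use less.prems(4) in \<open>auto simp: b'_def\<close>)
      show False using minimal[OF k comm'] less.prems(2) subset_antisym[OF 1 2] by simp
    next
      case True
      then obtain i' j where ij: "i' < k" "j < k" "i' \<noteq> j" "c i' \<noteq> 0" "c j \<noteq> 0" "\<bar>c j\<bar> \<le> \<bar>c i'\<bar>"
        using ci less.prems(4) by (metis linear)
      \<comment> \<open>The sign is chosen such that
        \<open>|c i' - \<epsilon> c j| = |c i'| - |c j|\<close>.\<close>
      define \<epsilon> where "\<epsilon> = sgn (c i') * sgn (c j)"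
      define b' where "b' = b(j := b j \<otimes> b i' [^] \<epsilon>)"
      define c' where "c' = c(i' := c i' - \<epsilon> * c j)"
      \<comment> \<open>The elementary matrix that expresses \<open>b'\<close> in terms of
        \<open>b\<close>; the new factor in \<open>b' j\<close> is compensated by the change of the
        coefficient at \<open>i'\<close>.\<close>
      define A where "A l m = (if l = m then 1 else 0) + (if l = j \<and> m = i' then \<epsilon> else 0)" for l m
      have bspan: "b l \<in> gspan b k" if "l < k" for l
        using that by (auto intro: generate.incl)
      have b'A: "b' l = mpow b (A l) k" if l: "l < k" for l
      proof -
        have unit: "mpow b (\<lambda>m. if l = m then 1 else 0) k = b l" if "l < k" for l
        proof -
          have "mpow b (\<lambda>m. if l = m then 1 else 0) k = mpow b (\<lambda>m. if m = l then 1 else 0) k"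
            by (rule mpow_cong) auto
          then show ?thesis using mpow_unit[OF comm that, of 1] closed[OF that] by simp
        qed
        show ?thesis
        proof (cases "l = j")
          case True
          have "mpow b (A l) k = mpow b (\<lambda>m. if j = m then 1 else 0) k \<otimes>
              mpow b (\<lambda>m. if m = i' then \<epsilon> else 0) k"
            unfolding A_def True by (subst mpow_add[OF comm, symmetric]) simp
          also have "\<dots> = b' l"
            using unit[OF ij(2)] mpow_unit[OF comm ij(1)] True unfolding b'_def by simp
          finally show ?thesis by simp
        next
          case False
          then show ?thesis using unit[OF l] unfolding A_def b'_def by simp
        qed
      qed
      have b'span: "b' l \<in> gspan b k" if "l < k" for l
        using b'A[OF that] mpow_in_gspan[OF comm] by simp
      have comm': "commuting_fam b' k"
        using b'span gspan_closed[OF comm] gspan_commute[OF comm] unfolding commuting_fam_def by blast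
      have "gspan b' k = gspan b k"
      proof
        show "gspan b' k \<subseteq> gspan b k"
          by (rule generate_subgroup_incl[OF _ gspan_subgroup[OF comm]]) (use b'span in blast)
        have b'g: "b' l \<in> gspan b' k" if "l < k" for l
          using that by (auto intro: generate.incl)
        have "b l \<in> gspan b' k" if l: "l < k" for l
        proof (cases "l = j")
          case True
          have "b' i' [^] (- \<epsilon>) \<in> gspan b' k" using gspan_pow[OF comm' b'g[OF ij(1)]] .
          then have "b' j \<otimes> b' i' [^] (- \<epsilon>) \<in> gspan b' k" using b'g[OF ij(2)] by (rule generate.eng[rotated])
          moreover have "b' j \<otimes> b' i' [^] (- \<epsilon>) = b j"
            using closed ij unfolding b'_def by (simp add: m_assoc int_pow_neg)
          ultimately show ?thesis using True by simp
        next
          case False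
          then show ?thesis using b'g[OF l] unfolding b'_def by simp
        qed
        then show "gspan b k \<subseteq> gspan b' k"
          by (intro generate_subgroup_incl[OF _ gspan_subgroup[OF comm']]) blast
      qed
      then have span': "gspan b' k = H" using less.prems(2) by simp
      have "mpow b' c' k = mpow b (\<lambda>m. \<Sum>l<k. c' l * A l m) k"
        by (rule mpow_substitute[OF comm comm' b'A])
      also have "\<dots> = mpow b c k"
      proof (rule mpow_cong)
        fix m assume m: "m < k"
        have "(\<Sum>l<k. c' l * A l m) = (\<Sum>l<k. (if l = m then c' l else 0)) +
            (\<Sum>l<k. if l = j then (if m = i' then c' l * \<epsilon> else 0) else 0)"
          unfolding sum.distrib[symmetric] A_def by (intro sum.cong) (auto simp: distrib_left)
        also have "\<dots> = c' m + (if m = i' then c' j * \<epsilon> else 0)" using m ij(2) by simp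
        also have "\<dots> = c m" using ij(3) unfolding c'_def by auto
        finally show "b m = b m \<and> (\<Sum>l<k. c' l * A l m) = c m" by simp
      qed
      finally have rel: "mpow b' c' k = \<one>" using less.prems(3) by simp
      have eps: "\<epsilon> * c j = sgn (c i') * \<bar>c j\<bar>" unfolding \<epsilon>_def by (simp add: abs_sgn mult_ac)
      have "\<bar>c' i'\<bar> < \<bar>c i'\<bar>"
        using ij unfolding c'_def by (simp add: eps) (auto simp: sgn_if)
      then have "(\<Sum>l<k. nat \<bar>c' l\<bar>) < (\<Sum>l<k. nat \<bar>c l\<bar>)"
        using ij(1) by (intro sum_strict_mono_ex1) (auto simp: c'_def)
      \<comment> \<open>The coefficient at \<open>j\<close> was not changed, so the induction
        hypothesis for the shorter relation contradicts \<open>c j \<noteq> 0\<close>.\<close>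
      then have "c' j = 0" using less.hyps comm' span' rel ij(2) by blast
      then show False using ij(3,5) unfolding c'_def by simp
    qed
  qed
qed

lemma basis_exists:
  assumes hs: "set hs \<subseteq> carrier G" "\<And>x y. x \<in> set hs \<Longrightarrow> y \<in> set hs \<Longrightarrow> x \<otimes> y = y \<otimes> x"
  shows "\<exists>bs. set bs \<subseteq> generate G (set hs) \<and> generate G (set bs) = generate G (set hs) \<and>
    independent ((!) bs) (length bs)"
proof -
  define H where "H = generate G (set hs)"
  define Q where "Q k \<longleftrightarrow> (\<exists>b. commuting_fam b k \<and> gspan b k = H)" for k
  have "commuting_fam ((!) hs) (length hs)"
    unfolding commuting_fam_def using hs by (auto simp: nth_mem subset_iff)
  moreover have "(!) hs ` {..<length hs} = set hs" by (auto simp: set_conv_nth)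
  ultimately have "Q (length hs)" unfolding Q_def H_def by metis
  then have "Q (LEAST k. Q k)" by (rule LeastI)
  define k where "k = (LEAST k. Q k)"
  obtain b where b: "commuting_fam b k" "gspan b k = H"
    using \<open>Q (LEAST k. Q k)\<close> unfolding Q_def k_def by blast
  have minimal: "gspan b' k' \<noteq> H" if "k' < k" "commuting_fam b' k'" for b' k'
    using that not_less_Least[of k' Q] unfolding k_def Q_def by blast
  have "c i = 0" if "mpow b c k = \<one>" "i < k" for c i
    using minimal_family_independent[OF minimal b that] by blast
  moreover have "mpow ((!) (map b [0..<k])) c k = mpow b c k" for c
    by (rule mpow_cong) simp
  ultimately have "independent ((!) (map b [0..<k])) (length (map b [0..<k]))"
    unfolding independent_def by simp
  moreover have "set (map b [0..<k]) = b ` {..<k}" by (auto simp: atLeast0LessThan)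
  moreover have "b ` {..<k} \<subseteq> H" unfolding b(2)[symmetric] by (auto intro: generate.incl)
  ultimately show ?thesis using b(2) unfolding H_def by metis
qed

section \<open>Conjugators of bounded length\<close>

definition conj_list :: "'a \<Rightarrow> 'a list \<Rightarrow> 'a list" where
  "conj_list x as = map (\<lambda>a. inv x \<otimes> a \<otimes> x) as"

definition box :: "nat \<Rightarrow> nat \<Rightarrow> 'a list set" where
  "box R r = {as. set as \<subseteq> {a. bd R a} \<and> length as = r}"

text \<open>A graph on tuples of short elements. Steps by \<open>inv \<delta>\<close> are included
  because a conjugator is positive only up to a power of \<open>\<delta>\<close>.\<close>

definition conj_step :: "nat \<Rightarrow> nat \<Rightarrow> ('a list \<times> 'a list) set" where
  "conj_step R r = {(as, cs). as \<in> box R r \<and> cs \<in> box R r \<and>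
     (\<exists>s \<in> insert (inv \<delta>) D. cs = conj_list s as)}"

lemma box_closed: "as \<in> box R r \<Longrightarrow> set as \<subseteq> carrier G"
  unfolding box_def using bd_closed by blast

lemma conj_list_mult:
  "set as \<subseteq> carrier G \<Longrightarrow> x \<in> carrier G \<Longrightarrow> y \<in> carrier G \<Longrightarrow>
    conj_list (x \<otimes> y) as = conj_list y (conj_list x as)"
  unfolding conj_list_def by (auto simp: inv_mult_group m_assoc)

lemma conj_list_one: "set as \<subseteq> carrier G \<Longrightarrow> conj_list \<one> as = as"
  unfolding conj_list_def by (induction as) auto

text \<open>That the conjugate of \<open>e\<close> by \<open>x\<close> is bounded from below means
  \<open>x \<preceq> e x \<delta>^R\<close>, and that \<open>e\<close> itself is means
  \<open>\<delta> \<preceq> e \<delta> \<delta>^R\<close>. The map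
  \<open>z \<mapsto> e z \<delta>^R\<close> preserves meets, so the inequality passes to
  \<open>s\<close>. Taking \<open>e\<close> to be \<open>a\<close> and \<open>inv a\<close> gives
  both bounds.\<close>

lemma conj_meet_bounded:
  assumes a: "bd R a" and x: "x \<in> P" and ax: "bd R (inv x \<otimes> a \<otimes> x)" and s: "glb {x, \<delta>} s"
  shows "bd R (inv s \<otimes> a \<otimes> s)"
proof -
  have sc: "s \<in> carrier G" "s \<preceq> x" "s \<preceq> \<delta>" using s unfolding glb_def by auto
  have *: "inv s \<otimes> e \<otimes> s \<otimes> \<delta> [^] R \<in> P"
    if e: "e \<in> carrier G" "e \<otimes> \<delta> [^] R \<in> P" "inv x \<otimes> e \<otimes> x \<otimes> \<delta> [^] R \<in> P" for e
  proof -
    have "x \<preceq> e \<otimes> x \<otimes> \<delta> [^] R" using e x unfolding le_def by (simp add: m_assoc)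
    then have 1: "s \<preceq> e \<otimes> x \<otimes> \<delta> [^] R" using le_trans[OF sc(2)] sc(1) e x by simp
    have "\<one> \<otimes> \<one> \<otimes> \<delta> [^] (1::nat) \<preceq> \<one> \<otimes> (e \<otimes> \<delta> [^] R) \<otimes> \<delta> [^] (1::nat)"
      using e one_le by (subst le_shift) auto
    then have "\<delta> \<preceq> e \<otimes> \<delta> \<otimes> \<delta> [^] R"
      using e(1) nat_pow_Suc2[OF delta_closed, of R] by (simp add: m_assoc)
    then have 2: "s \<preceq> e \<otimes> \<delta> \<otimes> \<delta> [^] R" using le_trans[OF sc(3)] sc(1) e by simp
    have "glb ((\<lambda>z. e \<otimes> z \<otimes> \<delta> [^] R) ` {x, \<delta>}) (e \<otimes> s \<otimes> \<delta> [^] R)"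
      by (rule glb_shift[OF s]) (use x e in auto)
    then have "s \<preceq> e \<otimes> s \<otimes> \<delta> [^] R" using 1 2 sc(1) unfolding glb_def by auto
    then show ?thesis using e sc(1) unfolding le_def by (simp add: m_assoc)
  qed
  show ?thesis
    using a ax sc(1) x *[of a] *[of "inv a"] unfolding bd_def by (simp add: inv_mult_group m_assoc)
qed

text \<open>The simple factor \<open>s\<close> cut off from \<open>x\<close> depends on the
  conjugator alone, so \<open>conj_meet_bounded\<close> keeps all entries of the tuple short at the
  same time.\<close>

lemma conj_path_positive:
  assumes "as \<in> box R r" "x \<in> P" "x \<preceq> \<delta> [^] (q::nat)" "conj_list x as \<in> box R r"
  shows "(as, conj_list x as) \<in> (conj_step R r)\<^sup>*"
  using assms
proof (induction q arbitrary: as x)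
  case 0
  then have "x = \<one>" using le_antisym[of x \<one>] one_le[of x] by simp
  then show ?case using conj_list_one[OF box_closed[OF 0(1)]] by simp
next
  case (Suc q)
  note x = \<open>x \<in> P\<close>
  have xc: "x \<in> carrier G" using x by simp
  obtain s where s: "glb {x, \<delta>} s" using glb_exists[of "{x, \<delta>}"] x by auto
  note rem = meet_remainder[OF x Suc.prems(3) s]
  have sc: "s \<in> carrier G" using rem(1) by simp
  have asc: "set as \<subseteq> carrier G" using box_closed Suc.prems(1) .
  have "bd R (inv s \<otimes> a \<otimes> s)" if "a \<in> set as" for a
    using that Suc.prems(1,4) by (intro conj_meet_bounded[OF _ x _ s]) (auto simp: box_def conj_list_def)
  then have box': "conj_list s as \<in> box R r"
    using Suc.prems(1) unfolding box_def conj_list_def by auto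
  then have step: "(as, conj_list s as) \<in> conj_step R r"
    using Suc.prems(1) rem(1) unfolding conj_step_def by blast
  have eq: "conj_list (inv s \<otimes> x) (conj_list s as) = conj_list x as"
    using conj_list_mult[OF asc sc, of "inv s \<otimes> x"] sc xc by simp
  have "(conj_list s as, conj_list (inv s \<otimes> x) (conj_list s as)) \<in> (conj_step R r)\<^sup>*"
    using Suc.IH[OF box' rem(2,3)] eq Suc.prems(4) by simp
  then show ?case using step unfolding eq by (rule converse_rtrancl_into_rtrancl[rotated])
qed

lemma conj_path:
  assumes as: "as \<in> box R r" and x: "x \<in> carrier G" "conj_list x as \<in> box R r"
  shows "(as, conj_list x as) \<in> (conj_step R r)\<^sup>*"
proof -
  obtain k where k: "x \<otimes> \<delta> [^] (k::nat) \<in> P" using cofinal[OF x(1)] by blast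
  \<comment> \<open>Now \<open>x = \<delta>^-k y\<close> with \<open>y\<close> positive: the path
    consists of \<open>k\<close> steps by \<open>inv \<delta>\<close> followed by a positive
    path.\<close>
  define y where "y = \<delta> [^] k \<otimes> x"
  have yc: "y \<in> carrier G" using x(1) unfolding y_def by simp
  have "inv (\<delta> [^] k) \<otimes> y \<otimes> \<delta> [^] k \<in> P" using k x(1) unfolding y_def by simp
  then have y: "y \<in> P" using delta_pow_normal[OF yc] by simp
  have path: "conj_list (inv (\<delta> [^] n)) as \<in> box R r \<and>
      (as, conj_list (inv (\<delta> [^] n)) as) \<in> (conj_step R r)\<^sup>*" for n :: nat
  proof (induction n)
    case 0
    then show ?case using as conj_list_one[OF box_closed[OF as]] by simp
  next
    case (Suc n)
    have "inv (\<delta> [^] Suc n) = inv (\<delta> [^] n) \<otimes> inv \<delta>"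
      using nat_pow_Suc2[OF delta_closed, of n] by (simp add: inv_mult_group)
    then have eq: "conj_list (inv (\<delta> [^] Suc n)) as =
        conj_list (inv \<delta>) (conj_list (inv (\<delta> [^] n)) as)"
      using conj_list_mult[OF box_closed[OF as]] by simp
    have "conj_list (inv \<delta>) (conj_list (inv (\<delta> [^] n)) as) \<in> box R r"
      using Suc bd_delta_conj unfolding box_def conj_list_def[of "inv \<delta>"] by auto
    then show ?case unfolding eq using Suc
      by (auto simp: conj_step_def intro: rtrancl_into_rtrancl)
  qed
  obtain l where "bd l y" using bd_exists[OF yc] by blast
  then have yl: "y \<preceq> \<delta> [^] l" unfolding bd_def le_def by simp
  have "x = inv (\<delta> [^] k) \<otimes> y" using x(1) unfolding y_def by simp
  then have eq: "conj_list x as = conj_list y (conj_list (inv (\<delta> [^] k)) as)"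
    using conj_list_mult[OF box_closed[OF as], of "inv (\<delta> [^] k)" y] yc by simp
  have "(conj_list (inv (\<delta> [^] k)) as, conj_list x as) \<in> (conj_step R r)\<^sup>*"
    using conj_path_positive[OF _ y yl] path[of k] x(2) unfolding eq by blast
  then show ?thesis using path[of k] by (meson rtrancl_trans)
qed

lemma finite_box: "finite (box R r)"
  unfolding box_def by (rule finite_lists_length_eq[OF finite_bd])

lemma card_box: "card (box R r) \<le> (card D ^ (2 * R)) ^ r"
  unfolding box_def card_lists_length_eq[OF finite_bd] using card_bd by (intro power_mono) auto

lemma conj_step_subset: "conj_step R r \<subseteq> box R r \<times> box R r"
  unfolding conj_step_def by auto

lemma finite_conj_step: "finite (conj_step R r)"
  using finite_subset[OF conj_step_subset] finite_box by blast

lemma card_conj_step: "card (conj_step R r) \<le> ((card D ^ (2 * R)) ^ r) ^ 2"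
proof -
  have "card (conj_step R r) \<le> card (box R r \<times> box R r)"
    by (rule card_mono[OF _ conj_step_subset]) (simp add: finite_box)
  also have "\<dots> \<le> ((card D ^ (2 * R)) ^ r) ^ 2"
    unfolding card_cartesian_product power2_eq_square by (intro mult_mono card_box) auto
  finally show ?thesis .
qed

lemma conj_relpow:
  "as \<in> box R r \<Longrightarrow> (as, cs) \<in> conj_step R r ^^ n \<Longrightarrow>
    \<exists>ss. set ss \<subseteq> insert (inv \<delta>) D \<and> length ss = n \<and> cs = conj_list (word_prod G ss) as"
proof (induction n arbitrary: as)
  case 0
  then show ?case using conj_list_one[OF box_closed[OF 0(1)]] by (intro exI[of _ "[]"]) auto
next
  case (Suc n)
  then obtain ds where ds: "(as, ds) \<in> conj_step R r" "(ds, cs) \<in> conj_step R r ^^ n"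
    by (meson relpow_Suc_D2)
  obtain s where s: "s \<in> insert (inv \<delta>) D" "ds = conj_list s as" "as \<in> box R r" "ds \<in> box R r"
    using ds(1) unfolding conj_step_def by blast
  obtain ss where ss: "set ss \<subseteq> insert (inv \<delta>) D" "length ss = n" "cs = conj_list (word_prod G ss) ds"
    using Suc.IH[OF s(4) ds(2)] by blast
  have "s \<in> carrier G" "word_prod G ss \<in> carrier G"
    using s(1) ss(1) by (auto intro!: word_prod_closed)
  then have "cs = conj_list (word_prod G (s # ss)) as"
    using conj_list_mult[OF box_closed[OF s(3)]] ss(3) s(2) by simp
  then show ?case using s(1) ss(1,2) by (intro exI[of _ "s # ss"]) auto
qed

text \<open>A path need not be longer than the number of edges. The product along it may differ from
  \<open>x\<close>, but it conjugates the tuple to the same result.\<close>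

lemma short_conjugator:
  assumes as: "as \<in> box R r" and x: "x \<in> carrier G" "conj_list x as \<in> box R r"
  obtains ss where "set ss \<subseteq> insert (inv \<delta>) D" "length ss \<le> ((card D ^ (2 * R)) ^ r) ^ 2"
    "conj_list (word_prod G ss) as = conj_list x as"
proof -
  obtain n where n: "n \<le> card (conj_step R r)" "(as, conj_list x as) \<in> conj_step R r ^^ n"
    using conj_path[OF as x] unfolding rtrancl_finite_eq_relpow[OF finite_conj_step] by blast
  then show ?thesis using conj_relpow[OF as n(2)] card_conj_step[of R r] that by (metis order_trans)
qed

end

section \<open>The cone of a Garside monoid\<close>

context garside_monoid
begin

lemma le_L_antisym: "a \<in> carrier M \<Longrightarrow> b \<in> carrier M \<Longrightarrow> le_L M a b \<Longrightarrow> le_L M b a \<Longrightarrow> a = b"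
proof -
  interpret L: Lattice.lattice "\<lparr>carrier = carrier M, eq = (=), le = le_L M\<rparr>" by (rule lattice_L)
  show "a \<in> carrier M \<Longrightarrow> b \<in> carrier M \<Longrightarrow> le_L M a b \<Longrightarrow> le_L M b a \<Longrightarrow> a = b"
    using L.le_antisym[of a b] by simp
qed

lemma meet_L:
  assumes "a \<in> carrier M" "b \<in> carrier M"
  obtains m where "m \<in> carrier M" "le_L M m a" "le_L M m b"
    "\<And>z. z \<in> carrier M \<Longrightarrow> le_L M z a \<Longrightarrow> le_L M z b \<Longrightarrow> le_L M z m"
proof -
  interpret L: Lattice.lattice "\<lparr>carrier = carrier M, eq = (=), le = le_L M\<rparr>" by (rule lattice_L)
  obtain m where "greatest \<lparr>carrier = carrier M, eq = (=), le = le_L M\<rparr> m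
      (Lower \<lparr>carrier = carrier M, eq = (=), le = le_L M\<rparr> {a, b})"
    using L.inf_of_two_exists[of a b] assms by auto
  then show ?thesis using that assms unfolding greatest_def Lower_def by auto
qed

lemma le_L_trans:
  "a \<in> carrier M \<Longrightarrow> b \<in> carrier M \<Longrightarrow> c \<in> carrier M \<Longrightarrow> le_L M a b \<Longrightarrow> le_L M b c \<Longrightarrow> le_L M a c"
  unfolding le_L_def by (metis m_assoc m_closed)

lemma unit_trivial: "a \<in> carrier M \<Longrightarrow> b \<in> carrier M \<Longrightarrow> a \<otimes> b = \<one> \<Longrightarrow> a = \<one>"
  by (rule le_L_antisym) (auto simp: le_L_def)

lemma simple_closed: "d \<in> simples M \<Delta> \<Longrightarrow> d \<in> carrier M"
  unfolding simples_def by simp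

lemma simple_induct [consumes 1, case_names one mult]:
  assumes "a \<in> carrier M" "Q \<one>"
    and "\<And>d a. d \<in> simples M \<Delta> \<Longrightarrow> a \<in> carrier M \<Longrightarrow> Q a \<Longrightarrow> Q (d \<otimes> a)"
  shows "Q a"
proof -
  obtain xs where "set xs \<subseteq> simples M \<Delta>" "a = word_prod M xs"
    using simples_generate assms(1) unfolding monoid_generates_def by blast
  moreover have "set xs \<subseteq> simples M \<Delta> \<Longrightarrow> Q (word_prod M xs) \<and> word_prod M xs \<in> carrier M" for xs
    using assms(2,3) simple_closed by (induction xs) auto
  ultimately show ?thesis by blast
qed

lemma simple_complement_R:
  assumes "d \<in> simples M \<Delta>" obtains e where "e \<in> simples M \<Delta>" "d \<otimes> e = \<Delta>"
proof -
  obtain e where e: "e \<in> carrier M" "d \<otimes> e = \<Delta>"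
    using assms unfolding simples_def le_L_def by blast
  then have "le_R M e \<Delta>" using simple_closed[OF assms] unfolding le_R_def by blast
  then have "e \<in> simples M \<Delta>" using e(1) balanced unfolding simples_def by blast
  then show ?thesis using that e by blast
qed

lemma simple_complement_L:
  assumes "d \<in> simples M \<Delta>" obtains e where "e \<in> simples M \<Delta>" "e \<otimes> d = \<Delta>"
proof -
  have "le_R M d \<Delta>" using assms balanced simple_closed[OF assms] unfolding simples_def by blast
  then obtain e where e: "e \<in> carrier M" "e \<otimes> d = \<Delta>" unfolding le_R_def by blast
  then have "le_L M e \<Delta>" using simple_closed[OF assms] unfolding le_L_def by blast
  then have "e \<in> simples M \<Delta>" using e(1) unfolding simples_def by blast
  then show ?thesis using that e by blast
qed

text \<open>Complements in \<open>\<Delta>\<close> are taken twice: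
  \<open>d e = \<Delta> = e f\<close> gives \<open>d \<Delta> = d e f = \<Delta> f\<close>.\<close>

lemma simple_Delta_commute:
  assumes d: "d \<in> simples M \<Delta>"
  shows "\<exists>f \<in> simples M \<Delta>. d \<otimes> \<Delta> = \<Delta> \<otimes> f" "\<exists>f \<in> simples M \<Delta>. \<Delta> \<otimes> d = f \<otimes> \<Delta>"
proof -
  obtain e where e: "e \<in> simples M \<Delta>" "d \<otimes> e = \<Delta>" by (rule simple_complement_R[OF d])
  obtain f where f: "f \<in> simples M \<Delta>" "e \<otimes> f = \<Delta>" by (rule simple_complement_R[OF e(1)])
  have "d \<otimes> \<Delta> = d \<otimes> e \<otimes> f" using f e(1) d simple_closed by (simp add: m_assoc)
  then show "\<exists>f \<in> simples M \<Delta>. d \<otimes> \<Delta> = \<Delta> \<otimes> f" using e f by auto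
  obtain e where e: "e \<in> simples M \<Delta>" "e \<otimes> d = \<Delta>" by (rule simple_complement_L[OF d])
  obtain f where f: "f \<in> simples M \<Delta>" "f \<otimes> e = \<Delta>" by (rule simple_complement_L[OF e(1)])
  have "\<Delta> \<otimes> d = f \<otimes> (e \<otimes> d)" using f e(1) d simple_closed by (simp add: m_assoc[symmetric])
  then show "\<exists>f \<in> simples M \<Delta>. \<Delta> \<otimes> d = f \<otimes> \<Delta>" using e f by auto
qed

lemma Delta_commute:
  assumes "a \<in> carrier M"
  shows "(\<exists>b \<in> carrier M. a \<otimes> \<Delta> = \<Delta> \<otimes> b) \<and> (\<exists>b \<in> carrier M. \<Delta> \<otimes> a = b \<otimes> \<Delta>)"
  using assms
proof (induction rule: simple_induct)
  case one
  then show ?case using \<Delta>_closed by (auto intro!: bexI[of _ \<one>])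
next
  case (mult d a)
  have d: "d \<in> carrier M" using mult.hyps(1) simple_closed by blast
  obtain b b' where b: "b \<in> carrier M" "a \<otimes> \<Delta> = \<Delta> \<otimes> b" "b' \<in> carrier M" "\<Delta> \<otimes> a = b' \<otimes> \<Delta>"
    using mult.IH by blast
  obtain f f' where f: "f \<in> carrier M" "d \<otimes> \<Delta> = \<Delta> \<otimes> f" "f' \<in> carrier M" "\<Delta> \<otimes> d = f' \<otimes> \<Delta>"
    using simple_Delta_commute[OF mult.hyps(1)] simple_closed by blast
  have "d \<otimes> a \<otimes> \<Delta> = d \<otimes> \<Delta> \<otimes> b" using d mult.hyps(2) b \<Delta>_closed by (simp add: m_assoc)
  also have "\<dots> = \<Delta> \<otimes> (f \<otimes> b)" using f b(1) \<Delta>_closed by (simp add: m_assoc)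
  finally have 1: "d \<otimes> a \<otimes> \<Delta> = \<Delta> \<otimes> (f \<otimes> b)" .
  have "\<Delta> \<otimes> (d \<otimes> a) = f' \<otimes> (\<Delta> \<otimes> a)"
    using d mult.hyps(2) f(3) \<Delta>_closed by (simp add: m_assoc[symmetric] f(4))
  also have "\<dots> = f' \<otimes> b' \<otimes> \<Delta>" using f(3) b(3) \<Delta>_closed by (simp add: m_assoc b(4))
  finally show ?case using 1 f b by blast
qed

lemma Delta_pow_commute:
  assumes "a \<in> carrier M"
  shows "(\<exists>b \<in> carrier M. a \<otimes> \<Delta> [^] k = \<Delta> [^] k \<otimes> b) \<and>
    (\<exists>b \<in> carrier M. \<Delta> [^] (k::nat) \<otimes> a = b \<otimes> \<Delta> [^] k)"
proof (induction k)
  case 0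
  then show ?case using assms by auto
next
  case (Suc k)
  obtain b b' where b: "b \<in> carrier M" "a \<otimes> \<Delta> [^] k = \<Delta> [^] k \<otimes> b"
    "b' \<in> carrier M" "\<Delta> [^] k \<otimes> a = b' \<otimes> \<Delta> [^] k"
    using Suc by blast
  obtain c where c: "c \<in> carrier M" "b \<otimes> \<Delta> = \<Delta> \<otimes> c" using Delta_commute[OF b(1)] by blast
  obtain c' where c': "c' \<in> carrier M" "\<Delta> \<otimes> b' = c' \<otimes> \<Delta>" using Delta_commute[OF b(3)] by blast
  have "a \<otimes> \<Delta> [^] Suc k = a \<otimes> \<Delta> [^] k \<otimes> \<Delta>" using assms \<Delta>_closed by (simp add: m_assoc)
  also have "\<dots> = \<Delta> [^] k \<otimes> (b \<otimes> \<Delta>)" unfolding b(2) using b(1) \<Delta>_closed by (simp add: m_assoc)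
  also have "\<dots> = \<Delta> [^] Suc k \<otimes> c" unfolding c(2) using c(1) \<Delta>_closed by (simp add: m_assoc)
  finally have 1: "a \<otimes> \<Delta> [^] Suc k = \<Delta> [^] Suc k \<otimes> c" .
  have "\<Delta> [^] Suc k \<otimes> a = \<Delta> \<otimes> (\<Delta> [^] k \<otimes> a)"
    unfolding nat_pow_Suc2[OF \<Delta>_closed] using assms \<Delta>_closed by (simp add: m_assoc)
  also have "\<dots> = \<Delta> \<otimes> b' \<otimes> \<Delta> [^] k" unfolding b(4) using b(3) \<Delta>_closed by (simp add: m_assoc)
  also have "\<dots> = c' \<otimes> \<Delta> [^] Suc k"
    unfolding c'(2) nat_pow_Suc2[OF \<Delta>_closed] using c'(1) \<Delta>_closed by (simp add: m_assoc)
  finally show ?case using 1 c(1) c'(1) by blast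
qed

text \<open>For a product \<open>d a\<close> with \<open>a c = \<Delta>^k\<close>, the complement of
  \<open>d\<close> is moved to the right past \<open>\<Delta>^k\<close>.\<close>

lemma divides_Delta_pow: "a \<in> carrier M \<Longrightarrow> \<exists>c \<in> carrier M. \<exists>k::nat. a \<otimes> c = \<Delta> [^] k"
proof (induction rule: simple_induct)
  case one
  then show ?case by (metis l_one nat_pow_0 one_closed)
next
  case (mult d a)
  have d: "d \<in> carrier M" using mult.hyps(1) simple_closed by blast
  obtain c k where c: "c \<in> carrier M" "a \<otimes> c = \<Delta> [^] (k::nat)" using mult.IH by blast
  obtain e where e: "e \<in> carrier M" "d \<otimes> e = \<Delta>"
    using simple_complement_R[OF mult.hyps(1)] simple_closed by metis
  obtain f where f: "f \<in> carrier M" "e \<otimes> \<Delta> [^] k = \<Delta> [^] k \<otimes> f"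
    using Delta_pow_commute[OF e(1)] by blast
  have "d \<otimes> a \<otimes> (c \<otimes> f) = d \<otimes> (a \<otimes> c) \<otimes> f" using d mult.hyps(2) c(1) f(1) by (simp add: m_assoc)
  also have "\<dots> = d \<otimes> (e \<otimes> \<Delta> [^] k)" unfolding c(2) f(2) using d f(1) \<Delta>_closed by (simp add: m_assoc)
  also have "\<dots> = d \<otimes> e \<otimes> \<Delta> [^] k" using d e(1) \<Delta>_closed by (simp add: m_assoc)
  also have "\<dots> = \<Delta> [^] Suc k" unfolding nat_pow_Suc2[OF \<Delta>_closed] e(2) ..
  finally show ?case using c(1) f(1) by blast
qed

text \<open>The meet \<open>g\<close> of \<open>u a\<close> and \<open>u b\<close> is divisible by
  \<open>u\<close>, and cancelling \<open>u\<close> leaves a common divisor of \<open>a\<close> and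
  \<open>b\<close>. Meets thus survive the clearing of denominators.\<close>

lemma le_L_mult_meet:
  assumes "u \<in> carrier M" "a \<in> carrier M" "b \<in> carrier M" "m \<in> carrier M" "w \<in> carrier M"
    and m: "\<And>z. z \<in> carrier M \<Longrightarrow> le_L M z a \<Longrightarrow> le_L M z b \<Longrightarrow> le_L M z m"
    and w: "le_L M w (u \<otimes> a)" "le_L M w (u \<otimes> b)"
  shows "le_L M w (u \<otimes> m)"
proof -
  obtain g where g: "g \<in> carrier M" "le_L M g (u \<otimes> a)" "le_L M g (u \<otimes> b)"
    "\<And>z. z \<in> carrier M \<Longrightarrow> le_L M z (u \<otimes> a) \<Longrightarrow> le_L M z (u \<otimes> b) \<Longrightarrow> le_L M z g"
    by (rule meet_L[of "u \<otimes> a" "u \<otimes> b"]) (use assms in auto)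
  have "le_L M u g" using g(4)[of u] assms unfolding le_L_def by blast
  then obtain v where v: "v \<in> carrier M" "u \<otimes> v = g" unfolding le_L_def by blast
  have cancel: "le_L M v z" if z: "z \<in> carrier M" "le_L M g (u \<otimes> z)" for z
  proof -
    obtain t where t: "t \<in> carrier M" "u \<otimes> v \<otimes> t = u \<otimes> z"
      using z(2) v(2) unfolding le_L_def by blast
    then have "u \<otimes> (v \<otimes> t) = u \<otimes> z" using assms(1) v(1) by (simp add: m_assoc)
    then have "v \<otimes> t = z" using assms(1) v(1) t(1) z(1) l_cancel[of u "v \<otimes> t" z] by simp
    then show ?thesis using t(1) unfolding le_L_def by blast
  qed
  have "le_L M v m" using m v(1) cancel assms(2,3) g(2,3) by blast
  then obtain t where t: "t \<in> carrier M" "v \<otimes> t = m" unfolding le_L_def by blast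
  then have "g \<otimes> t = u \<otimes> m" using assms(1) v by (auto simp: m_assoc)
  then have "le_L M g (u \<otimes> m)" using t(1) unfolding le_L_def by blast
  moreover have "le_L M w g" using g(4) w assms(5) by blast
  ultimately show ?thesis using le_L_trans assms g(1) by (meson m_closed)
qed

end

context garside_group
begin

section \<open>Transfer of the order to the group of fractions\<close>

lemma iota_closed: "a \<in> carrier M \<Longrightarrow> \<iota> a \<in> carrier G"
  using embedding_hom unfolding hom_def by auto

lemma iota_mult: "a \<in> carrier M \<Longrightarrow> b \<in> carrier M \<Longrightarrow> \<iota> (a \<otimes> b) = \<iota> a \<otimes>\<^bsub>G\<^esub> \<iota> b"
  using embedding_hom unfolding hom_def by auto

lemma iota_one: "\<iota> \<one> = \<one>\<^bsub>G\<^esub>"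
  using iota_mult[of \<one> \<one>] iota_closed[of \<one>] G.r_cancel_one[of "\<iota> \<one>" "\<iota> \<one>"] by auto

lemma iota_pow: "a \<in> carrier M \<Longrightarrow> \<iota> (a [^] (k::nat)) = \<iota> a [^]\<^bsub>G\<^esub> k"
  by (induction k) (auto simp: iota_one iota_mult)

lemma iota_le:
  assumes "a \<in> carrier M" "b \<in> carrier M"
  shows "inv\<^bsub>G\<^esub> (\<iota> a) \<otimes>\<^bsub>G\<^esub> \<iota> b \<in> \<iota> ` carrier M \<longleftrightarrow> le_L M a b"
proof
  assume "inv\<^bsub>G\<^esub> (\<iota> a) \<otimes>\<^bsub>G\<^esub> \<iota> b \<in> \<iota> ` carrier M"
  then obtain c where c: "c \<in> carrier M" "inv\<^bsub>G\<^esub> (\<iota> a) \<otimes>\<^bsub>G\<^esub> \<iota> b = \<iota> c" by blast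
  have "\<iota> (a \<otimes> c) = \<iota> b"
    using assms c(1) iota_closed unfolding iota_mult[OF assms(1) c(1)] c(2)[symmetric]
    by (simp add: G.inv_mult_cancel)
  then have "a \<otimes> c = b" using embedding_inj assms c(1) by (auto dest: inj_onD)
  then show "le_L M a b" using c(1) unfolding le_L_def by blast
next
  assume "le_L M a b"
  then obtain c where c: "c \<in> carrier M" "b = a \<otimes> c" unfolding le_L_def by blast
  then show "inv\<^bsub>G\<^esub> (\<iota> a) \<otimes>\<^bsub>G\<^esub> \<iota> b \<in> \<iota> ` carrier M"
    using assms iota_closed by (simp add: iota_mult G.inv_mult_cancel)
qed

lemma positive_interval_simples:
  "{x \<in> \<iota> ` carrier M. inv\<^bsub>G\<^esub> x \<otimes>\<^bsub>G\<^esub> \<iota> \<Delta> \<in> \<iota> ` carrier M} = \<iota> ` simples M \<Delta>"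
  using iota_le \<Delta>_closed unfolding simples_def by auto

text \<open>For \<open>x = a^-1 b\<close> with \<open>a c = \<Delta>^k\<close> and
  \<open>b \<Delta>^k = \<Delta>^k b'\<close>, one has \<open>b \<Delta>^k = a c b'\<close>, and
  \<open>a\<close> cancels.\<close>

lemma fraction_cofinal:
  assumes "x \<in> carrier G" shows "\<exists>k::nat. x \<otimes>\<^bsub>G\<^esub> \<iota> \<Delta> [^]\<^bsub>G\<^esub> k \<in> \<iota> ` carrier M"
proof -
  obtain a b where ab: "a \<in> carrier M" "b \<in> carrier M" "x = inv\<^bsub>G\<^esub> (\<iota> a) \<otimes>\<^bsub>G\<^esub> \<iota> b"
    using fractions assms by blast
  obtain c k where c: "c \<in> carrier M" "a \<otimes> c = \<Delta> [^] (k::nat)" using divides_Delta_pow ab(1) by blast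
  obtain b' where b': "b' \<in> carrier M" "b \<otimes> \<Delta> [^] k = \<Delta> [^] k \<otimes> b'"
    using Delta_pow_commute ab(2) by blast
  have "le_L M a (b \<otimes> \<Delta> [^] k)"
    unfolding b'(2) le_L_def using ab(1) c b'(1) m_assoc[of a c b'] by (intro bexI[of _ "c \<otimes> b'"]) auto
  then have "inv\<^bsub>G\<^esub> (\<iota> a) \<otimes>\<^bsub>G\<^esub> \<iota> (b \<otimes> \<Delta> [^] k) \<in> \<iota> ` carrier M"
    using iota_le ab \<Delta>_closed by simp
  moreover have "inv\<^bsub>G\<^esub> (\<iota> a) \<otimes>\<^bsub>G\<^esub> \<iota> (b \<otimes> \<Delta> [^] k) = x \<otimes>\<^bsub>G\<^esub> \<iota> \<Delta> [^]\<^bsub>G\<^esub> k"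
    using ab \<Delta>_closed iota_closed by (simp add: iota_mult iota_pow G.m_assoc)
  ultimately show ?thesis by metis
qed

lemma fraction_cofinal_left:
  assumes "x \<in> carrier G" "y \<in> carrier G"
  obtains u where "u \<in> carrier M" "\<iota> u \<otimes>\<^bsub>G\<^esub> x \<in> \<iota> ` carrier M" "\<iota> u \<otimes>\<^bsub>G\<^esub> y \<in> \<iota> ` carrier M"
proof -
  \<comment> \<open>Every larger exponent works as well, so the exponents found for \<open>x\<close>
    and for \<open>y\<close> can be added.\<close>
  have pow: "\<exists>k::nat. \<forall>l::nat. \<iota> (\<Delta> [^] (k + l)) \<otimes>\<^bsub>G\<^esub> x \<in> \<iota> ` carrier M" if x: "x \<in> carrier G" for x
  proof -
    obtain k a where a: "a \<in> carrier M" "x \<otimes>\<^bsub>G\<^esub> \<iota> \<Delta> [^]\<^bsub>G\<^esub> (k::nat) = \<iota> a"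
      using fraction_cofinal[OF x] by blast
    have "\<iota> (\<Delta> [^] (k + l)) \<otimes>\<^bsub>G\<^esub> x \<in> \<iota> ` carrier M" for l
    proof -
      obtain b where b: "b \<in> carrier M" "\<Delta> [^] k \<otimes> a = b \<otimes> \<Delta> [^] k"
        using Delta_pow_commute a(1) by blast
      have "\<iota> (\<Delta> [^] k) \<otimes>\<^bsub>G\<^esub> x \<otimes>\<^bsub>G\<^esub> \<iota> (\<Delta> [^] k) = \<iota> b \<otimes>\<^bsub>G\<^esub> \<iota> (\<Delta> [^] k)"
        using a b x \<Delta>_closed iota_closed iota_mult[of "\<Delta> [^] k" a] iota_mult[of b "\<Delta> [^] k"]
        by (simp add: G.m_assoc iota_pow)
      then have "\<iota> (\<Delta> [^] k) \<otimes>\<^bsub>G\<^esub> x = \<iota> b"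
        using x b(1) \<Delta>_closed iota_closed by (metis G.m_closed G.r_cancel nat_pow_closed)
      then have "\<iota> (\<Delta> [^] l) \<otimes>\<^bsub>G\<^esub> (\<iota> (\<Delta> [^] k) \<otimes>\<^bsub>G\<^esub> x) = \<iota> (\<Delta> [^] l \<otimes> b)"
        using b(1) \<Delta>_closed by (simp add: iota_mult)
      moreover have "\<iota> (\<Delta> [^] (k + l)) = \<iota> (\<Delta> [^] l) \<otimes>\<^bsub>G\<^esub> \<iota> (\<Delta> [^] k)"
        using \<Delta>_closed by (simp add: iota_mult[symmetric] nat_pow_mult add.commute)
      ultimately show ?thesis
        using x b(1) \<Delta>_closed iota_closed by (simp add: G.m_assoc)
    qed
    then show ?thesis by blast
  qed
  obtain k :: nat where k: "\<And>n. \<iota> (\<Delta> [^] (k + n)) \<otimes>\<^bsub>G\<^esub> x \<in> \<iota> ` carrier M"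
    using pow[OF assms(1)] by blast
  obtain l :: nat where l: "\<And>n. \<iota> (\<Delta> [^] (l + n)) \<otimes>\<^bsub>G\<^esub> y \<in> \<iota> ` carrier M"
    using pow[OF assms(2)] by blast
  from k[of l] l[of k] show ?thesis
    using that[of "\<Delta> [^] (k + l)"] \<Delta>_closed by (simp add: add.commute)
qed

lemma garside_cone: "garside_cone G (\<iota> ` carrier M) (\<iota> \<Delta>)"
proof (intro garside_cone.intro garside_cone_axioms.intro)
  show "group G" by (rule G.group_axioms)
  show "\<iota> ` carrier M \<subseteq> carrier G" using iota_closed by blast
  show "\<one>\<^bsub>G\<^esub> \<in> \<iota> ` carrier M" using iota_one by (metis image_eqI one_closed)
  show "x \<otimes>\<^bsub>G\<^esub> y \<in> \<iota> ` carrier M" if "x \<in> \<iota> ` carrier M" "y \<in> \<iota> ` carrier M" for x y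
    using that iota_mult by (metis (no_types, lifting) imageE image_eqI m_closed)
  show "x = \<one>\<^bsub>G\<^esub>" if x: "x \<in> \<iota> ` carrier M" "inv\<^bsub>G\<^esub> x \<in> \<iota> ` carrier M" for x
  proof -
    obtain a b where ab: "a \<in> carrier M" "x = \<iota> a" "b \<in> carrier M" "inv\<^bsub>G\<^esub> x = \<iota> b" using x by blast
    then have "\<iota> (a \<otimes> b) = \<iota> \<one>" using iota_closed iota_mult iota_one by (metis G.r_inv)
    then have "a \<otimes> b = \<one>" using embedding_inj ab(1,3) by (auto dest: inj_onD)
    then show ?thesis using unit_trivial ab iota_one by blast
  qed
  show "\<iota> \<Delta> \<in> \<iota> ` carrier M" using \<Delta>_closed by blast
  show "inv\<^bsub>G\<^esub> \<iota> \<Delta> \<otimes>\<^bsub>G\<^esub> x \<otimes>\<^bsub>G\<^esub> \<iota> \<Delta> \<in> \<iota> ` carrier M \<longleftrightarrow> x \<in> \<iota> ` carrier M" if x: "x \<in> carrier G" for x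
  proof
    assume "x \<in> \<iota> ` carrier M"
    then obtain a where a: "a \<in> carrier M" "x = \<iota> a" by blast
    obtain b where b: "b \<in> carrier M" "a \<otimes> \<Delta> = \<Delta> \<otimes> b" using Delta_commute a(1) by blast
    have "\<iota> a \<otimes>\<^bsub>G\<^esub> \<iota> \<Delta> = \<iota> \<Delta> \<otimes>\<^bsub>G\<^esub> \<iota> b" using a b \<Delta>_closed by (metis iota_mult)
    then have "inv\<^bsub>G\<^esub> \<iota> \<Delta> \<otimes>\<^bsub>G\<^esub> x \<otimes>\<^bsub>G\<^esub> \<iota> \<Delta> = \<iota> b"
      using a b(1) \<Delta>_closed iota_closed by (simp add: G.m_assoc G.inv_mult_cancel)
    then show "inv\<^bsub>G\<^esub> \<iota> \<Delta> \<otimes>\<^bsub>G\<^esub> x \<otimes>\<^bsub>G\<^esub> \<iota> \<Delta> \<in> \<iota> ` carrier M" using b(1) by blast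
  next
    assume "inv\<^bsub>G\<^esub> \<iota> \<Delta> \<otimes>\<^bsub>G\<^esub> x \<otimes>\<^bsub>G\<^esub> \<iota> \<Delta> \<in> \<iota> ` carrier M"
    then obtain b where b: "b \<in> carrier M" "inv\<^bsub>G\<^esub> \<iota> \<Delta> \<otimes>\<^bsub>G\<^esub> x \<otimes>\<^bsub>G\<^esub> \<iota> \<Delta> = \<iota> b" by blast
    obtain a where a: "a \<in> carrier M" "\<Delta> \<otimes> b = a \<otimes> \<Delta>" using Delta_commute b(1) by blast
    have "\<iota> \<Delta> \<otimes>\<^bsub>G\<^esub> \<iota> b = \<iota> a \<otimes>\<^bsub>G\<^esub> \<iota> \<Delta>" using a b(1) \<Delta>_closed by (metis iota_mult)
    moreover have "\<iota> \<Delta> \<otimes>\<^bsub>G\<^esub> \<iota> b = x \<otimes>\<^bsub>G\<^esub> \<iota> \<Delta>"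
      unfolding b(2)[symmetric] using x \<Delta>_closed iota_closed by (simp add: G.m_assoc G.inv_mult_cancel)
    ultimately have "x = \<iota> a" using x a(1) \<Delta>_closed iota_closed by simp
    then show "x \<in> \<iota> ` carrier M" using a(1) by blast
  qed
  show "\<exists>k::nat. x \<otimes>\<^bsub>G\<^esub> \<iota> \<Delta> [^]\<^bsub>G\<^esub> k \<in> \<iota> ` carrier M" if "x \<in> carrier G" for x
    using fraction_cofinal[OF that] .
  show "finite {x \<in> \<iota> ` carrier M. inv\<^bsub>G\<^esub> x \<otimes>\<^bsub>G\<^esub> \<iota> \<Delta> \<in> \<iota> ` carrier M}"
    unfolding positive_interval_simples using finite_simples by blast
  show "\<exists>m\<in>carrier G. inv\<^bsub>G\<^esub> m \<otimes>\<^bsub>G\<^esub> x \<in> \<iota> ` carrier M \<and> inv\<^bsub>G\<^esub> m \<otimes>\<^bsub>G\<^esub> y \<in> \<iota> ` carrier M \<and>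
      (\<forall>z\<in>carrier G. inv\<^bsub>G\<^esub> z \<otimes>\<^bsub>G\<^esub> x \<in> \<iota> ` carrier M \<longrightarrow> inv\<^bsub>G\<^esub> z \<otimes>\<^bsub>G\<^esub> y \<in> \<iota> ` carrier M \<longrightarrow>
        inv\<^bsub>G\<^esub> z \<otimes>\<^bsub>G\<^esub> m \<in> \<iota> ` carrier M)"
    if xy: "x \<in> carrier G" "y \<in> carrier G" for x y
  proof -
    obtain u where u: "u \<in> carrier M" "\<iota> u \<otimes>\<^bsub>G\<^esub> x \<in> \<iota> ` carrier M" "\<iota> u \<otimes>\<^bsub>G\<^esub> y \<in> \<iota> ` carrier M"
      by (rule fraction_cofinal_left[OF xy])
    obtain a b where ab: "a \<in> carrier M" "\<iota> u \<otimes>\<^bsub>G\<^esub> x = \<iota> a" "b \<in> carrier M" "\<iota> u \<otimes>\<^bsub>G\<^esub> y = \<iota> b"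
      using u(2,3) by blast
    obtain m where m: "m \<in> carrier M" "le_L M m a" "le_L M m b"
      "\<And>z. z \<in> carrier M \<Longrightarrow> le_L M z a \<Longrightarrow> le_L M z b \<Longrightarrow> le_L M z m"
      by (rule meet_L[OF ab(1,3)]) (rule that)
    have uc: "\<iota> u \<in> carrier G" "\<iota> m \<in> carrier G" using u(1) m(1) iota_closed by auto
    \<comment> \<open>The meet of the numerators divided by the common denominator.\<close>
    define n where "n = inv\<^bsub>G\<^esub> \<iota> u \<otimes>\<^bsub>G\<^esub> \<iota> m"
    have nc: "n \<in> carrier G" using uc unfolding n_def by simp
    have n_le: "inv\<^bsub>G\<^esub> n \<otimes>\<^bsub>G\<^esub> w = inv\<^bsub>G\<^esub> (\<iota> m) \<otimes>\<^bsub>G\<^esub> (\<iota> u \<otimes>\<^bsub>G\<^esub> w)" if "w \<in> carrier G" for w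
      using that uc unfolding n_def by (simp add: G.inv_mult_group G.m_assoc)
    have "inv\<^bsub>G\<^esub> z \<otimes>\<^bsub>G\<^esub> n \<in> \<iota> ` carrier M"
      if z: "z \<in> carrier G" "inv\<^bsub>G\<^esub> z \<otimes>\<^bsub>G\<^esub> x \<in> \<iota> ` carrier M" "inv\<^bsub>G\<^esub> z \<otimes>\<^bsub>G\<^esub> y \<in> \<iota> ` carrier M" for z
    proof -
      \<comment> \<open>A competitor \<open>z\<close> may need a further denominator
        \<open>v\<close>; by \<open>le_L_mult_meet\<close>, common left divisors of
        \<open>v a\<close> and \<open>v b\<close> still divide \<open>v m\<close>.\<close>
      obtain v where v: "v \<in> carrier M" "\<iota> v \<otimes>\<^bsub>G\<^esub> (\<iota> u \<otimes>\<^bsub>G\<^esub> z) \<in> \<iota> ` carrier M"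
        using fraction_cofinal_left[of "\<iota> u \<otimes>\<^bsub>G\<^esub> z" "\<iota> u \<otimes>\<^bsub>G\<^esub> z"] uc z(1) by auto
      obtain w where w: "w \<in> carrier M" "\<iota> v \<otimes>\<^bsub>G\<^esub> (\<iota> u \<otimes>\<^bsub>G\<^esub> z) = \<iota> w" using v(2) by blast
      have vc: "\<iota> v \<in> carrier G" "\<iota> w \<in> carrier G" using v(1) w(1) iota_closed by auto
      have *: "inv\<^bsub>G\<^esub> (\<iota> w) \<otimes>\<^bsub>G\<^esub> \<iota> (v \<otimes> c) = inv\<^bsub>G\<^esub> z \<otimes>\<^bsub>G\<^esub> (inv\<^bsub>G\<^esub> \<iota> u \<otimes>\<^bsub>G\<^esub> \<iota> c)"
        if "c \<in> carrier M" for c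
        unfolding w(2)[symmetric] iota_mult[OF v(1) that]
        using that iota_closed vc uc z(1) by (simp add: G.inv_mult_group G.m_assoc G.inv_mult_cancel)
      have "inv\<^bsub>G\<^esub> \<iota> u \<otimes>\<^bsub>G\<^esub> \<iota> a = x" "inv\<^bsub>G\<^esub> \<iota> u \<otimes>\<^bsub>G\<^esub> \<iota> b = y"
        unfolding ab(2,4)[symmetric] using xy uc by (simp_all add: G.inv_mult_cancel)
      then have "le_L M w (v \<otimes> a)" "le_L M w (v \<otimes> b)"
        using z(2,3) *[OF ab(1)] *[OF ab(3)] iota_le w(1) v(1) ab(1,3) by (metis m_closed)+
      then have "le_L M w (v \<otimes> m)"
        using le_L_mult_meet[OF v(1) ab(1,3) m(1) w(1) m(4)] by blast
      then have "inv\<^bsub>G\<^esub> (\<iota> w) \<otimes>\<^bsub>G\<^esub> \<iota> (v \<otimes> m) \<in> \<iota> ` carrier M"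
        using iota_le w(1) v(1) m(1) by simp
      then show ?thesis unfolding *[OF m(1)] n_def .
    qed
    moreover have "inv\<^bsub>G\<^esub> n \<otimes>\<^bsub>G\<^esub> x \<in> \<iota> ` carrier M" "inv\<^bsub>G\<^esub> n \<otimes>\<^bsub>G\<^esub> y \<in> \<iota> ` carrier M"
      using n_le xy ab iota_le m(1,2,3) by simp_all
    ultimately show ?thesis using nc by blast
  qed
qed

end

section \<open>The word problem\<close>

text \<open>Letters are numbers evaluated by \<open>lv\<close>. Each simple element and each inverse
  of one has a letter, possibly several, and nothing is assumed about \<open>lv\<close> outside
  \<open>A\<close>.\<close>

locale coded_letters = garside_cone G P \<delta> for G (structure) and P and \<delta> +
  fixes A :: "nat set" and lv :: "nat \<Rightarrow> 'a"
  assumes finite_A: "finite A"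
    and letters: "a \<in> A \<Longrightarrow> lv a \<in> D \<or> inv (lv a) \<in> D \<and> lv a \<in> carrier G"
    and pos_letter: "d \<in> D \<Longrightarrow> \<exists>a\<in>A. lv a = d"
    and neg_letter: "d \<in> D \<Longrightarrow> \<exists>a\<in>A. lv a = inv d"
begin

text \<open>A choice, hence nothing an algorithm can evaluate on group elements. It enters the
  algorithms only through finite tables and one constant.\<close>

definition code :: "'a \<Rightarrow> nat" where "code s = (SOME a. a \<in> A \<and> lv a = s)"

lemma code: "s \<in> D \<Longrightarrow> code s \<in> A" "s \<in> D \<Longrightarrow> lv (code s) = s"
  "inv s \<in> D \<Longrightarrow> s \<in> carrier G \<Longrightarrow> code s \<in> A" "inv s \<in> D \<Longrightarrow> s \<in> carrier G \<Longrightarrow> lv (code s) = s"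
proof -
  have *: "code s \<in> A \<and> lv (code s) = s" if "\<exists>a\<in>A. lv a = s"
    unfolding code_def using someI_ex[of "\<lambda>a. a \<in> A \<and> lv a = s"] that by blast
  show "s \<in> D \<Longrightarrow> code s \<in> A" "s \<in> D \<Longrightarrow> lv (code s) = s" using * pos_letter by blast+
  show "inv s \<in> D \<Longrightarrow> s \<in> carrier G \<Longrightarrow> code s \<in> A"
    "inv s \<in> D \<Longrightarrow> s \<in> carrier G \<Longrightarrow> lv (code s) = s" using * neg_letter[of "inv s"] by auto
qed

lemma lv_closed [simp]: "a \<in> A \<Longrightarrow> lv a \<in> carrier G"
  using letters[of a] D_closed by blast

definition wv :: "nat list \<Rightarrow> 'a" where "wv w = word_prod G (map lv w)"

lemma wv_Nil [simp]: "wv [] = \<one>" and wv_Cons [simp]: "wv (a # w) = lv a \<otimes> wv w"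
  unfolding wv_def by simp_all

lemma wv_closed [simp]: "set w \<subseteq> A \<Longrightarrow> wv w \<in> carrier G"
  by (induction w) auto

lemma wv_append: "set u \<subseteq> A \<Longrightarrow> set w \<subseteq> A \<Longrightarrow> wv (u @ w) = wv u \<otimes> wv w"
  by (induction u) (auto simp: m_assoc)

definition B :: "nat set" where "B = {a \<in> A. lv a \<in> D}"

lemma B_subset: "B \<subseteq> A"
  unfolding B_def by blast

lemma B_D: "b \<in> B \<Longrightarrow> lv b \<in> D"
  unfolding B_def by blast

lemma code_B: "s \<in> D \<Longrightarrow> code s \<in> B"
  unfolding B_def using code by simp

lemma wv_cone: "set u \<subseteq> B \<Longrightarrow> wv u \<in> P"
  by (induction u) (auto simp: one_cone mult_cone D_cone B_D)

text \<open>A letter is of the form \<open>s \<delta>\<^sup>-\<^sup>\<epsilon>\<close> with \<open>s\<close> simple and \<open>\<epsilon> \<in> {0, 1}\<close>; pushing the powers of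
  \<open>\<delta>\<close> to the right turns a word into \<open>u \<delta>\<^sup>-\<^sup>j\<close> with a positive word \<open>u\<close>.\<close>

definition delta_exponent :: "nat \<Rightarrow> nat" where "delta_exponent a = (if a \<in> A \<and> lv a \<notin> D then 1 else 0)"
definition simple_part :: "nat \<Rightarrow> nat" where "simple_part a = (if a \<in> A then code (lv a \<otimes> \<delta> [^] delta_exponent a) else 0)"
definition twist :: "nat \<Rightarrow> nat" where "twist a = (if a \<in> A then code (inv \<delta> \<otimes> lv a \<otimes> \<delta>) else 0)"

text \<open>The state pairs the code of \<open>u\<close> with the exponent \<open>j\<close>. A
  letter \<open>s \<delta>^-1\<close> in front of \<open>u \<delta>^-j\<close> gives
  \<open>s (\<delta>^-1 u \<delta>) \<delta>^-(j+1)\<close>, which is where \<open>twist\<close>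
  comes from.\<close>

definition fraction_step :: "nat \<Rightarrow> nat \<Rightarrow> nat" where
  "fraction_step a z = prod_encode (list_encode (simple_part a # (if delta_exponent a = 0 then list_decode (nfst z)
     else map twist (list_decode (nfst z)))), nsnd z + delta_exponent a)"

definition fraction :: "nat list \<Rightarrow> nat" where
  "fraction w = fold fraction_step (rev w) (prod_encode (list_encode [], 0))"

lemma wv_twist: "set u \<subseteq> B \<Longrightarrow> set (map twist u) \<subseteq> B \<and> wv (map twist u) = inv \<delta> \<otimes> wv u \<otimes> \<delta>"
proof (induction u)
  case (Cons a u)
  then have a: "a \<in> A" "lv a \<in> D" using B_D B_subset by auto
  have "twist a \<in> B" "lv (twist a) = inv \<delta> \<otimes> lv a \<otimes> \<delta>"
    using a code_B[OF D_conj] code(2)[OF D_conj] unfolding twist_def by auto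
  then show ?case using Cons a wv_cone[of u] by (simp add: m_assoc)
qed simp

lemma fraction:
  assumes "set w \<subseteq> A"
  shows "\<exists>u j. fraction w = prod_encode (list_encode u, j) \<and> set u \<subseteq> B \<and>
    wv w = wv u \<otimes> inv (\<delta> [^] (j::nat))"
  using assms
proof (induction w)
  case Nil
  show ?case unfolding fraction_def by (intro exI[of _ "[]"] exI[of _ 0]) auto
next
  case (Cons a w)
  then obtain u j where uj: "fraction w = prod_encode (list_encode u, j)" "set u \<subseteq> B"
    "wv w = wv u \<otimes> inv (\<delta> [^] (j::nat))" by auto
  have a: "a \<in> A" using Cons.prems by simp
  have step: "fraction (a # w) = fraction_step a (fraction w)" unfolding fraction_def by simp
  have uc: "wv u \<in> carrier G" using wv_cone[OF uj(2)] by simp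
  show ?case
  proof (cases "lv a \<in> D")
    case True
    then have "delta_exponent a = 0" "simple_part a = code (lv a)" using a unfolding simple_part_def delta_exponent_def by auto
    then show ?thesis
      using True uj uc step code_B[OF True] code(2)[OF True] B_subset a
      by (intro exI[of _ "simple_part a # u"] exI[of _ j]) (auto simp: fraction_step_def m_assoc)
  next
    case False
    then have "inv (lv a) \<in> D" using letters a by blast
    then have s: "lv a \<otimes> \<delta> \<in> D" using D_complement a by fastforce
    have n: "delta_exponent a = 1" "simple_part a = code (lv a \<otimes> \<delta>)" using False a unfolding simple_part_def delta_exponent_def by auto
    have tw: "set (map twist u) \<subseteq> B" "wv (map twist u) = inv \<delta> \<otimes> wv u \<otimes> \<delta>"
      using wv_twist[OF uj(2)] by auto
    have "wv (a # w) = lv a \<otimes> (wv u \<otimes> inv (\<delta> [^] j))" using uj by simp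
    also have "\<dots> = lv a \<otimes> \<delta> \<otimes> (inv \<delta> \<otimes> wv u \<otimes> \<delta>) \<otimes> inv (\<delta> [^] Suc j)"
      using a uc by (simp add: inv_mult_group m_assoc)
    also have "\<dots> = wv (simple_part a # map twist u) \<otimes> inv (\<delta> [^] Suc j)"
      using n code(2)[OF s] tw(2) by simp
    finally show ?thesis
      using n uj(1) step tw(1) code_B[OF s]
      by (intro exI[of _ "simple_part a # map twist u"] exI[of _ "Suc j"]) (auto simp: fraction_step_def)
  qed
qed

text \<open>One pass from right to left splits a positive word into its meet with \<open>\<delta>\<close> and a remainder.\<close>

definition meet_delta :: "'a \<Rightarrow> 'a" where "meet_delta v = (SOME s. glb {v, \<delta>} s)"
definition head2 :: "nat \<Rightarrow> nat \<Rightarrow> nat" where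
  "head2 a b = (if a \<in> B \<and> b \<in> B then code (meet_delta (lv a \<otimes> lv b)) else 0)"
definition tail2 :: "nat \<Rightarrow> nat \<Rightarrow> nat" where
  "tail2 a b = (if a \<in> B \<and> b \<in> B then code (inv (meet_delta (lv a \<otimes> lv b)) \<otimes> (lv a \<otimes> lv b)) else 0)"

definition split_delta :: "nat list \<Rightarrow> nat" where
  "split_delta u = fold (\<lambda>a z. prod_encode (head2 a (nfst z), list_encode (tail2 a (nfst z) # list_decode (nsnd z))))
     (rev u) (prod_encode (code \<one>, list_encode []))"

lemma meet_delta: "v \<in> carrier G \<Longrightarrow> glb {v, \<delta>} (meet_delta v)"
  unfolding meet_delta_def using glb_exists[of "{v, \<delta>}"] by (auto intro: someI)

text \<open>By \<open>glb_mult_delta\<close> the head of \<open>a u\<close> is the meet of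
  \<open>a h\<close> with \<open>\<delta>\<close>, where \<open>h\<close> is the head of
  \<open>u\<close>. As \<open>a h\<close> is a product of two simple elements, the new head and the
  quotient are both simple, so a table on pairs of letters suffices.\<close>

lemma split_delta:
  assumes "set u \<subseteq> B"
  shows "\<exists>h r. split_delta u = prod_encode (h, list_encode r) \<and> h \<in> B \<and> set r \<subseteq> B \<and>
    glb {wv u, \<delta>} (lv h) \<and> wv u = lv h \<otimes> wv r"
  using assms
proof (induction u)
  case Nil
  have "glb {\<one>, \<delta>} \<one>" unfolding glb_def using one_le delta_cone by auto
  then show ?case using one_D code code_B unfolding split_delta_def
    by (intro exI[of _ "code \<one>"] exI[of _ "[]"]) auto
next
  case (Cons a u)
  then obtain h r where hr: "split_delta u = prod_encode (h, list_encode r)" "h \<in> B" "set r \<subseteq> B"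
    "glb {wv u, \<delta>} (lv h)" "wv u = lv h \<otimes> wv r" by auto
  have a: "a \<in> B" using Cons.prems by simp
  define v where "v = lv a \<otimes> lv h"
  have D: "lv a \<in> D" "lv h \<in> D" using B_D a hr(2) by auto
  have v: "v \<in> P" unfolding v_def using D D_cone mult_cone by blast
  have m: "glb {v, \<delta>} (meet_delta v)" using meet_delta v by simp
  have le: "v \<preceq> \<delta> [^] Suc 1" unfolding v_def using D_mult_le D by blast
  note rem = meet_remainder[OF v le m]
  have tD: "inv (meet_delta v) \<otimes> v \<in> D" using rem(2,3) unfolding D_def by simp
  have split: "split_delta (a # u) = prod_encode (head2 a h, list_encode (tail2 a h # r))"
    using hr(1) unfolding split_delta_def by simp
  have h2: "head2 a h = code (meet_delta v)" "tail2 a h = code (inv (meet_delta v) \<otimes> v)"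
    using a hr(2) unfolding head2_def tail2_def v_def by auto
  have "glb {lv a \<otimes> wv u, \<delta>} (meet_delta v)"
    using glb_mult_delta[OF _ _ hr(4)] m D D_cone wv_cone Cons.prems unfolding v_def by simp
  moreover have "lv a \<otimes> wv u = meet_delta v \<otimes> (inv (meet_delta v) \<otimes> v \<otimes> wv r)"
    using hr(5) D v rem(1) wv_cone[OF hr(3)] unfolding v_def by (simp add: m_assoc)
  ultimately show ?case
    using split h2 code(2)[OF rem(1)] code(2)[OF tD] code_B[OF rem(1)] code_B[OF tD] hr(3)
    by (intro exI[of _ "head2 a h"] exI[of _ "tail2 a h # r"]) auto
qed

text \<open>The value 0 means failure and \<open>Suc c\<close> means the list with code
  \<open>c\<close>. A failure persists in later rounds.\<close>

definition strip_delta :: "nat \<Rightarrow> nat" where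
  "strip_delta s = (if s = 0 then 0 else
     if nfst (split_delta (list_decode (s - 1))) \<in> {a \<in> A. lv a = \<delta>}
     then Suc (nsnd (split_delta (list_decode (s - 1)))) else 0)"

text \<open>With the word written as \<open>u \<delta>^-j\<close>, \<open>\<delta>\<close> has to
  split off \<open>j\<close> times from \<open>u\<close> and leave only letters of value
  \<open>\<one>\<close>. Such letters exist, so the remaining list may be nonempty. The condition is
  phrased as membership in a finite set to match \<open>decidable_finite\<close>.\<close>

definition trivial_word :: "nat list \<Rightarrow> bool" where
  "trivial_word w \<longleftrightarrow> (let s = (strip_delta ^^ nsnd (fraction w)) (Suc (nfst (fraction w)))
     in s \<noteq> 0 \<and> (\<forall>a\<in>set (list_decode (s - 1)). a \<in> {a \<in> A. lv a = \<one>}))"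

lemma positive_one: "x \<in> P \<Longrightarrow> y \<in> P \<Longrightarrow> x \<otimes> y = \<one> \<Longrightarrow> x = \<one> \<and> y = \<one>"
proof -
  assume xy: "x \<in> P" "y \<in> P" "x \<otimes> y = \<one>"
  have "inv x \<otimes> (x \<otimes> y) = inv x" using xy by simp
  then have "inv x = y" using xy(1,2) by simp
  then show ?thesis using xy cone_antisym by force
qed

lemma wv_one: "set u \<subseteq> B \<Longrightarrow> wv u = \<one> \<longleftrightarrow> (\<forall>a\<in>set u. lv a = \<one>)"
proof (induction u)
  case (Cons a u)
  then have "lv a \<in> P" "wv u \<in> P" using B_D D_cone wv_cone by auto
  then show ?case using Cons positive_one[of "lv a" "wv u"] by auto
qed simp

lemma strip_delta_zero: "(strip_delta ^^ n) 0 = 0"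
  by (induction n) (auto simp: strip_delta_def)

text \<open>If the head is not \<open>\<delta>\<close>, then \<open>\<delta>\<close> is not below
  \<open>wv u\<close>, so \<open>wv u\<close> cannot be a power of \<open>\<delta>\<close> with
  positive exponent.\<close>

lemma strip_delta:
  assumes "set u \<subseteq> B"
  shows "wv u = \<delta> [^] j \<longleftrightarrow> (let s = (strip_delta ^^ j) (Suc (list_encode u))
    in s \<noteq> 0 \<and> (\<forall>a\<in>set (list_decode (s - 1)). a \<in> {a \<in> A. lv a = \<one>}))"
  using assms
proof (induction j arbitrary: u)
  case 0
  then show ?case using wv_one B_subset by auto
next
  case (Suc j)
  obtain h r where hr: "split_delta u = prod_encode (h, list_encode r)" "h \<in> B" "set r \<subseteq> B"
    "glb {wv u, \<delta>} (lv h)" "wv u = lv h \<otimes> wv r"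
    using split_delta[OF Suc.prems] by blast
  have uP: "wv u \<in> P" "wv r \<in> P" using wv_cone Suc.prems hr(3) by auto
  have pow: "\<delta> [^] Suc j = \<delta> \<otimes> \<delta> [^] j" by (rule nat_pow_Suc2) simp
  show ?case
  proof (cases "lv h = \<delta>")
    case True
    then have "strip_delta (Suc (list_encode u)) = Suc (list_encode r)"
      using hr(1,2) B_subset unfolding strip_delta_def by auto
    moreover have "wv u = \<delta> [^] Suc j \<longleftrightarrow> wv r = \<delta> [^] j"
      unfolding hr(5) True pow using uP by simp
    ultimately show ?thesis using Suc.IH[OF hr(3)] by (simp add: funpow_Suc_right del: funpow.simps nat_pow_Suc)
  next
    case False
    then have "strip_delta (Suc (list_encode u)) = 0"
      using hr(1) unfolding strip_delta_def by auto
    moreover have "wv u \<noteq> \<delta> [^] Suc j"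
    proof
      assume eq: "wv u = \<delta> [^] Suc j"
      have "\<delta> \<preceq> wv u" unfolding eq pow by (simp add: le_delta_pow)
      then have "glb {wv u, \<delta>} \<delta>" unfolding glb_def by auto
      then show False using glb_unique hr(4) False by blast
    qed
    ultimately show ?thesis by (simp add: funpow_Suc_right strip_delta_zero del: funpow.simps nat_pow_Suc)
  qed
qed

lemma trivial_word: "set w \<subseteq> A \<Longrightarrow> trivial_word w \<longleftrightarrow> wv w = \<one>"
proof -
  assume w: "set w \<subseteq> A"
  obtain u j where uj: "fraction w = prod_encode (list_encode u, j)" "set u \<subseteq> B"
    "wv w = wv u \<otimes> inv (\<delta> [^] j)" using fraction[OF w] by blast
  have uc: "wv u \<in> carrier G" using wv_cone[OF uj(2)] by simp
  have "wv w = \<one> \<longleftrightarrow> wv u = \<delta> [^] j"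
  proof
    assume "wv w = \<one>"
    then have "wv u \<otimes> inv (\<delta> [^] j) \<otimes> \<delta> [^] j = \<delta> [^] j" using uj(3) by simp
    then show "wv u = \<delta> [^] j" using uc by (simp add: m_assoc)
  qed (simp add: uj(3))
  then show ?thesis using strip_delta[OF uj(2)] uj(1) unfolding trivial_word_def by simp
qed

section \<open>Computability of the word problem\<close>

lemma finite_B: "finite B"
  using finite_A B_subset finite_subset by blast

lemma computable_letter_tables:
  "computable f \<Longrightarrow> computable (\<lambda>x. delta_exponent (f x))"
  "computable f \<Longrightarrow> computable (\<lambda>x. simple_part (f x))"
  "computable f \<Longrightarrow> computable (\<lambda>x. twist (f x))"
  "computable f \<Longrightarrow> computable g \<Longrightarrow> computable (\<lambda>x. head2 (f x) (g x))"
  "computable f \<Longrightarrow> computable g \<Longrightarrow> computable (\<lambda>x. tail2 (f x) (g x))"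
proof -
  show "computable f \<Longrightarrow> computable (\<lambda>x. delta_exponent (f x))"
    by (rule computable_table[OF finite_A]) (auto simp: delta_exponent_def)
  show "computable f \<Longrightarrow> computable (\<lambda>x. simple_part (f x))"
    by (rule computable_table[OF finite_A]) (auto simp: simple_part_def)
  show "computable f \<Longrightarrow> computable (\<lambda>x. twist (f x))"
    by (rule computable_table[OF finite_A]) (auto simp: twist_def)
  show "computable f \<Longrightarrow> computable g \<Longrightarrow> computable (\<lambda>x. head2 (f x) (g x))"
    by (rule computable_table2[OF finite_B]) (auto simp: head2_def)
  show "computable f \<Longrightarrow> computable g \<Longrightarrow> computable (\<lambda>x. tail2 (f x) (g x))"
    by (rule computable_table2[OF finite_B]) (auto simp: tail2_def)
qed

lemma computable_fraction:
  assumes "list_computable f" shows "computable (\<lambda>x. fraction (f x))"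
  unfolding fraction_def fraction_step_def
  by (intro computable_fold computable_intros computable_letter_tables assms)

lemma computable_split_delta:
  assumes "list_computable f" shows "computable (\<lambda>x. split_delta (f x))"
  unfolding split_delta_def
  by (intro computable_fold computable_intros computable_letter_tables assms)

lemma decidable_trivial_word:
  assumes "list_computable f" shows "decidable (\<lambda>x. trivial_word (f x))"
proof -
  have s: "computable (\<lambda>x. strip_delta (g x))" if "computable g" for g
    unfolding strip_delta_def using that finite_A
    by (intro computable_intros decidable_finite computable_split_delta) auto
  show ?thesis
    unfolding trivial_word_def Let_def using finite_A assms
    by (intro computable_intros decidable_finite computable_funpow s computable_fraction) auto
qed

section \<open>Decision procedures\<close>

definition flip :: "nat \<Rightarrow> nat" where "flip a = (if a \<in> A then code (inv (lv a)) else 0)"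
definition inverse_word :: "nat list \<Rightarrow> nat list" where "inverse_word w = map flip (rev w)"
definition equal_words :: "nat list \<Rightarrow> nat list \<Rightarrow> bool" where "equal_words u v \<longleftrightarrow> trivial_word (u @ inverse_word v)"

lemma flip: assumes "a \<in> A" shows "flip a \<in> A" "lv (flip a) = inv (lv a)"
proof -
  have "lv a \<in> D \<or> inv (lv a) \<in> D" using letters[OF assms] by blast
  then show "flip a \<in> A" "lv (flip a) = inv (lv a)"
    using code(1,2)[of "inv (lv a)"] code(3,4)[of "inv (lv a)"] assms unfolding flip_def by auto
qed

lemma inverse_word: "set w \<subseteq> A \<Longrightarrow> set (inverse_word w) \<subseteq> A \<and> wv (inverse_word w) = inv (wv w)"
proof (induction w)
  case (Cons a w)
  then have a: "a \<in> A" and w: "set w \<subseteq> A" by auto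
  have "inverse_word (a # w) = inverse_word w @ [flip a]" unfolding inverse_word_def by simp
  then show ?case using Cons.IH[OF w] flip[OF a] a w by (simp add: wv_append inv_mult_group)
qed (simp add: inverse_word_def)

lemma equal_words: "set u \<subseteq> A \<Longrightarrow> set v \<subseteq> A \<Longrightarrow> equal_words u v \<longleftrightarrow> wv u = wv v"
proof -
  assume uv: "set u \<subseteq> A" "set v \<subseteq> A"
  have "wv u \<otimes> inv (wv v) = \<one> \<longleftrightarrow> wv u = wv v"
  proof
    assume eq: "wv u \<otimes> inv (wv v) = \<one>"
    have "wv u = wv u \<otimes> inv (wv v) \<otimes> wv v" using uv by (simp add: m_assoc)
    then show "wv u = wv v" using eq uv by simp
  qed (use uv in simp)
  then show ?thesis
    unfolding equal_words_def using trivial_word[of "u @ inverse_word v"] inverse_word[OF uv(2)] uv by (simp add: wv_append)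
qed

section \<open>Families of coded words and exponent vectors\<close>

abbreviation wvc :: "nat \<Rightarrow> 'a" where "wvc c \<equiv> wv (list_decode c)"

definition valid :: "nat \<Rightarrow> bool" where "valid c \<longleftrightarrow> (\<forall>a\<in>set (list_decode c). a \<in> A)"

lemma valid_iff: "valid c \<longleftrightarrow> set (list_decode c) \<subseteq> A"
  unfolding valid_def by blast

definition commuting_codes :: "nat list \<Rightarrow> bool" where
  "commuting_codes bs \<longleftrightarrow> (\<forall>c\<in>set bs. valid c) \<and> (\<forall>c\<in>set bs. \<forall>d\<in>set bs. wvc c \<otimes> wvc d = wvc d \<otimes> wvc c)"

definition code_value :: "nat list \<Rightarrow> nat \<Rightarrow> 'a" where "code_value bs i = wvc (nth_default 0 bs i)"
text \<open>Coded exponents are natural numbers, and missing ones count as 0. Negative exponents are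
  moved to the other side of an equation instead of being encoded.\<close>

definition vec :: "nat list \<Rightarrow> nat \<Rightarrow> int" where "vec p i = int (nth_default 0 p i)"
definition code_span :: "nat list \<Rightarrow> 'a set" where "code_span bs = generate G (wvc ` set bs)"
definition power_word :: "nat list \<Rightarrow> nat list \<Rightarrow> nat list" where
  "power_word bs p = concat (map (\<lambda>i. concat (map (\<lambda>_. list_decode (nth_default 0 bs i)) [0..<nth_default 0 p i]))
     [0..<length bs])"

lemma nth_default_in_set: "i < length xs \<Longrightarrow> nth_default 0 xs i \<in> set xs"
  by (simp add: nth_default_def)

lemma code_value_image: "code_value bs ` {..<length bs} = wvc ` set bs"
proof -
  have "set bs = (\<lambda>i. nth_default 0 bs i) ` {..<length bs}"
    by (auto simp: nth_default_def in_set_conv_nth image_iff)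
  then show ?thesis unfolding code_value_def by (simp add: image_image)
qed

lemma gspan_fam: "gspan (code_value bs) (length bs) = code_span bs"
  unfolding code_value_image code_span_def ..

lemma valid_closed: "valid c \<Longrightarrow> wvc c \<in> carrier G"
  unfolding valid_iff by simp

lemma commuting_codes_commuting: "commuting_codes bs \<Longrightarrow> commuting_fam (code_value bs) (length bs)"
  unfolding commuting_codes_def commuting_fam_def code_value_def using nth_default_in_set valid_closed by blast

lemma commuting_codes_valid: "commuting_codes bs \<Longrightarrow> c \<in> set bs \<Longrightarrow> valid c"
  unfolding commuting_codes_def by blast

lemma code_span_closed: "commuting_codes bs \<Longrightarrow> x \<in> code_span bs \<Longrightarrow> x \<in> carrier G"
  using gspan_closed[OF commuting_codes_commuting] unfolding gspan_fam by blast

lemma code_span_subgroup: "commuting_codes bs \<Longrightarrow> subgroup (code_span bs) G"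
  using gspan_subgroup[OF commuting_codes_commuting] unfolding gspan_fam by blast

lemma code_span_subset: "commuting_codes bs \<Longrightarrow> (\<And>c. c \<in> set cs \<Longrightarrow> wvc c \<in> code_span bs) \<Longrightarrow> code_span cs \<subseteq> code_span bs"
  unfolding code_span_def[of cs] by (rule generate_subgroup_incl) (auto intro: code_span_subgroup)

lemma wv_concat_map:
  "(\<And>i. i < n \<Longrightarrow> set (f i) \<subseteq> A) \<Longrightarrow>
    wv (concat (map f [0..<n])) = word_prod G (map (\<lambda>i. wv (f i)) [0..<n])"
proof (induction n)
  case (Suc n)
  have f: "set (f i) \<subseteq> A" if "i \<le> n" for i using Suc.prems that by simp
  then have "set (concat (map f [0..<n])) \<subseteq> A" by (simp add: UN_subset_iff)
  moreover have "set (map (\<lambda>i. wv (f i)) [0..<n]) \<subseteq> carrier G" using f by auto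
  ultimately show ?case
    using Suc.IH f word_prod_append[of "map (\<lambda>i. wv (f i)) [0..<n]" "[wv (f n)]"]
    by (simp add: wv_append)
qed simp

lemma wv_repeat:
  "set w \<subseteq> A \<Longrightarrow> wv (concat (map (\<lambda>_. w) [0..<n])) = wv w [^] n"
proof (induction n)
  case (Suc n)
  have "set (concat (map (\<lambda>_. w) [0..<n])) \<subseteq> A" using Suc.prems by auto
  then show ?case using Suc by (simp add: wv_append)
qed simp

lemma power_word_closed: "commuting_codes bs \<Longrightarrow> set (power_word bs p) \<subseteq> A"
  using nth_default_in_set[of _ bs] commuting_codes_valid[of bs] unfolding power_word_def valid_iff by fastforce

lemma wv_pwl: assumes "commuting_codes bs" shows "wv (power_word bs p) = mpow (code_value bs) (vec p) (length bs)"
proof -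
  have A: "set (list_decode (nth_default 0 bs i)) \<subseteq> A" if "i < length bs" for i
    using that assms nth_default_in_set[of i bs] commuting_codes_valid[of bs] unfolding valid_iff by blast
  define f where "f i = concat (map (\<lambda>_. list_decode (nth_default 0 bs i)) [0..<nth_default 0 p i])" for i
  have f: "set (f i) \<subseteq> A" "wv (f i) = code_value bs i [^] vec p i" if "i < length bs" for i
    using A[OF that] unfolding f_def wv_repeat[OF A[OF that]] by (auto simp: code_value_def vec_def int_pow_int)
  have "wv (power_word bs p) = word_prod G (map (\<lambda>i. wv (f i)) [0..<length bs])"
    unfolding power_word_def f_def[symmetric] by (rule wv_concat_map[OF f(1)])
  also have "\<dots> = mpow (code_value bs) (vec p) (length bs)"
    unfolding mpow_def using f(2) by (intro arg_cong[of _ _ "word_prod G"] map_cong) auto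
  finally show ?thesis .
qed

text \<open>The equation \<open>g b^d = b^c\<close> expresses \<open>g\<close> with the exponents
  \<open>c - d\<close>. The quantifiers also reach some vectors with entries above \<open>N\<close>;
  this does no harm, because every solution proves membership.\<close>

definition in_span_upto :: "nat \<Rightarrow> nat list \<Rightarrow> nat list \<Rightarrow> bool" where
  "in_span_upto N bs g \<longleftrightarrow> (\<exists>c<list_code_bound (length bs) N. \<exists>d<list_code_bound (length bs) N.
     equal_words (g @ power_word bs (list_decode d)) (power_word bs (list_decode c)))"

text \<open>Equality of the two products is the relation with exponents \<open>c - d\<close>. Here
  too the vectors with larger entries do no harm, since for an independent family every such
  relation is trivial.\<close>

definition independent_upto :: "nat \<Rightarrow> nat list \<Rightarrow> bool" where
  "independent_upto N bs \<longleftrightarrow> (\<forall>c<list_code_bound (length bs) N. \<forall>d<list_code_bound (length bs) N.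
     equal_words (power_word bs (list_decode d)) (power_word bs (list_decode c)) \<longrightarrow>
     (\<forall>i<length bs. nth_default 0 (list_decode c) i = nth_default 0 (list_decode d) i))"

lemma in_span_upto_sound:
  assumes bs: "commuting_codes bs" and g: "set g \<subseteq> A" and in_span_upto: "in_span_upto N bs g" shows "wv g \<in> code_span bs"
proof -
  obtain c d where "equal_words (g @ power_word bs d) (power_word bs c)" using in_span_upto unfolding in_span_upto_def by blast
  then have eq: "wv g \<otimes> wv (power_word bs d) = wv (power_word bs c)"
    using equal_words power_word_closed[OF bs] g by (simp add: wv_append)
  have code_span: "wv (power_word bs p) \<in> code_span bs" for p
    using wv_pwl[OF bs] mpow_in_gspan[OF commuting_codes_commuting[OF bs]] gspan_fam by metis
  have "wv g = wv g \<otimes> wv (power_word bs d) \<otimes> inv (wv (power_word bs d))"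
    using g power_word_closed[OF bs] by (simp add: m_assoc)
  also have "\<dots> \<in> code_span bs"
    unfolding eq using code_span subgroup.m_closed[OF code_span_subgroup[OF bs]]
      subgroup.m_inv_closed[OF code_span_subgroup[OF bs]] by blast
  finally show ?thesis .
qed

definition pos_part :: "(nat \<Rightarrow> int) \<Rightarrow> nat \<Rightarrow> nat list" where
  "pos_part c k = map (\<lambda>i. nat (c i)) [0..<k]"

lemma vec_pos_part: "i < k \<Longrightarrow> vec (pos_part c k) i = max 0 (c i)"
  unfolding vec_def pos_part_def by (simp add: nth_default_def)

lemma pos_part_bound:
  "(\<And>i. i < k \<Longrightarrow> nat \<bar>c i\<bar> \<le> N) \<Longrightarrow> list_encode (pos_part c k) < list_code_bound k N"
  by (rule list_encode_less_vbound) (force simp: pos_part_def)+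

lemma mpow_pos_part:
  assumes bs: "commuting_codes bs"
  shows "mpow (code_value bs) c (length bs) \<otimes> wv (power_word bs (pos_part (\<lambda>i. - c i) (length bs))) =
    wv (power_word bs (pos_part c (length bs)))"
proof -
  note comm = commuting_codes_commuting[OF bs]
  have "mpow (code_value bs) (\<lambda>i. c i + vec (pos_part (\<lambda>i. - c i) (length bs)) i) (length bs) =
      mpow (code_value bs) (vec (pos_part c (length bs))) (length bs)"
    by (rule mpow_cong) (simp add: vec_pos_part)
  then show ?thesis using mpow_add[OF comm] wv_pwl[OF bs] by simp
qed

lemma in_span_upto_complete:
  assumes bs: "commuting_codes bs" and g: "set g \<subseteq> A" "wv g = mpow (code_value bs) c (length bs)"
    and N: "\<And>i. i < length bs \<Longrightarrow> nat \<bar>c i\<bar> \<le> N"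
  shows "in_span_upto N bs g"
proof -
  define p q where "p = pos_part c (length bs)" and "q = pos_part (\<lambda>i. - c i) (length bs)"
  have "equal_words (g @ power_word bs q) (power_word bs p)"
    using equal_words power_word_closed[OF bs] g mpow_pos_part[OF bs] unfolding p_def q_def by (simp add: wv_append)
  moreover have "list_encode p < list_code_bound (length bs) N" "list_encode q < list_code_bound (length bs) N"
    unfolding p_def q_def using N by (auto intro!: pos_part_bound)
  ultimately show ?thesis unfolding in_span_upto_def by (metis list_encode_inverse)
qed

lemma in_span_upto_mono: "in_span_upto N bs g \<Longrightarrow> N \<le> N' \<Longrightarrow> in_span_upto N' bs g"
  unfolding in_span_upto_def using list_code_bound_mono[of N N' "length bs"] by (meson order.strict_trans2)

lemma in_span_upto_exists: assumes "commuting_codes bs" "set g \<subseteq> A" "wv g \<in> code_span bs" shows "\<exists>N. in_span_upto N bs g"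
proof -
  obtain c where c: "wv g = mpow (code_value bs) c (length bs)"
    using gspan_mpow[OF commuting_codes_commuting[OF assms(1)]] assms(3) unfolding gspan_fam by blast
  have "\<exists>N. \<forall>i\<in>{..<length bs}. nat \<bar>c i\<bar> \<le> N" by (rule uniform_bound) auto
  then show ?thesis using in_span_upto_complete[OF assms(1,2) c] by (metis lessThan_iff)
qed

text \<open>Meets both conditions on \<open>Q\<close> in the approximation lemmas once the number of
  words and their lengths are at most \<open>s\<close>.\<close>

definition approx_bound :: "nat \<Rightarrow> nat" where "approx_bound s = 2 * s * s * card D + 2"
text \<open>The sum of the bound from \<open>independent_bound\<close> with \<open>T = s\<close> and
  the one from \<open>bounded_relation\<close>, so that one number serves both purposes. The
  parameter \<open>s\<close> will be built from codes, which dominate the lengths of lists and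
  words.\<close>

definition coeff_bound :: "nat \<Rightarrow> nat" where
  "coeff_bound s = 2 * approx_bound s ^ s * card D * s + approx_bound s ^ s"

lemma bd_wv: "set w \<subseteq> A \<Longrightarrow> bd (length w) (wv w)"
proof (induction w)
  case (Cons a w)
  have "bd 1 (lv a)" using letters[of a] bd_D bd_inv[OF bd_D, of "inv (lv a)"] Cons.prems by fastforce
  then show ?case using bd_mult[of 1 "lv a" "length w" "wv w"] Cons by simp
qed (simp add: bd_one)

lemma bd_wvc: "valid c \<Longrightarrow> bd c (wvc c)"
  using bd_mono[OF bd_wv] length_le_list_encode[of "list_decode c"] unfolding valid_iff by simp

lemma code_value_bd:
  assumes "commuting_codes bs" "list_encode bs \<le> s" "i < length bs" shows "bd s (code_value bs i)"
proof -
  have "nth_default 0 bs i \<in> set bs" using assms(3) by (rule nth_default_in_set)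
  then show ?thesis
    using bd_mono[OF bd_wvc] commuting_codes_valid[OF assms(1)] element_le_list_encode assms(2)
    unfolding code_value_def by (meson order_trans)
qed

lemma approx_bound_bounds:
  assumes "list_encode bs \<le> s"
  shows "2 \<le> approx_bound s" "2 * length bs * s * card D \<le> approx_bound s" "approx_bound s ^ length bs \<le> approx_bound s ^ s"
proof -
  have l: "length bs \<le> s" using assms length_le_list_encode order_trans by blast
  show "2 \<le> approx_bound s" unfolding approx_bound_def by simp
  have "2 * length bs * s * card D \<le> 2 * s * s * card D" using l by (intro mult_right_mono) auto
  then show "2 * length bs * s * card D \<le> approx_bound s" unfolding approx_bound_def by (rule trans_le_add1)
  show "approx_bound s ^ length bs \<le> approx_bound s ^ s" using l by (intro power_increasing) (auto simp: approx_bound_def)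
qed

text \<open>A dependent family has a relation with coefficients at most
  \<open>approx_bound s ^ k\<close>; its positive and negative parts are two different vectors with
  small codes and equal products.\<close>

lemma independent_upto_correct:
  assumes bs: "commuting_codes bs" and N: "coeff_bound (list_encode bs) \<le> N"
  shows "independent_upto N bs \<longleftrightarrow> independent (code_value bs) (length bs)"
proof
  note comm = commuting_codes_commuting[OF bs]
  assume indep: "independent (code_value bs) (length bs)"
  show "independent_upto N bs"
    unfolding independent_upto_def
  proof (intro allI impI)
    fix c d i assume eq: "equal_words (power_word bs (list_decode d)) (power_word bs (list_decode c))" and i: "i < length bs"
    let ?c = "vec (list_decode c)" and ?d = "vec (list_decode d)"
    have eq': "mpow (code_value bs) ?d (length bs) = mpow (code_value bs) ?c (length bs)"
      using eq equal_words power_word_closed[OF bs] wv_pwl[OF bs] by simp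
    have "mpow (code_value bs) (\<lambda>i. ?c i + (- 1) * ?d i) (length bs) = \<one>"
      using mpow_add[OF comm, of ?c "\<lambda>i. (- 1) * ?d i"] mpow_scale[OF comm, of "- 1" ?d] eq' comm
      by (simp add: int_pow_neg)
    then have "?c i + (- 1) * ?d i = 0" using indep i unfolding independent_def by blast
    then show "nth_default 0 (list_decode c) i = nth_default 0 (list_decode d) i"
      unfolding vec_def by simp
  qed
next
  note comm = commuting_codes_commuting[OF bs]
  define s k where "s = list_encode bs" and "k = length bs"
  assume independent_upto: "independent_upto N bs"
  show "independent (code_value bs) (length bs)"
  proof (rule ccontr)
    assume dep: "\<not> independent (code_value bs) (length bs)"
    note Q = approx_bound_bounds[of bs s]
    obtain p i where p: "mpow (code_value bs) p k = \<one>" "i < k" "p i \<noteq> 0"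
      "\<And>i. i < k \<Longrightarrow> \<bar>p i\<bar> \<le> int (approx_bound s ^ k)"
      unfolding k_def
      by (rule bounded_relation[OF comm code_value_bd[OF bs, of s] Q(1,2) dep])
        (auto simp: s_def k_def intro: that)
    have "nat \<bar>p i\<bar> \<le> N" if "i < k" for i
    proof -
      have "nat \<bar>p i\<bar> \<le> approx_bound s ^ k" using p(4)[OF that] by (simp add: nat_le_iff)
      also have "\<dots> \<le> approx_bound s ^ s" using Q(3) unfolding s_def k_def by simp
      also have "\<dots> \<le> N" using N unfolding s_def coeff_bound_def by simp
      finally show ?thesis .
    qed
    then have "list_encode (pos_part p k) < list_code_bound k N" "list_encode (pos_part (\<lambda>i. - p i) k) < list_code_bound k N"
      by (auto intro!: pos_part_bound)
    moreover have "equal_words (power_word bs (pos_part (\<lambda>i. - p i) k)) (power_word bs (pos_part p k))"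
      using mpow_pos_part[OF bs, of p] p(1) equal_words power_word_closed[OF bs] unfolding k_def by simp
    ultimately have "nth_default 0 (pos_part p k) i = nth_default 0 (pos_part (\<lambda>i. - p i) k) i"
      using independent_upto p(2) unfolding independent_upto_def k_def by (metis list_encode_inverse)
    then have "vec (pos_part p k) i = vec (pos_part (\<lambda>i. - p i) k) i" unfolding vec_def by simp
    then show False using p(2,3) by (simp add: vec_pos_part)
  qed
qed

text \<open>A certificate that can be checked: \<open>N\<close> bounds exponents that witness the
  two inclusions of spans. Independence requires no certificate, because its bound is computed from
  \<open>bs\<close>.\<close>

definition is_basis :: "nat list \<Rightarrow> nat list \<Rightarrow> nat \<Rightarrow> bool" where
  "is_basis hs bs N \<longleftrightarrow> (\<forall>b\<in>set bs. valid b \<and> in_span_upto N hs (list_decode b)) \<and>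
     (\<forall>h\<in>set hs. in_span_upto N bs (list_decode h)) \<and> independent_upto (coeff_bound (list_encode bs)) bs"

lemma is_basis_sound:
  assumes hs: "commuting_codes hs" and basis: "is_basis hs bs N"
  shows "commuting_codes bs" "code_span bs = code_span hs" "independent (code_value bs) (length bs)"
proof -
  have bs: "valid b" "wvc b \<in> code_span hs" if "b \<in> set bs" for b
    using basis that in_span_upto_sound[OF hs] unfolding is_basis_def valid_iff by auto
  have "wvc b \<otimes> wvc c = wvc c \<otimes> wvc b" if "b \<in> set bs" "c \<in> set bs" for b c
    using that bs(2) gspan_commute[OF commuting_codes_commuting[OF hs]] unfolding gspan_fam by blast
  then show commuting_codes: "commuting_codes bs" unfolding commuting_codes_def using bs(1) by blast
  have "wvc h \<in> code_span bs" if "h \<in> set hs" for h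
    using that basis in_span_upto_sound[OF commuting_codes] commuting_codes_valid[OF hs] unfolding is_basis_def valid_iff by blast
  then show "code_span bs = code_span hs"
    using code_span_subset[OF hs, of bs] code_span_subset[OF commuting_codes, of hs] bs(2) by blast
  show "independent (code_value bs) (length bs)"
    using basis independent_upto_correct[OF commuting_codes] unfolding is_basis_def by blast
qed

lemma wv_code:
  "set ss \<subseteq> insert (inv \<delta>) D \<Longrightarrow> set (map code ss) \<subseteq> A \<and> wv (map code ss) = word_prod G ss"
proof (induction ss)
  case (Cons s ss)
  have "s \<in> D \<or> s = inv \<delta>" using Cons.prems by auto
  then have "code s \<in> A \<and> lv (code s) = s" using code[of s] delta_D by fastforce
  then show ?case using Cons by simp
qed simp

lemma wv_surj: assumes x: "x \<in> carrier G" obtains w where "set w \<subseteq> A" "wv w = x"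
proof -
  obtain k where k: "x \<otimes> \<delta> [^] (k::nat) \<in> P" using cofinal[OF x] by blast
  obtain l where "bd l (x \<otimes> \<delta> [^] k)" using bd_exists[of "x \<otimes> \<delta> [^] k"] x by auto
  then have "x \<otimes> \<delta> [^] k \<preceq> \<delta> [^] l" unfolding bd_def le_def by simp
  then obtain ds where ds: "set ds \<subseteq> D" "x \<otimes> \<delta> [^] k = word_prod G ds" using simple_factors[OF k] by blast
  have rep: "word_prod G (replicate k (inv \<delta>)) = inv (\<delta> [^] k)"
    by (induction k) (simp_all add: inv_mult_group)
  have "word_prod G (ds @ replicate k (inv \<delta>)) = x \<otimes> \<delta> [^] k \<otimes> inv (\<delta> [^] k)"
    using ds(1) unfolding ds(2) rep[symmetric] by (intro word_prod_append) auto
  also have "\<dots> = x" using x by (simp add: m_assoc)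
  finally have eq: "word_prod G (ds @ replicate k (inv \<delta>)) = x" .
  have "set (ds @ replicate k (inv \<delta>)) \<subseteq> insert (inv \<delta>) D" using ds(1) by auto
  note w = wv_code[OF this]
  show ?thesis by (rule that[OF conjunct1[OF w] trans[OF conjunct2[OF w] eq]])
qed

text \<open>This makes the search terminate: an abstract basis is spelled out in words, and the
  finitely many memberships involved share a common exponent bound.\<close>

lemma is_basis_exists: assumes hs: "commuting_codes hs" shows "\<exists>bs N. is_basis hs bs N"
proof -
  have "set (map wvc hs) \<subseteq> carrier G" using commuting_codes_valid[OF hs] valid_closed by auto
  moreover have "x \<otimes> y = y \<otimes> x" if "x \<in> set (map wvc hs)" "y \<in> set (map wvc hs)" for x y
    using that hs unfolding commuting_codes_def by auto
  ultimately obtain gs where gs: "set gs \<subseteq> code_span hs" "generate G (set gs) = code_span hs"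
    "independent ((!) gs) (length gs)"
    using basis_exists[of "map wvc hs"] unfolding code_span_def by auto
  have "\<exists>c. valid c \<and> wvc c = g" if "g \<in> set gs" for g
  proof -
    have "g \<in> carrier G" using gs(1) that by (intro code_span_closed[OF hs]) blast
    then obtain w where "set w \<subseteq> A" "wv w = g" by (rule wv_surj)
    then show ?thesis unfolding valid_iff by (intro exI[of _ "list_encode w"]) simp
  qed
  then obtain f where f: "\<And>g. g \<in> set gs \<Longrightarrow> valid (f g) \<and> wvc (f g) = g" by metis
  define bs where "bs = map f gs"
  have wv_bs: "wvc ` set bs = set gs" unfolding bs_def using f by (force simp: image_iff)
  then have code_span: "code_span bs = code_span hs" using gs(2) unfolding code_span_def by simp
  have bsp: "valid b \<and> wvc b \<in> code_span hs" if "b \<in> set bs" for b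
    using that gs(1) f unfolding bs_def by auto
  then have commuting_codes: "commuting_codes bs"
    unfolding commuting_codes_def using gspan_commute[OF commuting_codes_commuting[OF hs]] unfolding gspan_fam by blast
  have "mpow (code_value bs) c (length bs) = mpow ((!) gs) c (length gs)" for c
    unfolding bs_def by (simp, rule mpow_cong) (use f in \<open>auto simp: code_value_def nth_default_def\<close>)
  then have "independent (code_value bs) (length bs)" using gs(3) unfolding independent_def bs_def by simp
  then have independent_upto: "independent_upto (coeff_bound (list_encode bs)) bs" using independent_upto_correct[OF commuting_codes] by simp
  have "\<exists>N. \<forall>b\<in>set bs. in_span_upto N hs (list_decode b)"
    by (rule uniform_bound[OF finite_set in_span_upto_exists[OF hs] in_span_upto_mono])
      (use bsp in \<open>auto simp: valid_iff\<close>)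
  then obtain N1 where N1: "\<forall>b\<in>set bs. in_span_upto N1 hs (list_decode b)" by blast
  have "wvc h \<in> code_span bs" if "h \<in> set hs" for h
    unfolding code_span unfolding code_span_def using that by (auto intro: generate.incl)
  then have "\<exists>N. \<forall>h\<in>set hs. in_span_upto N bs (list_decode h)"
    by (intro uniform_bound[OF finite_set in_span_upto_exists[OF commuting_codes] in_span_upto_mono])
      (use commuting_codes_valid[OF hs] in \<open>auto simp: valid_iff\<close>)
  then obtain N2 where N2: "\<forall>h\<in>set hs. in_span_upto N2 bs (list_decode h)" by blast
  have "is_basis hs bs (max N1 N2)"
    unfolding is_basis_def
    using independent_upto bsp N1 N2 in_span_upto_mono[OF _ max.cobounded1] in_span_upto_mono[OF _ max.cobounded2] by simp
  then show ?thesis by blast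
qed

text \<open>Relative to an independent family the length of \<open>g\<close> bounds its exponents,
  so a computed number replaces the unknown \<open>N\<close> of the certificate.\<close>

definition span_test :: "nat list \<Rightarrow> nat list \<Rightarrow> bool" where
  "span_test bs g \<longleftrightarrow> in_span_upto (coeff_bound (list_encode bs + list_encode g)) bs g"

lemma conjugate_coeff_bound:
  assumes bs: "commuting_codes bs" "independent (code_value bs) (length bs)" and s: "list_encode bs \<le> s"
    and x: "x \<in> carrier G" "bd s (inv x \<otimes> mpow (code_value bs) c (length bs) \<otimes> x)" and i: "i < length bs"
  shows "nat \<bar>c i\<bar> \<le> coeff_bound s"
proof -
  note Q = approx_bound_bounds[OF s]
  have "nat \<bar>c i\<bar> \<le> 2 * approx_bound s ^ length bs * card D * s"
    by (rule independent_bound[OF commuting_codes_commuting[OF bs(1)] code_value_bd[OF bs(1) s] Q(1,2) bs(2) x i])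
  also have "\<dots> \<le> 2 * approx_bound s ^ s * card D * s" using Q(3) by (intro mult_right_mono) auto
  finally show ?thesis unfolding coeff_bound_def by simp
qed

lemma span_test:
  assumes bs: "commuting_codes bs" "independent (code_value bs) (length bs)" and g: "set g \<subseteq> A"
  shows "span_test bs g \<longleftrightarrow> wv g \<in> code_span bs"
proof
  assume "wv g \<in> code_span bs"
  then obtain c where c: "wv g = mpow (code_value bs) c (length bs)"
    using gspan_mpow[OF commuting_codes_commuting[OF bs(1)]] unfolding gspan_fam by blast
  have "bd (list_encode bs + list_encode g) (wv g)"
    using bd_mono[OF bd_wv[OF g]] length_le_list_encode[of g] by simp
  then have "bd (list_encode bs + list_encode g) (inv \<one> \<otimes> mpow (code_value bs) c (length bs) \<otimes> \<one>)"
    using g unfolding c[symmetric] by simp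
  from conjugate_coeff_bound[OF bs le_add1 one_closed this]
  show "span_test bs g" unfolding span_test_def by (intro in_span_upto_complete[OF bs(1) g c])
qed (use in_span_upto_sound[OF bs(1) g] in \<open>simp add: span_test_def\<close>)

text \<open>The inner sum is a radius that covers the given elements, of length at most
  \<open>s\<close>, and their conjugates: products of at most \<open>s\<close> basis elements of
  length at most \<open>s\<close> with exponents at most \<open>coeff_bound s\<close>. The rest is
  the path bound of \<open>short_conjugator\<close> for tuples of at most \<open>Suc s\<close>
  entries; \<open>Suc\<close> leaves room for a single element even if \<open>s = 0\<close>.\<close>

definition conj_bound :: "nat \<Rightarrow> nat" where
  "conj_bound s = ((card D ^ (2 * (s * (s * coeff_bound s) + s))) ^ Suc s) ^ 2"

definition conj_code_bound :: "nat \<Rightarrow> nat" where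
  "conj_code_bound s = list_code_bound (conj_bound s) (Max A)"

text \<open>Although \<open>y\<close> is unknown, the elements \<open>inv y a y\<close> are short:
  they are products of basis elements, and conjugating back by \<open>inv y\<close> returns the
  short elements \<open>a\<close>, which bounds their coordinates. Then
  \<open>short_conjugator\<close> works in a ball of known radius.\<close>

lemma bounded_conjugator:
  assumes bs: "commuting_codes bs" "independent (code_value bs) (length bs)" and s: "list_encode bs \<le> s"
    and as: "\<And>a. a \<in> set as \<Longrightarrow> bd s a" "length as \<le> Suc s"
    and y: "y \<in> carrier G" "\<And>a. a \<in> set as \<Longrightarrow> inv y \<otimes> a \<otimes> y \<in> code_span bs"
  obtains v where "v < conj_code_bound s" "valid v"
    "\<And>a. a \<in> set as \<Longrightarrow> inv (wvc v) \<otimes> a \<otimes> wvc v = inv y \<otimes> a \<otimes> y"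
proof -
  define R where "R = s * (s * coeff_bound s) + s"
  have asb: "as \<in> box R (length as)"
    using as(1) bd_mono[of s _ R] unfolding box_def R_def by auto
  have "bd R (inv y \<otimes> a \<otimes> y)" if a: "a \<in> set as" for a
  proof -
    have ac: "a \<in> carrier G" using as(1)[OF a] bd_closed by blast
    obtain c where c: "inv y \<otimes> a \<otimes> y = mpow (code_value bs) c (length bs)"
      using gspan_mpow[OF commuting_codes_commuting[OF bs(1)]] y(2)[OF a] unfolding gspan_fam by blast
    have "inv (inv y) \<otimes> mpow (code_value bs) c (length bs) \<otimes> inv y = a"
      unfolding c[symmetric] using y(1) ac by (simp add: m_assoc)
    then have "nat \<bar>c i\<bar> \<le> coeff_bound s" if "i < length bs" for i
      using conjugate_coeff_bound[OF bs s, of "inv y"] y(1) as(1)[OF a] that by simp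
    then have "(\<Sum>i<length bs. nat \<bar>c i\<bar>) \<le> length bs * coeff_bound s"
      using sum_bounded_above[of "{..<length bs}" "\<lambda>i. nat \<bar>c i\<bar>" "coeff_bound s"] by simp
    also have "\<dots> \<le> s * coeff_bound s"
      using s length_le_list_encode[of bs] by (intro mult_right_mono) auto
    finally have "s * (\<Sum>i<length bs. nat \<bar>c i\<bar>) \<le> R"
      unfolding R_def by (intro trans_le_add1 mult_left_mono) auto
    then show ?thesis
      unfolding c using bd_mono[OF bd_mpow[OF commuting_codes_commuting[OF bs(1)] code_value_bd[OF bs(1) s]]] by blast
  qed
  then have "conj_list y as \<in> box R (length as)" unfolding box_def conj_list_def by auto
  then obtain ss where ss: "set ss \<subseteq> insert (inv \<delta>) D"
    "length ss \<le> ((card D ^ (2 * R)) ^ length as) ^ 2" "conj_list (word_prod G ss) as = conj_list y as"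
    by (rule short_conjugator[OF asb y(1)]) (rule that)
  define w where "w = map code ss"
  have w: "set w \<subseteq> A" "wv w = word_prod G ss" using wv_code[OF ss(1)] unfolding w_def by auto
  have "((card D ^ (2 * R)) ^ length as) ^ 2 \<le> conj_bound s"
    unfolding conj_bound_def R_def[symmetric] using as(2) card_D_pos
    by (intro power_mono power_increasing) auto
  then have "length w \<le> conj_bound s" using ss(2) unfolding w_def by simp
  then have "list_encode w < conj_code_bound s"
    unfolding conj_code_bound_def using w(1) finite_A by (intro list_encode_less_vbound) auto
  moreover have "valid (list_encode w)" unfolding valid_iff using w(1) by simp
  moreover have "inv (wv w) \<otimes> a \<otimes> wv w = inv y \<otimes> a \<otimes> y" if "a \<in> set as" for a
    using ss(3) that unfolding w(2) conj_list_def by auto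
  ultimately show ?thesis using that[of "list_encode w"] by simp
qed

definition conj_test :: "nat list \<Rightarrow> nat list \<Rightarrow> bool" where
  "conj_test bs g \<longleftrightarrow> (\<exists>v<conj_code_bound (list_encode bs + list_encode g).
     valid v \<and> span_test bs (inverse_word (list_decode v) @ g @ list_decode v))"

lemma wv_conj:
  assumes "valid v" "set g \<subseteq> A"
  shows "set (inverse_word (list_decode v) @ g @ list_decode v) \<subseteq> A"
    "wv (inverse_word (list_decode v) @ g @ list_decode v) = inv (wvc v) \<otimes> wv g \<otimes> wvc v"
    "set (list_decode v @ g @ inverse_word (list_decode v)) \<subseteq> A"
    "wv (list_decode v @ g @ inverse_word (list_decode v)) = wvc v \<otimes> wv g \<otimes> inv (wvc v)"
  using assms inverse_word[of "list_decode v"] unfolding valid_iff by (auto simp: wv_append m_assoc)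

lemma conj_test:
  assumes bs: "commuting_codes bs" "independent (code_value bs) (length bs)" and g: "set g \<subseteq> A"
  shows "conj_test bs g \<longleftrightarrow> (\<exists>x\<in>carrier G. x \<otimes> wv g \<otimes> inv x \<in> code_span bs)"
proof
  assume "conj_test bs g"
  then obtain v where v: "valid v" "span_test bs (inverse_word (list_decode v) @ g @ list_decode v)"
    unfolding conj_test_def by blast
  then have "inv (wvc v) \<otimes> wv g \<otimes> inv (inv (wvc v)) \<in> code_span bs"
    using span_test[OF bs wv_conj(1)[OF v(1) g]] wv_conj(2)[OF v(1) g] valid_closed[OF v(1)] by simp
  then show "\<exists>x\<in>carrier G. x \<otimes> wv g \<otimes> inv x \<in> code_span bs" using valid_closed[OF v(1)] by blast
next
  assume "\<exists>x\<in>carrier G. x \<otimes> wv g \<otimes> inv x \<in> code_span bs"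
  \<comment> \<open>The test conjugates from the other side, so \<open>inv x\<close> plays the part
    of the unknown conjugator.\<close>
  then obtain x where x: "x \<in> carrier G" "inv (inv x) \<otimes> wv g \<otimes> inv x \<in> code_span bs" by auto
  define s where "s = list_encode bs + list_encode g"
  have "bd s (wv g)" using bd_mono[OF bd_wv[OF g]] length_le_list_encode[of g] unfolding s_def by simp
  then obtain v where v: "v < conj_code_bound s" "valid v"
    "inv (wvc v) \<otimes> wv g \<otimes> wvc v = inv (inv x) \<otimes> wv g \<otimes> inv x"
    using bounded_conjugator[OF bs, of s "[wv g]" "inv x"] x unfolding s_def by auto
  then have "span_test bs (inverse_word (list_decode v) @ g @ list_decode v)"
    using span_test[OF bs wv_conj(1)[OF v(2) g]] wv_conj(2)[OF v(2) g] x(2) by simp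
  then show "conj_test bs g" unfolding conj_test_def s_def[symmetric] using v by blast
qed

definition subset_test :: "nat list \<Rightarrow> nat list \<Rightarrow> bool" where
  "subset_test bs cs \<longleftrightarrow> (\<forall>c\<in>set cs. span_test bs (list_decode c))"

lemma subset_test:
  assumes "commuting_codes bs" "independent (code_value bs) (length bs)" "commuting_codes cs"
  shows "subset_test bs cs \<longleftrightarrow> code_span cs \<subseteq> code_span bs"
proof -
  have "subset_test bs cs \<longleftrightarrow> (\<forall>c\<in>set cs. wvc c \<in> code_span bs)"
    unfolding subset_test_def using span_test[OF assms(1,2)] commuting_codes_valid[OF assms(3)]
    unfolding valid_iff by blast
  also have "\<dots> \<longleftrightarrow> code_span cs \<subseteq> code_span bs"
  proof
    assume "code_span cs \<subseteq> code_span bs"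
    moreover have "wvc c \<in> code_span cs" if "c \<in> set cs" for c
      unfolding code_span_def using that by (auto intro: generate.incl)
    ultimately show "\<forall>c\<in>set cs. wvc c \<in> code_span bs" by blast
  qed (use code_span_subset[OF assms(1)] in blast)
  finally show ?thesis .
qed

definition conj_subgroup_test :: "nat list \<Rightarrow> nat list \<Rightarrow> bool" where
  "conj_subgroup_test bs cs \<longleftrightarrow> (\<exists>v<conj_code_bound (list_encode bs + list_encode cs). valid v \<and>
     (\<forall>b\<in>set bs. span_test cs (inverse_word (list_decode v) @ list_decode b @ list_decode v)) \<and>
     (\<forall>c\<in>set cs. span_test bs (list_decode v @ list_decode c @ inverse_word (list_decode v))))"

lemma conj_image_subgroup:
  assumes "x \<in> carrier G" "subgroup H G" shows "subgroup {y \<in> carrier G. x \<otimes> y \<otimes> inv x \<in> H} G"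
proof
  fix y z assume yz: "y \<in> {y \<in> carrier G. x \<otimes> y \<otimes> inv x \<in> H}" "z \<in> {y \<in> carrier G. x \<otimes> y \<otimes> inv x \<in> H}"
  then have "x \<otimes> (y \<otimes> z) \<otimes> inv x = (x \<otimes> y \<otimes> inv x) \<otimes> (x \<otimes> z \<otimes> inv x)"
    using assms(1) by (simp add: m_assoc)
  then show "y \<otimes> z \<in> {y \<in> carrier G. x \<otimes> y \<otimes> inv x \<in> H}"
    using yz subgroup.m_closed[OF assms(2)] by simp
next
  fix y assume y: "y \<in> {y \<in> carrier G. x \<otimes> y \<otimes> inv x \<in> H}"
  then have "x \<otimes> inv y \<otimes> inv x = inv (x \<otimes> y \<otimes> inv x)"
    using assms(1) by (simp add: inv_mult_group m_assoc)
  then show "inv y \<in> {y \<in> carrier G. x \<otimes> y \<otimes> inv x \<in> H}"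
    using y subgroup.m_inv_closed[OF assms(2)] by simp
qed (use assms subgroup.one_closed in auto)

lemma conj_sp_subset:
  assumes "x \<in> carrier G" "subgroup H G" "commuting_codes bs"
    and "\<And>b. b \<in> set bs \<Longrightarrow> x \<otimes> wvc b \<otimes> inv x \<in> H" and "y \<in> code_span bs"
  shows "x \<otimes> y \<otimes> inv x \<in> H"
proof -
  have "code_span bs \<subseteq> {y \<in> carrier G. x \<otimes> y \<otimes> inv x \<in> H}"
    unfolding code_span_def
    by (rule generate_subgroup_incl[OF _ conj_image_subgroup[OF assms(1,2)]])
      (use assms(3,4) commuting_codes_valid valid_closed in auto)
  then show ?thesis using assms(5) by blast
qed

text \<open>Only the generators of the first span are conjugated by a short \<open>v\<close>. As
  \<open>v\<close> agrees on them with the unknown conjugator \<open>y\<close>, the element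
  \<open>u = v y^-1\<close> commutes with the first span; hence \<open>v\<close> conjugates that
  span exactly as \<open>y\<close> does, and the second inclusion needs no separate bound.\<close>

lemma conj_subgroup_test:
  assumes bs: "commuting_codes bs" "independent (code_value bs) (length bs)"
    and cs: "commuting_codes cs" "independent (code_value cs) (length cs)"
  shows "conj_subgroup_test bs cs \<longleftrightarrow> (\<exists>x\<in>carrier G. x <# code_span bs #> inv x = code_span cs)"
proof -
  have coset: "x <# H #> inv x = (\<lambda>y. x \<otimes> y \<otimes> inv x) ` H" for x H
    unfolding l_coset_def r_coset_def by auto
  have b_sp: "wvc b \<in> code_span bs" if "b \<in> set bs" for b bs
    unfolding code_span_def using that by (auto intro: generate.incl)
  have equal: "x <# code_span bs #> inv x = code_span cs"
    if x: "x \<in> carrier G" "\<And>b. b \<in> set bs \<Longrightarrow> x \<otimes> wvc b \<otimes> inv x \<in> code_span cs"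
      "\<And>c. c \<in> set cs \<Longrightarrow> inv x \<otimes> wvc c \<otimes> x \<in> code_span bs" for x
  proof
    show "x <# code_span bs #> inv x \<subseteq> code_span cs"
      unfolding coset using conj_sp_subset[OF x(1) code_span_subgroup[OF cs(1)] bs(1) x(2)] by blast
    show "code_span cs \<subseteq> x <# code_span bs #> inv x"
    proof
      fix y assume y: "y \<in> code_span cs"
      then have "inv x \<otimes> y \<otimes> inv (inv x) \<in> code_span bs"
        using conj_sp_subset[of "inv x", OF _ code_span_subgroup[OF bs(1)] cs(1)] x by simp
      moreover have "y = x \<otimes> (inv x \<otimes> y \<otimes> x) \<otimes> inv x"
        using x(1) code_span_closed[OF cs(1) y] by (simp add: m_assoc)
      ultimately show "y \<in> x <# code_span bs #> inv x" unfolding coset using x(1) by simp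
    qed
  qed
  have test: "(\<forall>b\<in>set bs. span_test cs (inverse_word (list_decode v) @ list_decode b @ list_decode v)) \<longleftrightarrow>
      (\<forall>b\<in>set bs. inv (wvc v) \<otimes> wvc b \<otimes> wvc v \<in> code_span cs)"
    "(\<forall>c\<in>set cs. span_test bs (list_decode v @ list_decode c @ inverse_word (list_decode v))) \<longleftrightarrow>
      (\<forall>c\<in>set cs. wvc v \<otimes> wvc c \<otimes> inv (wvc v) \<in> code_span bs)" if v: "valid v" for v
    using span_test[OF cs wv_conj(1)[OF v]] span_test[OF bs wv_conj(3)[OF v]] wv_conj(2,4)[OF v]
      commuting_codes_valid[OF bs(1)] commuting_codes_valid[OF cs(1)] unfolding valid_iff by auto
  show ?thesis
  proof
    assume "conj_subgroup_test bs cs"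
    then obtain v where v: "valid v" "\<forall>b\<in>set bs. inv (wvc v) \<otimes> wvc b \<otimes> wvc v \<in> code_span cs"
      "\<forall>c\<in>set cs. wvc v \<otimes> wvc c \<otimes> inv (wvc v) \<in> code_span bs"
      unfolding conj_subgroup_test_def using test by blast
    then have "inv (wvc v) <# code_span bs #> inv (inv (wvc v)) = code_span cs"
      using valid_closed[OF v(1)] by (intro equal) auto
    then show "\<exists>x\<in>carrier G. x <# code_span bs #> inv x = code_span cs" using valid_closed[OF v(1)] by blast
  next
    assume "\<exists>x\<in>carrier G. x <# code_span bs #> inv x = code_span cs"
    then obtain x where x: "x \<in> carrier G" "(\<lambda>y. x \<otimes> y \<otimes> inv x) ` code_span bs = code_span cs"
      unfolding coset by blast
    define y where "y = inv x"
    have y: "y \<in> carrier G" "x = inv y" using x(1) unfolding y_def by auto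
    have ysp: "inv y \<otimes> z \<otimes> y \<in> code_span cs" if "z \<in> code_span bs" for z
    proof -
      have "x \<otimes> z \<otimes> inv x \<in> code_span cs" using that unfolding x(2)[symmetric] by blast
      then show ?thesis unfolding y(2) using y(1) by simp
    qed
    define s where "s = list_encode bs + list_encode cs"
    have b1: "bd s a" if a: "a \<in> set (map wvc bs)" for a
    proof -
      obtain b where b: "b \<in> set bs" "a = wvc b" using a by auto
      then have "b \<le> s" using element_le_list_encode[OF b(1)] unfolding s_def by simp
      then show ?thesis using bd_mono[OF bd_wvc[OF commuting_codes_valid[OF bs(1) b(1)]]] b(2) by blast
    qed
    have b2: "length (map wvc bs) \<le> Suc s"
      using length_le_list_encode[of bs] unfolding s_def by simp
    have b3: "inv y \<otimes> a \<otimes> y \<in> code_span cs" if "a \<in> set (map wvc bs)" for a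
      using that ysp b_sp by auto
    have s: "list_encode cs \<le> s" unfolding s_def by simp
    obtain v where v: "v < conj_code_bound s" "valid v"
      "\<And>a. a \<in> set (map wvc bs) \<Longrightarrow> inv (wvc v) \<otimes> a \<otimes> wvc v = inv y \<otimes> a \<otimes> y"
      by (rule bounded_conjugator[OF cs s b1 b2 y(1) b3]) (assumption | rule that)+
    have vc: "wvc v \<in> carrier G" by (rule valid_closed[OF v(2)])
    have vb: "inv (wvc v) \<otimes> wvc b \<otimes> wvc v = inv y \<otimes> wvc b \<otimes> y" if "b \<in> set bs" for b
      using v(3) that by simp
    have "wvc v \<otimes> wvc c \<otimes> inv (wvc v) \<in> code_span bs" if c: "c \<in> set cs" for c
    proof -
      obtain z where z: "z \<in> code_span bs" "wvc c = inv y \<otimes> z \<otimes> y"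
      proof -
        have "wvc c \<in> (\<lambda>y. x \<otimes> y \<otimes> inv x) ` code_span bs" unfolding x(2) by (rule b_sp[OF c])
        then show ?thesis using that y(1) unfolding y(2) by auto
      qed
      define u where "u = wvc v \<otimes> inv y"
      have uc: "u \<in> carrier G" using vc y(1) unfolding u_def by simp
      have "u \<otimes> wvc b \<otimes> inv u \<in> code_span bs" if b: "b \<in> set bs" for b
      proof -
        have bc: "wvc b \<in> carrier G" using commuting_codes_valid[OF bs(1) b] valid_closed by blast
        have "u \<otimes> wvc b \<otimes> inv u = wvc v \<otimes> (inv y \<otimes> wvc b \<otimes> y) \<otimes> inv (wvc v)"
          using vc y(1) bc unfolding u_def by (simp add: inv_mult_group m_assoc)
        also have "\<dots> = wvc b" unfolding vb[OF b, symmetric] using vc bc by (simp add: m_assoc)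
        finally show ?thesis using b_sp[OF b] by simp
      qed
      then have "u \<otimes> z \<otimes> inv u \<in> code_span bs" using conj_sp_subset[OF uc code_span_subgroup[OF bs(1)] bs(1)] z(1) by blast
      moreover have "u \<otimes> z \<otimes> inv u = wvc v \<otimes> wvc c \<otimes> inv (wvc v)"
        unfolding z(2) u_def using vc y(1) code_span_closed[OF bs(1) z(1)] by (simp add: inv_mult_group m_assoc)
      ultimately show ?thesis by simp
    qed
    moreover have "inv (wvc v) \<otimes> wvc b \<otimes> wvc v \<in> code_span cs" if "b \<in> set bs" for b
      using vb[OF that] ysp[OF b_sp[OF that]] by simp
    ultimately show "conj_subgroup_test bs cs"
      unfolding conj_subgroup_test_def s_def[symmetric] using v(1,2) test by blast
  qed
qed

section \<open>Decidability of the tests\<close>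

lemma list_computable_invw:
  assumes "list_computable f" shows "list_computable (\<lambda>x. inverse_word (f x))"
proof -
  have flip: "computable (\<lambda>x. flip (g x))" if "computable g" for g
    by (rule computable_table[OF finite_A that]) (simp add: flip_def)
  show ?thesis unfolding inverse_word_def by (intro computable_intros flip assms)
qed

lemma decidable_eqw:
  "list_computable f \<Longrightarrow> list_computable g \<Longrightarrow> decidable (\<lambda>x. equal_words (f x) (g x))"
  unfolding equal_words_def by (intro decidable_trivial_word list_computable_append list_computable_invw)

lemma decidable_valid: "computable f \<Longrightarrow> decidable (\<lambda>x. valid (f x))"
  unfolding valid_def by (intro computable_intros decidable_finite finite_A)

lemma list_computable_pwl:
  assumes "list_computable f" "list_computable g" shows "list_computable (\<lambda>x. power_word (f x) (g x))"
  unfolding power_word_def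
  by (intro computable_intros assms list_computable_comp[OF assms(1)] list_computable_comp[OF assms(2)])

lemma decidable_mem:
  assumes "computable N" "list_computable f" "list_computable g"
  shows "decidable (\<lambda>x. in_span_upto (N x) (f x) (g x))"
  unfolding in_span_upto_def
  by (intro decidable_eqw list_computable_pwl computable_vbound computable_intros assms
      computable_comp[OF assms(1)] list_computable_comp[OF assms(2)] list_computable_comp[OF assms(3)])

lemma decidable_ind:
  assumes "computable N" "list_computable f" shows "decidable (\<lambda>x. independent_upto (N x) (f x))"
  unfolding independent_upto_def
  by (intro decidable_eqw list_computable_pwl computable_vbound computable_intros assms
      computable_comp[OF assms(1)] list_computable_comp[OF assms(2)])

lemma computable_coeff_bound: "computable f \<Longrightarrow> computable (\<lambda>x. coeff_bound (f x))"
  unfolding coeff_bound_def approx_bound_def by (intro computable_intros)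

lemma computable_conj_code_bound: "computable f \<Longrightarrow> computable (\<lambda>x. conj_code_bound (f x))"
  unfolding conj_code_bound_def conj_bound_def
  by (intro computable_vbound computable_coeff_bound computable_intros)

lemma decidable_is_basis:
  assumes "list_computable f" "list_computable g" "computable N"
  shows "decidable (\<lambda>x. is_basis (f x) (g x) (N x))"
  unfolding is_basis_def
  by (intro decidable_ind decidable_mem decidable_valid computable_coeff_bound computable_intros assms
      computable_comp[OF assms(3)] list_computable_comp[OF assms(1)] list_computable_comp[OF assms(2)])

lemma decidable_span_test:
  "list_computable f \<Longrightarrow> list_computable g \<Longrightarrow> decidable (\<lambda>x. span_test (f x) (g x))"
  unfolding span_test_def by (intro decidable_mem computable_coeff_bound computable_intros)

lemma decidable_conj_test:
  assumes "list_computable f" "list_computable g" shows "decidable (\<lambda>x. conj_test (f x) (g x))"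
  unfolding conj_test_def
  by (intro decidable_span_test decidable_valid computable_conj_code_bound list_computable_invw
      computable_intros assms list_computable_comp[OF assms(1)] list_computable_comp[OF assms(2)])

lemma decidable_subset_test:
  assumes "list_computable f" "list_computable g" shows "decidable (\<lambda>x. subset_test (f x) (g x))"
  unfolding subset_test_def
  by (intro decidable_span_test computable_intros assms
      list_computable_comp[OF assms(1)] list_computable_comp[OF assms(2)])

lemma decidable_conj_subgroup_test:
  assumes "list_computable f" "list_computable g"
  shows "decidable (\<lambda>x. conj_subgroup_test (f x) (g x))"
  unfolding conj_subgroup_test_def
  by (intro decidable_span_test decidable_valid computable_conj_code_bound list_computable_invw
      computable_intros assms list_computable_comp[OF assms(1)] list_computable_comp[OF assms(2)])

section \<open>Algorithms on coded words\<close>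

definition basis_for :: "nat list \<Rightarrow> nat list \<Rightarrow> bool" where
  "basis_for hs bs \<longleftrightarrow> commuting_codes bs \<and> code_span bs = code_span hs \<and> independent (code_value bs) (length bs)"

lemma is_basis_basis_for: "commuting_codes hs \<Longrightarrow> is_basis hs bs N \<Longrightarrow> basis_for hs bs"
  unfolding basis_for_def using is_basis_sound by blast

text \<open>The search finds a pair of a basis and an exponent bound, of which only the basis is
  returned.\<close>

lemma basis_algorithm:
  obtains p where "\<And>hs. commuting_codes hs \<Longrightarrow> \<exists>bs. basis_for hs bs \<and> computes p [list_encode hs] (list_encode bs)"
proof -
  define R where "R c x \<longleftrightarrow> is_basis (list_decode x) (list_decode (nfst c)) (nsnd c)" for c x
  have "decidable (\<lambda>z. R (nfst z) (nsnd z))"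
    unfolding R_def by (intro decidable_is_basis computable_intros)
  moreover have "computable (\<lambda>z. nfst (nfst z))" by (intro computable_basic)
  ultimately obtain p where p: "\<And>x. \<exists>c. R c x \<Longrightarrow>
      \<exists>c. R c x \<and> computes p [x] (nfst (nfst (prod_encode (c, x))))"
    by (rule search_computes) (rule that)
  have "\<exists>bs. basis_for hs bs \<and> computes p [list_encode hs] (list_encode bs)" if hs: "commuting_codes hs" for hs
  proof -
    obtain bs N where "is_basis hs bs N" using is_basis_exists[OF hs] by blast
    then have "R (prod_encode (list_encode bs, N)) (list_encode hs)" unfolding R_def by simp
    then obtain c where c: "R c (list_encode hs)" "computes p [list_encode hs] (nfst c)"
      using p[of "list_encode hs"] by auto
    then have "basis_for hs (list_decode (nfst c))"
      using is_basis_basis_for[OF hs] unfolding R_def by simp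
    then show ?thesis using c(2) by (intro exI[of _ "list_decode (nfst c)"]) simp
  qed
  then show ?thesis using that by blast
qed

text \<open>The basis that the search happens to find stays unspecified; the tests used for
  \<open>T\<close> are correct for every basis of the span.\<close>

lemma basis_test_algorithm:
  assumes "decidable (\<lambda>z. T (list_decode (nfst z)) (list_decode (nsnd z)))"
  obtains p where "\<And>g hs. commuting_codes hs \<Longrightarrow>
    \<exists>bs. basis_for hs bs \<and> computes p [list_encode g, list_encode hs] (of_bool (T bs g))"
proof -
  define R where "R c x \<longleftrightarrow> is_basis (list_decode (nsnd x)) (list_decode (nfst c)) (nsnd c)" for c x
  have "decidable (\<lambda>z. R (nfst z) (nsnd z))"
    unfolding R_def by (intro decidable_is_basis computable_intros)
  moreover have "computable (\<lambda>z. of_bool (T (list_decode (nfst (nfst z))) (list_decode (nfst (nsnd z)))))"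
    using decidable_comp[OF assms, of "\<lambda>z. prod_encode (nfst (nfst z), nfst (nsnd z))"]
    unfolding decidable_def by (simp add: computable_basic)
  ultimately obtain p where p: "\<And>x. \<exists>c. R c x \<Longrightarrow>
      \<exists>c. R c x \<and> computes p [x] (of_bool (T (list_decode (nfst (nfst (prod_encode (c, x)))))
        (list_decode (nfst (nsnd (prod_encode (c, x)))))))"
    by (rule search_computes) (rule that)
  obtain q where q: "\<And>x y v. computes p [prod_encode (x, y)] v \<Longrightarrow> computes q [x, y] v"
    by (rule computes_binary[of p]) (rule that)
  have "\<exists>bs. basis_for hs bs \<and> computes q [list_encode g, list_encode hs] (of_bool (T bs g))"
    if hs: "commuting_codes hs" for g hs
  proof -
    let ?x = "prod_encode (list_encode g, list_encode hs)"
    obtain bs N where "is_basis hs bs N" using is_basis_exists[OF hs] by blast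
    then have "R (prod_encode (list_encode bs, N)) ?x" unfolding R_def by simp
    then obtain c where c: "R c ?x" "computes p [?x] (of_bool (T (list_decode (nfst c)) g))"
      using p[of ?x] by auto
    then have "basis_for hs (list_decode (nfst c))"
      using is_basis_basis_for[OF hs] unfolding R_def by simp
    then show ?thesis using q[OF c(2)] by blast
  qed
  then show ?thesis using that by blast
qed

lemma two_basis_test_algorithm:
  assumes "decidable (\<lambda>z. T (list_decode (nfst z)) (list_decode (nsnd z)))"
  obtains p where "\<And>hs hs'. commuting_codes hs \<Longrightarrow> commuting_codes hs' \<Longrightarrow> \<exists>bs cs. basis_for hs bs \<and> basis_for hs' cs \<and>
    computes p [list_encode hs, list_encode hs'] (of_bool (T bs cs))"
proof -
  define R where "R c x \<longleftrightarrow>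
    is_basis (list_decode (nfst x)) (list_decode (nfst (nfst c))) (nsnd (nfst c)) \<and>
    is_basis (list_decode (nsnd x)) (list_decode (nfst (nsnd c))) (nsnd (nsnd c))" for c x
  have "decidable (\<lambda>z. R (nfst z) (nsnd z))"
    unfolding R_def by (intro decidable_is_basis computable_intros)
  moreover have "computable (\<lambda>z. of_bool (T (list_decode (nfst (nfst (nfst z))))
      (list_decode (nfst (nsnd (nfst z))))))"
    using decidable_comp[OF assms, of "\<lambda>z. prod_encode (nfst (nfst (nfst z)), nfst (nsnd (nfst z)))"]
    unfolding decidable_def by (simp add: computable_basic)
  ultimately obtain p where p: "\<And>x. \<exists>c. R c x \<Longrightarrow>
      \<exists>c. R c x \<and> computes p [x] (of_bool (T (list_decode (nfst (nfst (nfst (prod_encode (c, x))))))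
        (list_decode (nfst (nsnd (nfst (prod_encode (c, x))))))))"
    by (rule search_computes) (rule that)
  obtain q where q: "\<And>x y v. computes p [prod_encode (x, y)] v \<Longrightarrow> computes q [x, y] v"
    by (rule computes_binary[of p]) (rule that)
  have "\<exists>bs cs. basis_for hs bs \<and> basis_for hs' cs \<and>
      computes q [list_encode hs, list_encode hs'] (of_bool (T bs cs))"
    if hs: "commuting_codes hs" "commuting_codes hs'" for hs hs'
  proof -
    let ?x = "prod_encode (list_encode hs, list_encode hs')"
    obtain bs N cs N' where "is_basis hs bs N" "is_basis hs' cs N'" using is_basis_exists hs by blast
    then have "R (prod_encode (prod_encode (list_encode bs, N), prod_encode (list_encode cs, N'))) ?x"
      unfolding R_def by simp
    then obtain c where c: "R c ?x" "computes p [?x]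
        (of_bool (T (list_decode (nfst (nfst c))) (list_decode (nfst (nsnd c)))))"
      using p[of ?x] by auto
    then have "basis_for hs (list_decode (nfst (nfst c)))" "basis_for hs' (list_decode (nfst (nsnd c)))"
      using is_basis_basis_for[OF hs(1)] is_basis_basis_for[OF hs(2)]
      unfolding R_def prod_encode_inverse fst_conv snd_conv list_encode_inverse by blast+
    then show ?thesis using q[OF c(2)] by blast
  qed
  then show ?thesis using that by blast
qed

lemma membership_algorithm:
  obtains p where "\<And>g hs. set g \<subseteq> A \<Longrightarrow> commuting_codes hs \<Longrightarrow>
    computes p [list_encode g, list_encode hs] (of_bool (wv g \<in> code_span hs))"
proof -
  have "decidable (\<lambda>z. span_test (list_decode (nfst z)) (list_decode (nsnd z)))"
    by (intro decidable_span_test computable_intros)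
  then obtain p where p: "\<And>g hs. commuting_codes hs \<Longrightarrow>
      \<exists>bs. basis_for hs bs \<and> computes p [list_encode g, list_encode hs] (of_bool (span_test bs g))"
    by (rule basis_test_algorithm) (rule that)
  show ?thesis
  proof (rule that)
    fix g hs assume g: "set g \<subseteq> A" and hs: "commuting_codes hs"
    obtain bs where bs: "basis_for hs bs"
      "computes p [list_encode g, list_encode hs] (of_bool (span_test bs g))"
      using p[OF hs] by blast
    have "span_test bs g \<longleftrightarrow> (wv g \<in> code_span hs)"
      using bs(1) span_test[OF _ _ g, of bs] unfolding basis_for_def by simp
    then show "computes p [list_encode g, list_encode hs] (of_bool (wv g \<in> code_span hs))"
      using bs(2) by simp
  qed
qed

lemma conjugacy_membership_algorithm:
  obtains p where "\<And>g hs. set g \<subseteq> A \<Longrightarrow> commuting_codes hs \<Longrightarrow>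
    computes p [list_encode g, list_encode hs] (of_bool (\<exists>x\<in>carrier G. x \<otimes> wv g \<otimes> inv x \<in> code_span hs))"
proof -
  have "decidable (\<lambda>z. conj_test (list_decode (nfst z)) (list_decode (nsnd z)))"
    by (intro decidable_conj_test computable_intros)
  then obtain p where p: "\<And>g hs. commuting_codes hs \<Longrightarrow>
      \<exists>bs. basis_for hs bs \<and> computes p [list_encode g, list_encode hs] (of_bool (conj_test bs g))"
    by (rule basis_test_algorithm) (rule that)
  show ?thesis
  proof (rule that)
    fix g hs assume g: "set g \<subseteq> A" and hs: "commuting_codes hs"
    obtain bs where bs: "basis_for hs bs"
      "computes p [list_encode g, list_encode hs] (of_bool (conj_test bs g))"
      using p[OF hs] by blast
    have "conj_test bs g \<longleftrightarrow> (\<exists>x\<in>carrier G. x \<otimes> wv g \<otimes> inv x \<in> code_span hs)"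
      using bs(1) conj_test[OF _ _ g, of bs] unfolding basis_for_def by simp
    then show "computes p [list_encode g, list_encode hs] (of_bool (\<exists>x\<in>carrier G. x \<otimes> wv g \<otimes> inv x \<in> code_span hs))"
      using bs(2) by simp
  qed
qed

lemma equality_algorithm:
  obtains p where "\<And>hs hs'. commuting_codes hs \<Longrightarrow> commuting_codes hs' \<Longrightarrow>
    computes p [list_encode hs, list_encode hs'] (of_bool (code_span hs = code_span hs'))"
proof -
  define T where "T bs cs \<longleftrightarrow> subset_test bs cs \<and> subset_test cs bs" for bs cs
  have "decidable (\<lambda>z. T (list_decode (nfst z)) (list_decode (nsnd z)))"
    unfolding T_def by (intro decidable_subset_test computable_intros)
  then obtain p where p: "\<And>hs hs'. commuting_codes hs \<Longrightarrow> commuting_codes hs' \<Longrightarrow> \<exists>bs cs. basis_for hs bs \<and>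
      basis_for hs' cs \<and> computes p [list_encode hs, list_encode hs'] (of_bool (T bs cs))"
    by (rule two_basis_test_algorithm) (rule that)
  have T: "T bs cs \<longleftrightarrow> code_span hs = code_span hs'" if "basis_for hs bs" "basis_for hs' cs" for hs hs' bs cs
    using that subset_test[of bs cs] subset_test[of cs bs] unfolding T_def basis_for_def by auto
  show ?thesis
  proof (rule that)
    fix hs hs' assume hs: "commuting_codes hs" "commuting_codes hs'"
    obtain bs cs where bs: "basis_for hs bs" "basis_for hs' cs"
      "computes p [list_encode hs, list_encode hs'] (of_bool (T bs cs))"
      using p[OF hs] by blast
    then show "computes p [list_encode hs, list_encode hs'] (of_bool (code_span hs = code_span hs'))"
      using T by simp
  qed
qed

lemma conjugacy_algorithm:
  obtains p where "\<And>hs hs'. commuting_codes hs \<Longrightarrow> commuting_codes hs' \<Longrightarrow> computes p [list_encode hs, list_encode hs']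
    (of_bool (\<exists>x\<in>carrier G. x <# code_span hs #> inv x = code_span hs'))"
proof -
  have "decidable (\<lambda>z. conj_subgroup_test (list_decode (nfst z)) (list_decode (nsnd z)))"
    by (intro decidable_conj_subgroup_test computable_intros)
  then obtain p where p: "\<And>hs hs'. commuting_codes hs \<Longrightarrow> commuting_codes hs' \<Longrightarrow> \<exists>bs cs. basis_for hs bs \<and>
      basis_for hs' cs \<and> computes p [list_encode hs, list_encode hs'] (of_bool (conj_subgroup_test bs cs))"
    by (rule two_basis_test_algorithm) (rule that)
  show ?thesis
  proof (rule that)
    fix hs hs' assume hs: "commuting_codes hs" "commuting_codes hs'"
    obtain bs cs where bs: "basis_for hs bs" "basis_for hs' cs"
      "computes p [list_encode hs, list_encode hs'] (of_bool (conj_subgroup_test bs cs))"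
      using p[OF hs] by blast
    have "conj_subgroup_test bs cs \<longleftrightarrow> (\<exists>x\<in>carrier G. x <# code_span hs #> inv x = code_span hs')"
      using bs(1,2) conj_subgroup_test[of bs cs] unfolding basis_for_def by simp
    then show "computes p [list_encode hs, list_encode hs']
        (of_bool (\<exists>x\<in>carrier G. x <# code_span hs #> inv x = code_span hs'))"
      using bs(3) by simp
  qed
qed

lemma independent_lin_indep:
  assumes "independent (code_value bs) (length bs)" shows "lin_indep G (map wvc bs)"
  unfolding lin_indep_def
proof (intro allI impI ballI)
  fix cs :: "int list" and c
  assume cs: "length cs = length (map wvc bs)" and c: "c \<in> set cs"
    and one: "word_prod G (map2 (\<lambda>g c. g [^] c) (map wvc bs) cs) = \<one>"
  have "map2 (\<lambda>g c. g [^] c) (map wvc bs) cs = map (\<lambda>i. code_value bs i [^] (cs ! i)) [0..<length bs]"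
    using cs by (intro nth_equalityI) (auto simp: code_value_def nth_default_def)
  then have "mpow (code_value bs) ((!) cs) (length bs) = \<one>" using one unfolding mpow_def by simp
  moreover obtain i where "i < length bs" "c = cs ! i" using c cs by (auto simp: in_set_conv_nth)
  ultimately show "c = 0" using assms unfolding independent_def by blast
qed

end

section \<open>Words in simple elements as numbers\<close>

definition letter_code :: "('m \<Rightarrow> nat) \<Rightarrow> 'm \<times> bool \<Rightarrow> nat" where
  "letter_code \<nu> = (\<lambda>(d, s). prod_encode (\<nu> d, of_bool s))"

locale numbered_garside_group = garside_group M \<Delta> G \<iota>
  for M (structure) and \<Delta> and G (structure) and \<iota> +
  fixes \<nu> :: "'a \<Rightarrow> nat"
  assumes numbering: "inj_on \<nu> (simples M \<Delta>)"
begin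

definition letters :: "nat set" where "letters = letter_code \<nu> ` (simples M \<Delta> \<times> UNIV)"
definition letter_value :: "nat \<Rightarrow> 'c" where
  "letter_value n = letter_val G \<iota> (inv_into (simples M \<Delta> \<times> UNIV) (letter_code \<nu>) n)"

lemma letter_code_inj: "inj_on (letter_code \<nu>) (simples M \<Delta> \<times> UNIV)"
  using numbering unfolding inj_on_def letter_code_def by auto

lemma letter_value: "x \<in> simples M \<Delta> \<times> UNIV \<Longrightarrow> letter_value (letter_code \<nu> x) = letter_val G \<iota> x"
  unfolding letter_value_def using inv_into_f_f[OF letter_code_inj] by simp

sublocale coded_letters G "\<iota> ` carrier M" "\<iota> \<Delta>" letters letter_value
proof -
  interpret C: garside_cone G "\<iota> ` carrier M" "\<iota> \<Delta>" by (rule garside_cone)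
  have D: "C.D = \<iota> ` simples M \<Delta>" unfolding C.D_def C.le_def by (rule positive_interval_simples)
  have val: "letter_value (letter_code \<nu> (d, True)) = \<iota> d"
    "letter_value (letter_code \<nu> (d, False)) = inv\<^bsub>G\<^esub> (\<iota> d)" if "d \<in> simples M \<Delta>" for d
    using that letter_value unfolding letter_val_def by simp_all
  show "coded_letters G (\<iota> ` carrier M) (\<iota> \<Delta>) letters letter_value"
  proof (intro coded_letters.intro coded_letters_axioms.intro)
    show "garside_cone G (\<iota> ` carrier M) (\<iota> \<Delta>)" by (rule garside_cone)
    show "finite letters" unfolding letters_def using finite_simples by simp
    show "letter_value a \<in> C.D \<or> inv\<^bsub>G\<^esub> (letter_value a) \<in> C.D \<and> letter_value a \<in> carrier G"
      if a: "a \<in> letters" for a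
    proof -
      obtain d s where d: "d \<in> simples M \<Delta>" "a = letter_code \<nu> (d, s)" using a unfolding letters_def by auto
      then show ?thesis unfolding D using val[OF d(1)] iota_closed simple_closed by (cases s) auto
    qed
    show "\<exists>a\<in>letters. letter_value a = d" if "d \<in> C.D" for d
      using that val(1) unfolding D letters_def by blast
    show "\<exists>a\<in>letters. letter_value a = inv\<^bsub>G\<^esub> d" if "d \<in> C.D" for d
      using that val(2) unfolding D letters_def by blast
  qed
qed

lemma word_code_decode: "list_decode (word_code \<nu> w) = map (letter_code \<nu>) w"
  unfolding word_code_def letter_code_def by simp

lemma valid_word_code: "w \<in> swords M \<Delta> \<Longrightarrow> set (list_decode (word_code \<nu> w)) \<subseteq> letters"
  unfolding word_code_decode letters_def swords_def by auto

lemma wvc_word_code: "w \<in> swords M \<Delta> \<Longrightarrow> wvc (word_code \<nu> w) = word_val G \<iota> w"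
proof -
  assume "w \<in> swords M \<Delta>"
  then have "map letter_value (map (letter_code \<nu>) w) = map (letter_val G \<iota>) w"
    unfolding swords_def by (auto simp: letter_value)
  then show ?thesis unfolding wv_def word_val_def word_code_decode by (simp only:)
qed

text \<open>Needed for the basis problem, whose output has to consist of words in the simple
  elements again.\<close>

lemma valid_is_word_code: assumes "valid c" shows "\<exists>w\<in>swords M \<Delta>. word_code \<nu> w = c"
proof -
  have "list_decode c \<in> lists (letter_code \<nu> ` (simples M \<Delta> \<times> UNIV))"
    using assms unfolding valid_def letters_def[symmetric] by auto
  then obtain w where "w \<in> lists (simples M \<Delta> \<times> UNIV)" "list_decode c = map (letter_code \<nu>) w"
    unfolding lists_image by blast
  then show ?thesis
    unfolding swords_def word_code_def letter_code_def[symmetric]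
    by (metis list_decode_inverse)
qed

lemma words_code_eq: "words_code \<nu> ws = list_encode (map (word_code \<nu>) ws)"
  unfolding words_code_def ..

lemma wvc_word_codes:
  "ws \<in> lists (swords M \<Delta>) \<Longrightarrow> map wvc (map (word_code \<nu>) ws) = map (word_val G \<iota>) ws"
  by (auto simp: wvc_word_code)

lemma code_span_word_codes: "ws \<in> lists (swords M \<Delta>) \<Longrightarrow> code_span (map (word_code \<nu>) ws) = word_span G \<iota> ws"
  using arg_cong[OF wvc_word_codes, of ws set] unfolding code_span_def word_span_def by (simp add: image_image)

lemma commuting_codes_word_codes: "ws \<in> commuting_words M \<Delta> G \<iota> \<Longrightarrow> commuting_codes (map (word_code \<nu>) ws)"
proof -
  assume ws: "ws \<in> commuting_words M \<Delta> G \<iota>"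
  have "w \<in> swords M \<Delta>" if "w \<in> set ws" for w
    using ws that unfolding commuting_words_def by auto
  then have "valid (word_code \<nu> w)" "wvc (word_code \<nu> w) = word_val G \<iota> w" if "w \<in> set ws" for w
    using valid_word_code wvc_word_code that unfolding valid_iff by simp_all
  then show ?thesis using ws unfolding commuting_codes_def commuting_words_def by simp
qed

end

theorem theoremC:
  fixes M :: "('m, 'r) monoid_scheme" and \<Delta> :: 'm
    and G :: "('g, 's) monoid_scheme" and \<iota> :: "'m \<Rightarrow> 'g" and \<nu> :: "'m \<Rightarrow> nat"
  assumes "garside_group M \<Delta> G \<iota>"
    and "inj_on \<nu> (simples M \<Delta>)"
  shows
    "(\<exists>p. \<forall>hs \<in> commuting_words M \<Delta> G \<iota>.
        \<exists>bs \<in> lists (swords M \<Delta>).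
          computes p [words_code \<nu> hs] (words_code \<nu> bs) \<and>
          basis_of G (word_span G \<iota> hs) (map (word_val G \<iota>) bs)) \<and>
     (\<exists>p. \<forall>g \<in> swords M \<Delta>. \<forall>hs \<in> commuting_words M \<Delta> G \<iota>.
        computes p [word_code \<nu> g, words_code \<nu> hs]
          (of_bool (word_val G \<iota> g \<in> word_span G \<iota> hs))) \<and>
     (\<exists>p. \<forall>g \<in> swords M \<Delta>. \<forall>hs \<in> commuting_words M \<Delta> G \<iota>.
        computes p [word_code \<nu> g, words_code \<nu> hs]
          (of_bool (\<exists>x \<in> carrier G.
             x \<otimes>\<^bsub>G\<^esub> word_val G \<iota> g \<otimes>\<^bsub>G\<^esub> inv\<^bsub>G\<^esub> x \<in> word_span G \<iota> hs))) \<and>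
     (\<exists>p. \<forall>hs \<in> commuting_words M \<Delta> G \<iota>. \<forall>hs' \<in> commuting_words M \<Delta> G \<iota>.
        computes p [words_code \<nu> hs, words_code \<nu> hs']
          (of_bool (word_span G \<iota> hs = word_span G \<iota> hs'))) \<and>
     (\<exists>p. \<forall>hs \<in> commuting_words M \<Delta> G \<iota>. \<forall>hs' \<in> commuting_words M \<Delta> G \<iota>.
        computes p [words_code \<nu> hs, words_code \<nu> hs']
          (of_bool (\<exists>x \<in> carrier G.
             x <#\<^bsub>G\<^esub> word_span G \<iota> hs #>\<^bsub>G\<^esub> inv\<^bsub>G\<^esub> x = word_span G \<iota> hs')))"
proof -
  interpret numbered_garside_group M \<Delta> G \<iota> \<nu>
    by (intro numbered_garside_group.intro numbered_garside_group_axioms.intro assms)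
  let ?C = "commuting_words M \<Delta> G \<iota>"
  have words: "hs \<in> lists (swords M \<Delta>)" if "hs \<in> ?C" for hs
    using that unfolding commuting_words_def by blast
  have span: "code_span (map (word_code \<nu>) hs) = word_span G \<iota> hs" if "hs \<in> ?C" for hs
    by (rule code_span_word_codes[OF words[OF that]])
  have enc: "word_code \<nu> g = list_encode (list_decode (word_code \<nu> g))" for g by simp
  show ?thesis
  proof (intro conjI)
    obtain p where p: "\<And>hs. commuting_codes hs \<Longrightarrow> \<exists>bs. basis_for hs bs \<and> computes p [list_encode hs] (list_encode bs)"
      by (rule basis_algorithm) (rule that)
    have "\<exists>bs \<in> lists (swords M \<Delta>). computes p [words_code \<nu> hs] (words_code \<nu> bs) \<and>
        basis_of G (word_span G \<iota> hs) (map (word_val G \<iota>) bs)" if hs: "hs \<in> ?C" for hs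
    proof -
      obtain cs where cs: "basis_for (map (word_code \<nu>) hs) cs"
        "computes p [words_code \<nu> hs] (list_encode cs)"
        using p[OF commuting_codes_word_codes[OF hs]] unfolding words_code_eq by blast
      have "\<forall>c\<in>set cs. \<exists>w\<in>swords M \<Delta>. word_code \<nu> w = c"
        using cs(1) valid_is_word_code unfolding basis_for_def commuting_codes_def by blast
      then have "cs \<in> lists (word_code \<nu> ` swords M \<Delta>)" by (auto simp: image_iff)
      then obtain bs where bs: "bs \<in> lists (swords M \<Delta>)" "cs = map (word_code \<nu>) bs"
        unfolding lists_image by blast
      have wv: "map wvc cs = map (word_val G \<iota>) bs" unfolding bs(2) by (rule wvc_word_codes[OF bs(1)])
      have code_span: "code_span cs = word_span G \<iota> hs" using cs(1) span[OF hs] unfolding basis_for_def by simp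
      have set: "wvc ` set cs = set (map (word_val G \<iota>) bs)" unfolding wv[symmetric] by simp
      have "lin_indep G (map (word_val G \<iota>) bs)"
        using independent_lin_indep[of cs] cs(1) unfolding basis_for_def wv by blast
      moreover have "generate G (set (map (word_val G \<iota>) bs)) = word_span G \<iota> hs"
        using code_span unfolding code_span_def set .
      moreover have "set (map (word_val G \<iota>) bs) \<subseteq> generate G (set (map (word_val G \<iota>) bs))"
        by (auto intro: generate.incl)
      ultimately have "basis_of G (word_span G \<iota> hs) (map (word_val G \<iota>) bs)"
        unfolding basis_of_def by simp
      then show ?thesis using bs cs(2) unfolding words_code_eq by blast
    qed
    then show "\<exists>p. \<forall>hs \<in> ?C. \<exists>bs \<in> lists (swords M \<Delta>).
        computes p [words_code \<nu> hs] (words_code \<nu> bs) \<and>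
        basis_of G (word_span G \<iota> hs) (map (word_val G \<iota>) bs)" by blast
  next
    obtain p where p: "\<And>g hs. set g \<subseteq> letters \<Longrightarrow> commuting_codes hs \<Longrightarrow>
        computes p [list_encode g, list_encode hs] (of_bool (wv g \<in> code_span hs))"
      by (rule membership_algorithm) (rule that)
    have "computes p [word_code \<nu> g, words_code \<nu> hs] (of_bool (word_val G \<iota> g \<in> word_span G \<iota> hs))"
      if "g \<in> swords M \<Delta>" "hs \<in> ?C" for g hs
      using p[OF valid_word_code[OF that(1)] commuting_codes_word_codes[OF that(2)]]
      by (simp add: span[OF that(2)] wvc_word_code[OF that(1)] words_code_eq)
    then show "\<exists>p. \<forall>g \<in> swords M \<Delta>. \<forall>hs \<in> ?C. computes p [word_code \<nu> g, words_code \<nu> hs]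
        (of_bool (word_val G \<iota> g \<in> word_span G \<iota> hs))" by blast
  next
    obtain p where p: "\<And>g hs. set g \<subseteq> letters \<Longrightarrow> commuting_codes hs \<Longrightarrow>
        computes p [list_encode g, list_encode hs]
          (of_bool (\<exists>x\<in>carrier G. x \<otimes>\<^bsub>G\<^esub> wv g \<otimes>\<^bsub>G\<^esub> inv\<^bsub>G\<^esub> x \<in> code_span hs))"
      by (rule conjugacy_membership_algorithm) (rule that)
    have "computes p [word_code \<nu> g, words_code \<nu> hs] (of_bool (\<exists>x \<in> carrier G.
        x \<otimes>\<^bsub>G\<^esub> word_val G \<iota> g \<otimes>\<^bsub>G\<^esub> inv\<^bsub>G\<^esub> x \<in> word_span G \<iota> hs))"
      if "g \<in> swords M \<Delta>" "hs \<in> ?C" for g hs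
      using p[OF valid_word_code[OF that(1)] commuting_codes_word_codes[OF that(2)]]
      by (simp add: span[OF that(2)] wvc_word_code[OF that(1)] words_code_eq)
    then show "\<exists>p. \<forall>g \<in> swords M \<Delta>. \<forall>hs \<in> ?C. computes p [word_code \<nu> g, words_code \<nu> hs]
        (of_bool (\<exists>x \<in> carrier G.
          x \<otimes>\<^bsub>G\<^esub> word_val G \<iota> g \<otimes>\<^bsub>G\<^esub> inv\<^bsub>G\<^esub> x \<in> word_span G \<iota> hs))" by blast
  next
    obtain p where p: "\<And>hs hs'. commuting_codes hs \<Longrightarrow> commuting_codes hs' \<Longrightarrow>
        computes p [list_encode hs, list_encode hs'] (of_bool (code_span hs = code_span hs'))"
      by (rule equality_algorithm) (rule that)
    have "computes p [words_code \<nu> hs, words_code \<nu> hs']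
        (of_bool (word_span G \<iota> hs = word_span G \<iota> hs'))" if "hs \<in> ?C" "hs' \<in> ?C" for hs hs'
      using p[OF commuting_codes_word_codes[OF that(1)] commuting_codes_word_codes[OF that(2)]]
      by (simp add: span[OF that(1)] span[OF that(2)] words_code_eq)
    then show "\<exists>p. \<forall>hs \<in> ?C. \<forall>hs' \<in> ?C. computes p [words_code \<nu> hs, words_code \<nu> hs']
        (of_bool (word_span G \<iota> hs = word_span G \<iota> hs'))" by blast
  next
    obtain p where p: "\<And>hs hs'. commuting_codes hs \<Longrightarrow> commuting_codes hs' \<Longrightarrow> computes p [list_encode hs, list_encode hs']
        (of_bool (\<exists>x\<in>carrier G. x <#\<^bsub>G\<^esub> code_span hs #>\<^bsub>G\<^esub> inv\<^bsub>G\<^esub> x = code_span hs'))"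
      by (rule conjugacy_algorithm) (rule that)
    have "computes p [words_code \<nu> hs, words_code \<nu> hs'] (of_bool (\<exists>x \<in> carrier G.
        x <#\<^bsub>G\<^esub> word_span G \<iota> hs #>\<^bsub>G\<^esub> inv\<^bsub>G\<^esub> x = word_span G \<iota> hs'))"
      if "hs \<in> ?C" "hs' \<in> ?C" for hs hs'
      using p[OF commuting_codes_word_codes[OF that(1)] commuting_codes_word_codes[OF that(2)]]
      by (simp add: span[OF that(1)] span[OF that(2)] words_code_eq)
    then show "\<exists>p. \<forall>hs \<in> ?C. \<forall>hs' \<in> ?C. computes p [words_code \<nu> hs, words_code \<nu> hs']
        (of_bool (\<exists>x \<in> carrier G.
          x <#\<^bsub>G\<^esub> word_span G \<iota> hs #>\<^bsub>G\<^esub> inv\<^bsub>G\<^esub> x = word_span G \<iota> hs'))" by blast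
  qed
qed

end
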